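(* Let $\theta \in (-\pi/2,\pi/2)$. Then there exist $\varepsilon>0$ and a real-analytic function $f_\theta$ on the sphere $\partial B_\varepsilon$, where $B_\varepsilon\subset\mathbb{R}^3$ is the ball of radius $\varepsilon$ centered at the origin, such that the unique Harvey-Lawson solution $u_\theta$ of the Dirichlet problem $$\mathbf{F}_\theta(D^2u)=\arctan\lambda_1+\arctan\lambda_2+\arctan\lambda_3-\theta=0 \ \text{ in } B_\varepsilon,\qquad u=f_\theta \ \text{ on } \partial B_\varepsilon,$$ (where $\lambda_1,\lambda_2,\lambda_3$ are the eigenvalues of $D^2u$) satisfies: (i) $u_\theta\in C^{1,1/3}(B_\varepsilon)$; (ii) $u_\theta\notin C^{1,\delta}(B_\varepsilon)$ for every $\delta>1/3$.
   Context: $\mathrm{Sym}^2(\mathbb{R}^3)$ denotes the space of real symmetric $3\times 3$ matrices; $\lambda_1(A),\lambda_2(A),\lambda_3(A)$ are the eigenvalues of $A$; $D^2u$ is the Hessian. For $\theta\in(-\pi/2,\pi/2)$ put $$F=F_\theta=\{A\in \mathrm{Sym}^2(\mathbb{R}^3): \arctan\lambda_1(A)+\arctan\lambda_2(A)+\arctan\lambda_3(A)\ge\theta\}.$$ This is a closed set with $F+\mathcal{P}\subset F$, where $\mathcal{P}$ is the set of non-negative definite matrices (a "Dirichlet set"). Its Dirichlet dual is $\tilde F=-(\mathrm{Sym}^2(\mathbb{R}^3)\setminus \mathrm{Int}\,F)$, which equals $\{A:\sum_i\arctan\lambda_i(A)\ge-\theta\}$. Definitions (Harvey-Lawson). Let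 $\Omega\subset\mathbb{R}^3$ be open. - An upper semi-continuous function $w$ on $\Omega$ is subaffine if for each closed ball $\bar B'\subset\Omega$ and each affine function $a$, $w\le a$ on $\partial B'$ implies $w\le a$ on $\bar B'$. - A $C^2$ function $v$ is of type $\tilde F$ if $D^2v(x)\in\tilde F$ for all $x$ in its domain (and similarly with $F$ in place of $\tilde F$). - An upper semi-continuous function $u$ on $\Omega$ is of type $F$ if for every open ball $B'\subset\Omega$ and every $v\in C^2(B')$ of type $\tilde F$, the function $u+v$ is subaffine on $B'$. Type $\tilde F$ for upper semi-continuous functions is defined in the same way with the roles of $F$ and $\tilde F$ exchanged. - $u$ is $F$-Dirichlet on $\Omega$ if $u$ is of type $F$ and $-u$ is of type $\tilde F$ on $\Omega$. The Harvey-Lawson solution of the Dirichlet problem on a ball $B$ with continuous boundary data $\varphi$ is the function $u\in C(\bar B)$ which is $F$-Dirichlet on $B$ and equals $\varphi$ on $\partial B$; by a theorem of Harvey and Lawson it exists and is unique for every $\varphi\in C(\partial B)$. *)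

theory Defs
  imports "HOL-Analysis.Analysis" "HOL-Computational_Algebra.Polynomial"
begin

type_synonym mat3 = "real^3^3"

definition Sym2 :: "mat3 set" where
  "Sym2 = {A. transpose A = A}"

definition charpoly :: "mat3 \<Rightarrow> real poly" where
  "charpoly A = det (\<chi> i j. (if i = j then [:0, 1:] else 0) - [:A $ i $ j:])"

text \<open>Real eigenvalues with algebraic multiplicity; a multiset of size 3 when
  \<open>A \<in> Sym2\<close>, the only case in which it is used.\<close>

definition eigenvalues :: "mat3 \<Rightarrow> real multiset" where
  "eigenvalues A = proots (charpoly A)"

definition F_set :: "real \<Rightarrow> mat3 set" where
  "F_set \<theta> = {A \<in> Sym2. (\<Sum>l\<in>#eigenvalues A. arctan l) \<ge> \<theta>}"

text \<open>The interior is taken in the space of symmetric matrices, not in \<open>mat3\<close>, where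
  \<open>F_set \<theta>\<close> has empty interior.\<close>

definition dirichlet_dual :: "mat3 set \<Rightarrow> mat3 set" where
  "dirichlet_dual G = uminus ` (Sym2 - (top_of_set Sym2) interior_of G)"

definition usc_on :: "(real^3) set \<Rightarrow> (real^3 \<Rightarrow> real) \<Rightarrow> bool" where
  "usc_on \<Omega> w \<longleftrightarrow> (\<forall>c. openin (top_of_set \<Omega>) {x \<in> \<Omega>. w x < c})"

definition subaffine_on :: "(real^3) set \<Rightarrow> (real^3 \<Rightarrow> real) \<Rightarrow> bool" where
  "subaffine_on \<Omega> w \<longleftrightarrow> usc_on \<Omega> w \<and>
    (\<forall>c r p b. r > 0 \<longrightarrow> cball c r \<subseteq> \<Omega> \<longrightarrow>
      (\<forall>x\<in>sphere c r. w x \<le> p \<bullet> x + b) \<longrightarrow>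
      (\<forall>x\<in>cball c r. w x \<le> p \<bullet> x + b))"

definition grad :: "(real^3 \<Rightarrow> real) \<Rightarrow> real^3 \<Rightarrow> real^3" where
  "grad v x = (\<chi> i. frechet_derivative v (at x) (axis i 1))"

definition hessian :: "(real^3 \<Rightarrow> real) \<Rightarrow> real^3 \<Rightarrow> mat3" where
  "hessian v x = jacobian (grad v) (at x)"

text \<open>For open \<open>\<Omega>\<close>.\<close>

definition C2_on :: "(real^3) set \<Rightarrow> (real^3 \<Rightarrow> real) \<Rightarrow> bool" where
  "C2_on \<Omega> v \<longleftrightarrow> (\<forall>x\<in>\<Omega>. v differentiable (at x)) \<and>
    (\<forall>x\<in>\<Omega>. grad v differentiable (at x)) \<and> continuous_on \<Omega> (hessian v)"

definition C2_of_type :: "mat3 set \<Rightarrow> (real^3) set \<Rightarrow> (real^3 \<Rightarrow> real) \<Rightarrow> bool" where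
  "C2_of_type G \<Omega> v \<longleftrightarrow> C2_on \<Omega> v \<and> (\<forall>x\<in>\<Omega>. hessian v x \<in> G)"

text \<open>The set \<open>G\<close> constrains the test functions: \<open>u\<close> is of type \<open>F\<close> when tested against the
  dual of \<open>F\<close>, and of dual type when tested against \<open>F\<close> itself.\<close>

definition usc_tested_by :: "mat3 set \<Rightarrow> (real^3) set \<Rightarrow> (real^3 \<Rightarrow> real) \<Rightarrow> bool" where
  "usc_tested_by G \<Omega> u \<longleftrightarrow> usc_on \<Omega> u \<and>
    (\<forall>c r v. r > 0 \<longrightarrow> ball c r \<subseteq> \<Omega> \<longrightarrow> C2_of_type G (ball c r) v \<longrightarrow>
      subaffine_on (ball c r) (\<lambda>x. u x + v x))"

definition of_type :: "mat3 set \<Rightarrow> (real^3) set \<Rightarrow> (real^3 \<Rightarrow> real) \<Rightarrow> bool" where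
  "of_type F \<Omega> u \<longleftrightarrow> usc_tested_by (dirichlet_dual F) \<Omega> u"

definition of_dual_type :: "mat3 set \<Rightarrow> (real^3) set \<Rightarrow> (real^3 \<Rightarrow> real) \<Rightarrow> bool" where
  "of_dual_type F \<Omega> u \<longleftrightarrow> usc_tested_by F \<Omega> u"

definition F_Dirichlet :: "mat3 set \<Rightarrow> (real^3) set \<Rightarrow> (real^3 \<Rightarrow> real) \<Rightarrow> bool" where
  "F_Dirichlet F \<Omega> u \<longleftrightarrow> of_type F \<Omega> u \<and> of_dual_type F \<Omega> (\<lambda>x. - u x)"

text \<open>Only the values of \<open>u\<close> on the closed ball matter.\<close>

definition HL_solution ::
    "mat3 set \<Rightarrow> real^3 \<Rightarrow> real \<Rightarrow> (real^3 \<Rightarrow> real) \<Rightarrow> (real^3 \<Rightarrow> real) \<Rightarrow> bool" where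
  "HL_solution F c r \<phi> u \<longleftrightarrow> continuous_on (cball c r) u \<and>
    F_Dirichlet F (ball c r) u \<and> (\<forall>x\<in>sphere c r. u x = \<phi> x)"

text \<open>Multi-indices are functions \<open>3 \<Rightarrow> nat\<close>; \<open>has_sum\<close> is unordered, hence absolute,
  convergence.\<close>

definition real_analytic_at :: "(real^3 \<Rightarrow> real) \<Rightarrow> real^3 \<Rightarrow> bool" where
  "real_analytic_at g a \<longleftrightarrow> (\<exists>r>0. \<exists>c :: (3 \<Rightarrow> nat) \<Rightarrow> real. \<forall>x\<in>ball a r.
    ((\<lambda>\<alpha>. c \<alpha> * (\<Prod>i\<in>UNIV. (x $ i - a $ i) ^ \<alpha> i)) has_sum g x) UNIV)"

text \<open>For an analytic submanifold \<open>S\<close> (here a sphere), analyticity in local analytic charts is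
  the same as being locally the restriction of an analytic function of the ambient space.\<close>

definition real_analytic_on :: "(real^3 \<Rightarrow> real) \<Rightarrow> (real^3) set \<Rightarrow> bool" where
  "real_analytic_on f S \<longleftrightarrow> (\<forall>p\<in>S. \<exists>g. real_analytic_at g p \<and>
    (\<exists>r>0. \<forall>x\<in>S \<inter> ball p r. f x = g x))"

text \<open>The space \<open>C\<^sup>1\<^sup>,\<^sup>\<alpha>(\<Omega>)\<close>, for \<open>\<Omega>\<close> a ball: one Hoelder constant for the gradient on all of
  \<open>\<Omega>\<close>. On a ball this makes the function and its gradient bounded, so the full norm is finite.\<close>

definition C1_Hoelder_on :: "real \<Rightarrow> (real^3) set \<Rightarrow> (real^3 \<Rightarrow> real) \<Rightarrow> bool" where
  "C1_Hoelder_on \<alpha> \<Omega> u \<longleftrightarrow> (\<forall>x\<in>\<Omega>. u differentiable (at x)) \<and> continuous_on \<Omega> (grad u) \<and>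
    (\<exists>C. \<forall>x\<in>\<Omega>. \<forall>y\<in>\<Omega>. norm (grad u x - grad u y) \<le> C * dist x y powr \<alpha>)"

end

theory Submission
  imports Defs "HOL-Complex_Analysis.Complex_Analysis"
begin

text \<open>A special Lagrangian graph is sought as the envelope of the quadrics
  \<open>\<Phi> s X = (\<Sum>j. m j s * (X j)\<^sup>2) / 2 + h s\<close>: the solution is \<open>U X = \<Phi> (\<sigma> X) X\<close>, where \<open>\<sigma> X\<close> is the critical
  value of \<open>s\<close>, the root of \<open>G s X = (\<Sum>j. p j s * (X j)\<^sup>2) - K\<close>. The Hessian is then a diagonal matrix plus a
  matrix of rank one, and the equation becomes a system of ordinary differential equations for the
  angles \<open>arctan (m j s)\<close>, which is solved by quadratures (these are Joyce's evolving
  quadrics). The integration constants are chosen so that near the point \<open>(1, 0, 0)\<close>, which is moved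
  to the origin, \<open>G\<close> grows like \<open>s\<^sup>3\<close> along the first axis and its \<open>s\<close>-derivative vanishes at no
  other point. Hence \<open>\<sigma>\<close> and the gradient of \<open>U\<close> are Hoelder continuous with exponent exactly
  \<open>1/3\<close>, and \<open>U\<close> is smooth off the origin. There, \<open>\<sigma>\<close> is a simple root of a function
  holomorphic in \<open>s\<close>; expanding a contour integral into a multiple power series shows that \<open>U\<close> is
  real analytic.

  An isolated singularity at which the function is differentiable is invisible to the comparison
  arguments. If a maximum of a difference of functions cannot be moved away from the origin by
  adding any small linear function, the difference lies below a cone with vertex at the origin,
  which contradicts differentiability, or the existence of smooth test functions.\<close>

text \<open>Each level set of \<open>\<sigma>\<close> is a piece of a quadric, and on it the
  gradient of \<open>U\<close> is the restriction of a diagonal linear map. Because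
  \<open>\<Phi>\<close> is stationary at the critical value, this gradient contains no derivative of
  \<open>\<sigma>\<close>; that is why \<open>U\<close> is differentiable even at the origin, where
  \<open>\<sigma>\<close> is not. The exponent comes from the order of degeneracy. If the
  \<open>s\<close>-derivative of \<open>G\<close> has a zero of even order, \<open>G\<close> stays
  strictly increasing and its root persists and remains unique nearby. Order two is the lowest such
  order; it makes \<open>G\<close> grow like a cube, and inverting the cube gives 1/3. The algebraic
  form of the equation determines the sum of the angles only modulo pi. The signs are therefore
  arranged so that the rank one part of the Hessian is nonnegative: interlacing then confines the
  angle to an interval of length pi above that of the diagonal part, and this leaves one value. A
  competing solution is merely continuous. At the origin the one smooth test function used against
  it is half the square of the norm, whose Hessian, the identity, lies in
  \<open>F_set \<theta>\<close> and in its dual for all \<open>\<theta>\<close> considered.\<close>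

no_notation fps_nth (infixl "$" 75)

section \<open>Eigenvalues of symmetric matrices\<close>

lemma prod_UNIV_3: "(\<Prod>i\<in>(UNIV::3 set). f i) = f 1 * f 2 * f 3"
  for f :: "3 \<Rightarrow> 'a::comm_monoid_mult"
  unfolding UNIV_3 by (simp add: mult.assoc)

lemma poly_charpoly:
  "poly (charpoly A) x = det (mat x - A)" for A :: mat3
proof -
  have "poly (det M) x = det (\<chi> i j. poly (M $ i $ j) x)" for M :: "real poly^3^3"
    by (simp only: det_3 poly_add poly_diff poly_mult vec_lambda_beta)
  moreover have "(\<chi> i j. poly ((\<chi> i j. (if i = j then [:0, 1:] else 0) - [:A $ i $ j:]) $ i $ j) x) = mat x - A"
    by (simp add: vec_eq_iff mat_def)
  ultimately show ?thesis
    by (simp add: charpoly_def)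
qed

lemma ex_orthogonal_to_two:
  fixes a b :: "real^3"
  obtains x where "x \<noteq> 0" "x \<bullet> a = 0" "x \<bullet> b = 0"
proof -
  have "dim {a, b} \<le> card {a, b}"
    by (rule dim_le_card') simp
  also have "\<dots> \<le> 2"
    by (simp add: card_insert_if)
  finally have "dim {a, b} < DIM(real^3)"
    by simp
  from orthogonal_to_subspace_exists[OF this] obtain x
    where x: "x \<noteq> 0" "\<And>y. y \<in> span {a, b} \<Longrightarrow> orthogonal x y"
    by blast
  have "orthogonal x a" "orthogonal x b"
    by (blast intro: x span_base)+
  with x(1) show thesis
    unfolding orthogonal_def by (rule that)
qed

lemma Sym2_inner:
  assumes "A \<in> Sym2"
  shows "x \<bullet> (A *v y) = (A *v x) \<bullet> y"
  using assms dot_lmul_matrix[of x A y] transpose_matrix_vector[of A x] by (simp add: Sym2_def)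

text \<open>The Rayleigh quotient is stationary at its maximizer on the unit sphere of
  \<open>T\<close>. Invariance of \<open>T\<close> makes the residual
  \<open>A *v q - l *\<^sub>R q\<close> an admissible direction of variation, which forces it to
  vanish. Working on an invariant subspace allows the lemma to be iterated on orthogonal
  complements.\<close>

lemma Rayleigh_maximum:
  assumes A: "A \<in> Sym2" and T: "subspace T" "T \<noteq> {0}" and inv: "\<And>x. x \<in> T \<Longrightarrow> A *v x \<in> T"
  obtains q l where "q \<in> T" "norm q = 1" "A *v q = l *\<^sub>R q"
    "\<And>x. x \<in> T \<Longrightarrow> x \<bullet> (A *v x) \<le> l * (x \<bullet> x)"
proof -
  let ?f = "\<lambda>x. x \<bullet> (A *v x)"
  obtain v where v: "v \<in> T" "v \<noteq> 0"
    using T subspace_0 by blast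
  have "compact (T \<inter> sphere 0 1)"
    using T by (simp add: closed_Int_compact closed_subspace)
  moreover have "v /\<^sub>R norm v \<in> T" "norm (v /\<^sub>R norm v) = 1"
    using v T by (auto simp: subspace_scale)
  then have "T \<inter> sphere 0 1 \<noteq> {}"
    by (metis IntI empty_iff mem_sphere_0)
  moreover have "continuous_on (T \<inter> sphere 0 1) ?f"
    by (intro continuous_intros linear_continuous_on linear_conv_bounded_linear[THEN iffD1]) auto
  ultimately obtain q where q: "q \<in> T" "norm q = 1" and max: "\<And>x. x \<in> T \<Longrightarrow> norm x = 1 \<Longrightarrow> ?f x \<le> ?f q"
    by (metis (no_types, lifting) continuous_attains_sup IntD1 IntD2 IntI mem_sphere_0)
  define l where "l = ?f q"
  have bound: "?f x \<le> l * (x \<bullet> x)" if "x \<in> T" for x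
  proof (cases "x = 0")
    case False
    have "?f (x /\<^sub>R norm x) \<le> l"
      unfolding l_def using that False T by (intro max) (auto simp: subspace_scale)
    then have "?f x / (norm x)\<^sup>2 \<le> l"
      by (simp add: matrix_vector_mult_scaleR power2_eq_square field_simps)
    then show ?thesis
      using False by (simp add: field_simps power2_norm_eq_inner)
  qed auto
  have "A *v q = l *\<^sub>R q"
  proof -
    define w where "w = A *v q - l *\<^sub>R q"
    have wT: "w \<in> T"
      unfolding w_def using q T inv by (intro subspace_diff subspace_scale) auto
    \<comment> \<open>The first order gain in the direction of the residual must be absorbed by a
      term quadratic in \<open>t\<close>, for every \<open>t\<close>.\<close>
    have ineq: "2 * t * (w \<bullet> w) \<le> t\<^sup>2 * (l * (w \<bullet> w) - ?f w)" for t
    proof -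
      have "q + t *\<^sub>R w \<in> T"
        using q wT T by (intro subspace_add subspace_scale) auto
      then have 1: "?f (q + t *\<^sub>R w) \<le> l * ((q + t *\<^sub>R w) \<bullet> (q + t *\<^sub>R w))"
        by (rule bound)
      have 2: "?f (q + t *\<^sub>R w) = l + 2 * t * (w \<bullet> (A *v q)) + t\<^sup>2 * ?f w"
        using Sym2_inner[OF A, of q w]
        by (simp add: l_def matrix_vector_right_distrib matrix_vector_mult_scaleR inner_add_left inner_add_right
            power2_eq_square algebra_simps inner_commute)
      have 3: "(q + t *\<^sub>R w) \<bullet> (q + t *\<^sub>R w) = 1 + 2 * t * (w \<bullet> q) + t\<^sup>2 * (w \<bullet> w)"
        using q by (simp add: inner_add_left inner_add_right power2_eq_square inner_commute norm_eq_1)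
      have 4: "w \<bullet> (A *v q) = w \<bullet> w + l * (w \<bullet> q)"
        by (subst (2) w_def) (simp add: inner_diff_right)
      show ?thesis
        using 1 unfolding 2 3 4 by (simp add: algebra_simps)
    qed
    define M where "M = l * (w \<bullet> w) - ?f w"
    have "w \<bullet> w \<le> 0"
    proof (rule ccontr)
      assume pos: "\<not> w \<bullet> w \<le> 0"
      \<comment> \<open>So small that the quadratic term is at most \<open>w \<bullet> w\<close>,
        half of the linear one; the summand 1 keeps the denominator positive.\<close>
      define t where "t = (w \<bullet> w) / (\<bar>M\<bar> + 1)"
      have t: "t > 0"
        unfolding t_def using pos by (intro divide_pos_pos) linarith+
      have "2 * (w \<bullet> w) \<le> t * M"
        using ineq[of t] t by (simp add: M_def power2_eq_square)
      also have "\<dots> \<le> t * (\<bar>M\<bar> + 1)"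
        using t by (intro mult_left_mono) auto
      also have "\<dots> = w \<bullet> w"
        unfolding t_def by (simp add: add_nonneg_eq_0_iff)
      finally show False
        using pos by simp
    qed
    then show ?thesis
      unfolding w_def by (metis inner_gt_zero_iff not_le right_minus_eq)
  qed
  then show thesis
    using that q bound by blast
qed

text \<open>The ordering belongs to the notion, so that the eigenvalues of two matrices can be
  compared index by index.\<close>

definition eigensystem :: "mat3 \<Rightarrow> (3 \<Rightarrow> real^3) \<Rightarrow> (3 \<Rightarrow> real) \<Rightarrow> bool" where
  "eigensystem A q l \<longleftrightarrow> (\<forall>i j. q i \<bullet> q j = (if i = j then 1 else 0)) \<and>
    (\<forall>i. A *v q i = l i *\<^sub>R q i) \<and> l 1 \<le> l 2 \<and> l 2 \<le> l 3"

lemma eigensystem_exists: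
  assumes A: "A \<in> Sym2"
  obtains q l where "eigensystem A q l"
proof -
  obtain q3 l3 where 3: "norm q3 = 1" "A *v q3 = l3 *\<^sub>R q3"
    and max3: "\<And>x. x \<bullet> (A *v x) \<le> l3 * (x \<bullet> x)"
    using Rayleigh_maximum[OF A, of UNIV] by (metis UNIV_I UNIV_not_singleton subspace_UNIV)
  define T2 where "T2 = {x. x \<bullet> q3 = 0}"
  have T2: "subspace T2"
    unfolding T2_def by (auto simp: subspace_def inner_add_left)
  have inv2: "A *v x \<in> T2" if "x \<in> T2" for x
    using that 3 unfolding T2_def by (simp add: Sym2_inner[OF A, symmetric])
  have "T2 \<noteq> {0}"
    using ex_orthogonal_to_two[of q3 q3] unfolding T2_def by blast
  then obtain q2 l2 where 2: "q2 \<in> T2" "norm q2 = 1" "A *v q2 = l2 *\<^sub>R q2"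
    and max2: "\<And>x. x \<in> T2 \<Longrightarrow> x \<bullet> (A *v x) \<le> l2 * (x \<bullet> x)"
    using Rayleigh_maximum[OF A T2] inv2 by metis
  define T1 where "T1 = {x. x \<bullet> q3 = 0 \<and> x \<bullet> q2 = 0}"
  have T1: "subspace T1"
    unfolding T1_def by (auto simp: subspace_def inner_add_left)
  have inv1: "A *v x \<in> T1" if "x \<in> T1" for x
    using that 2 3 unfolding T1_def by (simp add: Sym2_inner[OF A, symmetric])
  have "T1 \<noteq> {0}"
    using ex_orthogonal_to_two[of q3 q2] unfolding T1_def by blast
  then obtain q1 l1 where 1: "q1 \<in> T1" "norm q1 = 1" "A *v q1 = l1 *\<^sub>R q1"
    using Rayleigh_maximum[OF A T1] inv1 by metis
  define q where "q = (\<lambda>i::3. if i = 1 then q1 else if i = 2 then q2 else q3)"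
  define l where "l = (\<lambda>i::3. if i = 1 then l1 else if i = 2 then l2 else l3)"
  have "l1 \<le> l2"
    using max2[of q1] 1 by (simp add: T1_def T2_def norm_eq_1)
  moreover have "l2 \<le> l3"
    using max3[of q2] 2 by (simp add: norm_eq_1)
  ultimately have "eigensystem A q l"
    using 1 2 3 by (simp add: eigensystem_def forall_3 q_def l_def T1_def T2_def norm_eq_1 inner_commute)
  then show thesis
    by (rule that)
qed

lemma eigensystem_matrix:
  assumes "eigensystem A q l"
  defines "Q \<equiv> (\<chi> i. q i)"
  shows "Q ** transpose Q = mat 1" "transpose Q ** Q = mat 1"
proof -
  show "Q ** transpose Q = mat 1"
    using assms(1) unfolding Q_def eigensystem_def matrix_matrix_mult_def transpose_def mat_def
    by (simp add: vec_eq_iff inner_vec_def)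
  then show "transpose Q ** Q = mat 1"
    using matrix_left_right_inverse by blast
qed

lemma eigensystem_inner:
  assumes "eigensystem A q l"
  shows "x \<bullet> y = (\<Sum>i\<in>UNIV. (q i \<bullet> x) * (q i \<bullet> y))"
proof -
  let ?Q = "\<chi> i. q i"
  have Q: "(?Q *v x) $ i = q i \<bullet> x" for x i
    by (simp add: matrix_vector_mult_def inner_vec_def)
  have "x \<bullet> y = x \<bullet> (transpose ?Q *v (?Q *v y))"
    using eigensystem_matrix(2)[OF assms] by (simp add: matrix_vector_mul_assoc)
  also have "\<dots> = (?Q *v x) \<bullet> (?Q *v y)"
    using dot_lmul_matrix[of x "transpose ?Q" "?Q *v y"] transpose_matrix_vector[of "transpose ?Q" x] by simp
  finally show ?thesis
    by (simp add: inner_vec_def Q)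
qed

lemma eigensystem_quadratic_form:
  assumes "eigensystem A q l" "A \<in> Sym2"
  shows "x \<bullet> (A *v x) = (\<Sum>i\<in>UNIV. l i * (q i \<bullet> x)\<^sup>2)"
proof -
  have "q i \<bullet> (A *v x) = l i * (q i \<bullet> x)" for i
    using assms by (simp add: Sym2_inner eigensystem_def)
  then show ?thesis
    by (subst eigensystem_inner[OF assms(1)]) (simp add: power2_eq_square algebra_simps)
qed

lemma eigensystem_det:
  assumes "eigensystem A q l"
  shows "det (mat x - A) = (\<Prod>i\<in>UNIV. x - l i)"
proof -
  let ?Q = "\<chi> i. q i"
  let ?D = "\<chi> i j. if i = j then x - l i else 0"
  have "mat x *v v = x *\<^sub>R v" for v :: "real^3"
    by (simp add: mat_def matrix_vector_mult_def vec_eq_iff if_distrib[where f="\<lambda>a. a * _"] cong: if_cong)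
  then have "(mat x - A) *v q j = (x - l j) *\<^sub>R q j" for j
    using assms by (simp add: eigensystem_def matrix_vector_mult_diff_rdistrib scaleR_diff_left)
  \<comment> \<open>The eigenvector equations, column by column. Taking determinants of this
    intertwining relation and cancelling \<open>det ?Q\<close> replaces a conjugation by the
    inverse.\<close>
  then have "(mat x - A) ** transpose ?Q = transpose ?Q ** ?D"
    by (simp add: vec_eq_iff matrix_matrix_mult_def matrix_vector_mult_def transpose_def
        if_distrib[where f="\<lambda>a. _ * a"] mult.commute cong: if_cong)
  then have "det ((mat x - A) ** transpose ?Q) = det (transpose ?Q ** ?D)"
    by (rule arg_cong)
  then have "det (mat x - A) * det ?Q = det ?Q * det ?D"
    by (simp only: det_mul det_transpose)
  moreover have "det ?Q \<noteq> 0"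
    using arg_cong[OF eigensystem_matrix(1)[OF assms], of det] by (auto simp: det_mul)
  moreover have "det ?D = (\<Prod>i\<in>UNIV. x - l i)"
    by (subst det_diagonal) auto
  ultimately show ?thesis
    by simp
qed

text \<open>Real polynomials are determined by their values, so a factorization of the determinant
  at all numbers \<open>x\<close> is enough to read off the formal roots with multiplicity.\<close>

lemma eigenvalues_eqI:
  assumes "\<And>x. det (mat x - A) = (x - a) * (x - b) * (x - c)"
  shows "eigenvalues A = {#a, b, c#}"
proof -
  have "poly (charpoly A) = poly ([:- a, 1:] * [:- b, 1:] * [:- c, 1:])"
    by (rule ext) (simp add: poly_charpoly assms del: mult_pCons_left mult_pCons_right)
  then have "charpoly A = [:- a, 1:] * [:- b, 1:] * [:- c, 1:]"
    by (simp only: poly_eq_poly_eq_iff)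
  then show ?thesis
    unfolding eigenvalues_def by (simp only:) (simp add: proots_mult del: mult_pCons_left mult_pCons_right)
qed

lemma eigensystem_eigenvalues:
  assumes "eigensystem A q l"
  shows "eigenvalues A = {#l 1, l 2, l 3#}"
  by (rule eigenvalues_eqI) (simp add: eigensystem_det[OF assms] prod_UNIV_3)

definition lag_angle :: "mat3 \<Rightarrow> real" where
  "lag_angle A = (\<Sum>l\<in>#eigenvalues A. arctan l)"

lemma lag_angle_eigensystem:
  assumes "eigensystem A q l"
  shows "lag_angle A = arctan (l 1) + arctan (l 2) + arctan (l 3)"
  by (simp add: lag_angle_def eigensystem_eigenvalues[OF assms])

text \<open>Only the indices with a nonzero coordinate \<open>q i \<bullet> x\<close> contribute.
  For \<open>x\<close> orthogonal to some of the eigenvectors, the form is thus bounded by the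
  remaining eigenvalues.\<close>

lemma eigensystem_bounds:
  assumes A: "eigensystem A q l" "A \<in> Sym2"
  shows "(\<And>i. q i \<bullet> x \<noteq> 0 \<Longrightarrow> c \<le> l i) \<Longrightarrow> c * (x \<bullet> x) \<le> x \<bullet> (A *v x)"
    and "(\<And>i. q i \<bullet> x \<noteq> 0 \<Longrightarrow> l i \<le> c) \<Longrightarrow> x \<bullet> (A *v x) \<le> c * (x \<bullet> x)"
proof -
  have e: "c * (x \<bullet> x) = (\<Sum>i\<in>UNIV. c * (q i \<bullet> x)\<^sup>2)"
    by (simp add: eigensystem_inner[OF A(1), of x x] sum_distrib_left power2_eq_square)
  have m: "u * (q i \<bullet> x)\<^sup>2 \<le> v * (q i \<bullet> x)\<^sup>2" if "q i \<bullet> x \<noteq> 0 \<Longrightarrow> u \<le> v" for u v i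
    using that by (cases "q i \<bullet> x = 0") (auto intro: mult_right_mono)
  show "c * (x \<bullet> x) \<le> x \<bullet> (A *v x)" if "\<And>i. q i \<bullet> x \<noteq> 0 \<Longrightarrow> c \<le> l i"
    unfolding e eigensystem_quadratic_form[OF A] by (intro sum_mono m that)
  show "x \<bullet> (A *v x) \<le> c * (x \<bullet> x)" if "\<And>i. q i \<bullet> x \<noteq> 0 \<Longrightarrow> l i \<le> c"
    unfolding e eigensystem_quadratic_form[OF A] by (intro sum_mono m that)
qed

text \<open>In dimension three every instance of the Courant--Fischer argument needs a nonzero vector
  satisfying just two linear equations.\<close>

lemma eigenvalue_le:
  assumes A: "eigensystem A q l" "A \<in> Sym2" and B: "eigensystem B r k" "B \<in> Sym2"
    and orth: "\<And>x. x \<bullet> a = 0 \<Longrightarrow> x \<bullet> b = 0 \<Longrightarrow> (x \<bullet> (A *v x) \<le> x \<bullet> (B *v x)) \<and>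
      (\<forall>i. q i \<bullet> x \<noteq> 0 \<longrightarrow> c \<le> l i) \<and> (\<forall>i. r i \<bullet> x \<noteq> 0 \<longrightarrow> k i \<le> d)"
  shows "c \<le> d"
proof -
  obtain x where x: "x \<noteq> 0" "x \<bullet> a = 0" "x \<bullet> b = 0"
    using ex_orthogonal_to_two by blast
  then have "c * (x \<bullet> x) \<le> x \<bullet> (A *v x)"
    using orth by (intro eigensystem_bounds(1)[OF A]) blast
  also have "\<dots> \<le> x \<bullet> (B *v x)"
    using orth x by blast
  also have "\<dots> \<le> d * (x \<bullet> x)"
    using orth x by (intro eigensystem_bounds(2)[OF B]) blast
  finally show ?thesis
    using x by simp
qed

lemma eigenvalues_mono:
  assumes A: "eigensystem A q l" "A \<in> Sym2" and B: "eigensystem B r k" "B \<in> Sym2"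
    and le: "\<And>x. x \<bullet> (A *v x) \<le> x \<bullet> (B *v x)"
  shows "l i \<le> k i"
proof -
  have l: "l 1 \<le> l 2" "l 2 \<le> l 3" and k: "k 1 \<le> k 2" "k 2 \<le> k 3"
    using A B by (auto simp: eigensystem_def)
  have "l 1 \<le> k 1"
    using l by (intro eigenvalue_le[OF A B, of "r 2" "r 3"]) (auto simp: forall_3 le inner_commute)
  moreover have "l 2 \<le> k 2"
    using l k by (intro eigenvalue_le[OF A B, of "q 1" "r 3"]) (auto simp: forall_3 le inner_commute)
  moreover have "l 3 \<le> k 3"
    using l k by (intro eigenvalue_le[OF A B, of "q 1" "q 2"]) (auto simp: forall_3 le inner_commute)
  ultimately show ?thesis
    by (metis exhaust_3)
qed

text \<open>One of the two available linear equations is spent on orthogonality to \<open>v\<close>,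
  which leaves just one for the eigenvectors. This costs one index, as in Cauchy
  interlacing.\<close>

lemma eigenvalues_rank_one:
  assumes A: "eigensystem A q l" "A \<in> Sym2" and B: "eigensystem B r k" "B \<in> Sym2"
    and le: "\<And>x. x \<bullet> v = 0 \<Longrightarrow> x \<bullet> (A *v x) \<le> x \<bullet> (B *v x)"
  shows "l 1 \<le> k 2" "l 2 \<le> k 3"
proof -
  have l: "l 1 \<le> l 2" "l 2 \<le> l 3" and k: "k 1 \<le> k 2" "k 2 \<le> k 3"
    using A B by (auto simp: eigensystem_def)
  show "l 1 \<le> k 2"
    using l k by (intro eigenvalue_le[OF A B, of v "r 3"]) (auto simp: forall_3 le inner_commute)
  show "l 2 \<le> k 3"
    using l k by (intro eigenvalue_le[OF A B, of v "q 1"]) (auto simp: forall_3 le inner_commute)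
qed

lemma lag_angle_mono:
  assumes "A \<in> Sym2" "B \<in> Sym2" "\<And>x. x \<bullet> (A *v x) \<le> x \<bullet> (B *v x)"
  shows "lag_angle A \<le> lag_angle B"
proof -
  obtain q l r k where "eigensystem A q l" "eigensystem B r k"
    using assms eigensystem_exists by metis
  then show ?thesis
    using eigenvalues_mono[of A q l B r k] assms
    by (auto simp: lag_angle_eigensystem intro!: add_mono arctan_monotone')
qed

text \<open>By interlacing, the two lower angles of \<open>B\<close> are at most the two upper
  angles of \<open>A\<close>. The two that are left over, the largest of \<open>B\<close> and the
  smallest of \<open>A\<close>, differ by less than pi.\<close>

lemma lag_angle_rank_one:
  assumes "A \<in> Sym2" "B \<in> Sym2" "\<And>x. x \<bullet> v = 0 \<Longrightarrow> x \<bullet> (B *v x) \<le> x \<bullet> (A *v x)"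
  shows "lag_angle B < lag_angle A + pi"
proof -
  obtain q l r k where "eigensystem B q l" "eigensystem A r k"
    using assms eigensystem_exists by metis
  then show ?thesis
    using eigenvalues_rank_one[of B q l A r k v] assms arctan_bounded[of "l 3"] arctan_bounded[of "k 1"]
      arctan_monotone'[of "l 1" "k 2"] arctan_monotone'[of "l 2" "k 3"]
    by (auto simp: lag_angle_eigensystem)
qed

lemma mat_mult_vec: "mat t *v x = t *\<^sub>R x" for x :: "real^'n"
  by (simp add: mat_def matrix_vector_mult_def vec_eq_iff if_distrib[where f="\<lambda>a. a * _"] cong: if_cong)

lemma mat_in_Sym2 [simp]: "mat t \<in> Sym2"
  by (simp add: Sym2_def)

lemma Sym2_simps:
  "A \<in> Sym2 \<Longrightarrow> B \<in> Sym2 \<Longrightarrow> A + B \<in> Sym2"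
  "A \<in> Sym2 \<Longrightarrow> B \<in> Sym2 \<Longrightarrow> A - B \<in> Sym2"
  "A \<in> Sym2 \<Longrightarrow> - A \<in> Sym2"
  by (auto simp: Sym2_def transpose_def vec_eq_iff)

lemma lag_angle_diff_mat:
  assumes "A \<in> Sym2" "t > 0"
  shows "lag_angle (A - mat t) < lag_angle A"
proof -
  obtain q l where q: "eigensystem A q l"
    using assms eigensystem_exists by metis
  then have "eigensystem (A - mat t) q (\<lambda>i. l i - t)"
    by (simp add: eigensystem_def matrix_vector_mult_diff_rdistrib mat_mult_vec scaleR_diff_left)
  then show ?thesis
    using q assms by (simp add: lag_angle_eigensystem add_strict_mono arctan_less_iff)
qed

lemma lag_angle_mat: "lag_angle (mat t) = 3 * arctan t"
proof -
  have "eigensystem (mat t) (\<lambda>i. axis i 1) (\<lambda>_. t)"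
    by (simp add: eigensystem_def mat_mult_vec inner_axis_axis)
  then show ?thesis
    by (simp add: lag_angle_eigensystem)
qed

lemma F_set_iff: "A \<in> F_set \<theta> \<longleftrightarrow> A \<in> Sym2 \<and> \<theta> \<le> lag_angle A"
  by (simp add: F_set_def lag_angle_def)

lemma mat3_quadratic_bound:
  fixes A :: mat3
  shows "\<bar>x \<bullet> (A *v x)\<bar> \<le> 3 * norm A * (x \<bullet> x)"
proof -
  have "\<bar>(A *v x) $ i\<bar> \<le> norm A * norm x" for i
  proof -
    have "(A *v x) $ i = A $ i \<bullet> x"
      by (simp add: matrix_vector_mult_def inner_vec_def)
    also have "\<bar>\<dots>\<bar> \<le> norm (A $ i) * norm x"
      by (rule Cauchy_Schwarz_ineq2)
    also have "\<dots> \<le> norm A * norm x"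
      by (intro mult_right_mono Finite_Cartesian_Product.norm_nth_le) auto
    finally show ?thesis .
  qed
  then have "norm (A *v x) \<le> (\<Sum>i\<in>(UNIV::3 set). norm A * norm x)"
    by (intro order_trans[OF norm_le_l1_cart] sum_mono)
  then have "norm x * norm (A *v x) \<le> norm x * (3 * norm A * norm x)"
    by (intro mult_left_mono) auto
  then show ?thesis
    using Cauchy_Schwarz_ineq2[of x "A *v x"] by (simp add: power2_norm_eq_inner[symmetric] power2_eq_square ac_simps)
qed

section \<open>The maximum principle with an isolated singularity\<close>

text \<open>Subtracting a small multiple of the identity strictly lowers the angle. Hence
  \<open>M\<close> has symmetric matrices outside \<open>F_set \<theta>\<close> arbitrarily close to
  it and is not an interior point.\<close>

lemma uminus_in_dirichlet_dual:
  assumes "M \<in> Sym2" "lag_angle M \<le> \<theta>"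
  shows "- M \<in> dirichlet_dual (F_set \<theta>)"
proof -
  have "M \<notin> (top_of_set Sym2) interior_of F_set \<theta>"
  proof
    assume "M \<in> (top_of_set Sym2) interior_of F_set \<theta>"
    then obtain T where T: "open T" "M \<in> T" "Sym2 \<inter> T \<subseteq> F_set \<theta>"
      unfolding interior_of_def openin_open by auto
    have "((\<lambda>t. mat t) \<longlongrightarrow> (mat 0 :: mat3)) (at_right (0::real))"
      unfolding mat_def
    proof (intro tendsto_vec_lambda)
      show "((\<lambda>t. if i = j then t else 0) \<longlongrightarrow> (if i = j then 0 else 0)) (at_right (0::real))" for i j :: 3
        by (cases "i = j") auto
    qed
    then have "((\<lambda>t. M - mat t) \<longlongrightarrow> M - mat 0) (at_right 0)"
      by (intro tendsto_intros)
    moreover have "M - mat 0 = M"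
      by (simp add: mat_def vec_eq_iff)
    ultimately have "\<forall>\<^sub>F t in at_right 0. M - mat t \<in> T"
      using T by (simp add: tendsto_def)
    moreover have "\<forall>\<^sub>F t in at_right 0. 0 < (t::real)"
      by (simp add: eventually_at_right_less)
    ultimately obtain t where t: "t > 0" "M - mat t \<in> T"
      using eventually_happens'[OF trivial_limit_at_right_real, OF eventually_conj] by blast
    then have "M - mat t \<in> F_set \<theta>"
      using T Sym2_simps(2)[OF assms(1) mat_in_Sym2] by blast
    then have "\<theta> \<le> lag_angle (M - mat t)"
      by (simp add: F_set_iff)
    then show False
      using lag_angle_diff_mat[OF assms(1) t(1)] assms by simp
  qed
  then show ?thesis
    using assms by (simp add: dirichlet_dual_def)
qed

text \<open>Otherwise \<open>- V\<close> would exceed \<open>M\<close> by \<open>d\<close> times the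
  identity. By the bound \<open>mat3_quadratic_bound\<close>, all symmetric matrices at distance
  less than \<open>d / 3\<close> from \<open>- V\<close> would still lie above \<open>M\<close> and
  have angle at least \<open>\<theta>\<close>, so \<open>- V\<close> would be interior to
  \<open>F_set \<theta>\<close>.\<close>

lemma dirichlet_dual_not_below:
  assumes V: "V \<in> dirichlet_dual (F_set \<theta>)" and M: "M \<in> Sym2" "\<theta> \<le> lag_angle M" and "d > 0"
    and le: "\<And>x. x \<bullet> (V *v x) + x \<bullet> (M *v x) \<le> - d * (x \<bullet> x)"
  shows False
proof -
  obtain A where A: "V = - A" "A \<in> Sym2" "A \<notin> (top_of_set Sym2) interior_of F_set \<theta>"
    using V by (auto simp: dirichlet_dual_def)
  have "Sym2 \<inter> ball A (d / 3) \<subseteq> F_set \<theta>"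
  proof
    fix B assume B: "B \<in> Sym2 \<inter> ball A (d / 3)"
    have "x \<bullet> (M *v x) \<le> x \<bullet> (B *v x)" for x
    proof -
      have "3 * norm (A - B) * (x \<bullet> x) \<le> d * (x \<bullet> x)"
        using B by (intro mult_right_mono) (auto simp: dist_norm)
      then have "x \<bullet> ((A - B) *v x) \<le> d * (x \<bullet> x)"
        using mat3_quadratic_bound[of x "A - B"] by linarith
      moreover have "x \<bullet> (V *v x) = - (x \<bullet> (A *v x))"
        using matrix_vector_mult_diff_rdistrib[of 0 A x] by (simp add: A)
      ultimately show ?thesis
        using le[of x] by (simp add: matrix_vector_mult_diff_rdistrib inner_diff_right)
    qed
    then have "lag_angle M \<le> lag_angle B"
      using M B by (intro lag_angle_mono) auto
    then show "B \<in> F_set \<theta>"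
      using M B by (simp add: F_set_iff)
  qed
  moreover have "openin (top_of_set Sym2) (Sym2 \<inter> ball A (d / 3))" "A \<in> Sym2 \<inter> ball A (d / 3)"
    using A \<open>d > 0\<close> by (auto simp: openin_open)
  ultimately show False
    using A by (auto simp: interior_of_def)
qed

lemma F_set_not_below:
  assumes V: "V \<in> F_set \<theta>" and M: "M \<in> Sym2" "lag_angle M \<le> \<theta>" and "d > 0"
    and le: "\<And>x. x \<bullet> (V *v x) - x \<bullet> (M *v x) \<le> - d * (x \<bullet> x)"
  shows False
proof -
  have "lag_angle V \<le> lag_angle (M - mat d)"
    using V M le by (intro lag_angle_mono)
      (auto simp: F_set_iff Sym2_simps matrix_vector_mult_diff_rdistrib mat_mult_vec inner_diff_right algebra_simps)
  then show False
    using V M lag_angle_diff_mat[OF M(1) \<open>d > 0\<close>] by (simp add: F_set_iff)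
qed

section \<open>Touching from above: paraboloids, cones and derivative tests\<close>

lemma perturbed_maximum:
  fixes g :: "real^3 \<Rightarrow> real"
  assumes cont: "continuous_on (cball c r) g" and bd: "\<And>x. x \<in> sphere c r \<Longrightarrow> g x \<le> 0"
    and x1: "x1 \<in> cball c r" "g x1 > 0"
  obtains (off_zero) d x0 e a where "d > 0" "e > 0" "ball x0 e \<subseteq> ball c r" "0 \<notin> ball x0 e"
      "\<And>x. x \<in> ball x0 e \<Longrightarrow> g x \<le> g x0 + a \<bullet> (x - x0) - d * (norm (x - x0))\<^sup>2"
  | (zero) d a where "d > 0" "0 \<in> ball c r"
      "\<And>x. x \<in> cball c r \<Longrightarrow> g x \<le> g 0 + a \<bullet> x - d * norm x"
proof -
  have r: "r \<ge> 0"
    using x1(1) zero_le_dist[of c x1] unfolding mem_cball by linarith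
  \<comment> \<open>In \<open>r\<^sup>2 + 2 * r\<close>, the square pays for the quadratic
    perturbation on the sphere, and \<open>2 * r\<close> for the linear one, once on the sphere and
    once at \<open>x1\<close>. The summand 1 makes the comparison strict and the denominator
    positive. So for every slope \<open>p\<close> of norm at most \<open>d\<close> the maximum stays
    inside the ball.\<close>
  define d where "d = g x1 / (r\<^sup>2 + 2 * r + 1)"
  have pos: "r\<^sup>2 + 2 * r + 1 > 0"
    using r by (simp add: add_nonneg_pos)
  have d: "d > 0" "d * (r\<^sup>2 + 2 * r) < g x1"
  proof -
    show "d > 0"
      unfolding d_def using x1 pos by simp
    have "d * (r\<^sup>2 + 2 * r + 1) = g x1"
      unfolding d_def using pos by simp
    then show "d * (r\<^sup>2 + 2 * r) < g x1"
      using \<open>d > 0\<close> by (simp add: algebra_simps)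
  qed
  have ex: "\<exists>x0\<in>ball c r. \<forall>x\<in>cball c r.
      g x \<le> g x0 + (p - (2 * d) *\<^sub>R (x0 - c)) \<bullet> (x - x0) - d * (norm (x - x0))\<^sup>2"
    if p: "norm p \<le> d" for p
  proof -
    define G where "G = (\<lambda>x. g x + d * (norm (x - c))\<^sup>2 - p \<bullet> (x - c))"
    have "continuous_on (cball c r) G"
      unfolding G_def by (intro continuous_intros cont)
    then obtain x0 where x0: "x0 \<in> cball c r" and max: "\<And>x. x \<in> cball c r \<Longrightarrow> G x \<le> G x0"
      using continuous_attains_sup[of "cball c r" G] x1 by (metis compact_cball empty_iff)
    have pb: "\<bar>p \<bullet> (x - c)\<bar> \<le> d * r" if "x \<in> cball c r" for x
    proof -
      have "norm (x - c) \<le> r"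
        using that by (simp add: dist_norm norm_minus_commute)
      then show ?thesis
        using p d by (intro order_trans[OF Cauchy_Schwarz_ineq2] mult_mono) auto
    qed
    have "x0 \<notin> sphere c r"
    proof
      assume s: "x0 \<in> sphere c r"
      then have "norm (x0 - c) = r"
        by (simp add: dist_norm norm_minus_commute)
      then have "G x0 \<le> d * r\<^sup>2 + d * r"
        using bd[OF s] pb[OF x0] by (simp add: G_def)
      moreover have "G x1 \<ge> g x1 - d * r"
        using pb[OF x1(1)] d by (simp add: G_def) (smt (verit) mult_nonneg_nonneg zero_le_power2)
      ultimately show False
        using max[OF x1(1)] d by (simp add: algebra_simps)
    qed
    then have "x0 \<in> ball c r"
      using x0 by (simp add: less_le)
    moreover have "g x \<le> g x0 + (p - (2 * d) *\<^sub>R (x0 - c)) \<bullet> (x - x0) - d * (norm (x - x0))\<^sup>2"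
      if "x \<in> cball c r" for x
    proof -
      have "(norm (x - c))\<^sup>2 = (norm (x0 - c))\<^sup>2 + 2 * ((x0 - c) \<bullet> (x - x0)) + (norm (x - x0))\<^sup>2"
        unfolding power2_norm_eq_inner by (simp add: inner_diff_left inner_diff_right inner_commute)
      then have "d * (norm (x - c))\<^sup>2 =
          d * (norm (x0 - c))\<^sup>2 + 2 * d * ((x0 - c) \<bullet> (x - x0)) + d * (norm (x - x0))\<^sup>2"
        by (simp only: ring_distribs ac_simps)
      moreover have "p \<bullet> (x - c) = p \<bullet> (x0 - c) + p \<bullet> (x - x0)"
        by (simp add: inner_diff_right)
      ultimately show ?thesis
        using max[OF that] unfolding G_def inner_diff_left inner_scaleR_left by linarith
    qed
    ultimately show ?thesis
      by blast
  qed
  show thesis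
  proof (cases "\<exists>p x0. norm p \<le> d \<and> x0 \<in> ball c r \<and> x0 \<noteq> 0 \<and> (\<forall>x\<in>cball c r.
      g x \<le> g x0 + (p - (2 * d) *\<^sub>R (x0 - c)) \<bullet> (x - x0) - d * (norm (x - x0))\<^sup>2)")
    case True
    then obtain p x0 where x0: "x0 \<in> ball c r - {0}" and le: "\<And>x. x \<in> ball c r \<Longrightarrow>
        g x \<le> g x0 + (p - (2 * d) *\<^sub>R (x0 - c)) \<bullet> (x - x0) - d * (norm (x - x0))\<^sup>2"
      by force
    have "open (ball c r - {0})"
      by (intro open_delete) simp
    then obtain e where "e > 0" "ball x0 e \<subseteq> ball c r - {0}"
      using x0 open_contains_ball by blast
    then show thesis
      using le by (intro off_zero[OF d(1)]) blast+
  next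
    case False
    then have z: "0 \<in> ball c r" "\<And>x. x \<in> cball c r \<Longrightarrow>
        g x \<le> g 0 + (p - (2 * d) *\<^sub>R (0 - c)) \<bullet> (x - 0) - d * (norm (x - 0))\<^sup>2" if "norm p \<le> d" for p
      using ex[OF that] that by metis+
    have "g x \<le> g 0 + ((2 * d) *\<^sub>R c) \<bullet> x - d * norm x" if x: "x \<in> cball c r" for x
    proof (cases "x = 0")
      case False
      \<comment> \<open>All slopes of norm at most \<open>d\<close> have their maximum at the
        origin, so the slope may be chosen depending on \<open>x\<close>; pointing opposite to
        \<open>x\<close>, it contributes \<open>- d * norm x\<close>.\<close>
      have "g x \<le> g 0 + (- (d / norm x) *\<^sub>R x - (2 * d) *\<^sub>R (0 - c)) \<bullet> (x - 0) - d * (norm (x - 0))\<^sup>2"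
        using False d by (intro z(2)[OF _ x]) auto
      also have "\<dots> \<le> g 0 + ((2 * d) *\<^sub>R c) \<bullet> x - (d / norm x) * (x \<bullet> x)"
        using d by (simp add: inner_add_left inner_diff_left)
      also have "(d / norm x) * (x \<bullet> x) = d * norm x"
        using False by (simp add: power2_norm_eq_inner[symmetric] power2_eq_square)
      finally show ?thesis .
    qed auto
    then show thesis
      using zero[of d "(2 * d) *\<^sub>R c"] d z(1)[of 0] by simp
  qed
qed

text \<open>The one-sided derivatives of \<open>g - a\<close> along \<open>v\<close> and along
  \<open>- v\<close> would both be at most \<open>- d * norm v\<close>, but they are opposite
  numbers.\<close>

lemma has_derivative_not_below_cone:
  fixes g :: "'a::real_normed_vector \<Rightarrow> real"
  assumes D: "(g has_derivative g') (at x0)" and "d > 0"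
    and "\<forall>\<^sub>F x in nhds x0. g x \<le> g x0 + a (x - x0) - d * norm (x - x0)" and "bounded_linear a"
    and "(v::'a) \<noteq> 0"
  shows False
proof -
  interpret a: bounded_linear a by fact
  interpret g': bounded_linear g'
    using D by (rule has_derivative_bounded_linear)
  have key: "g' w - a w \<le> - d * norm w" for w
  proof -
    have lim: "((\<lambda>t. (g (x0 + t *\<^sub>R w) - g x0) / t) \<longlongrightarrow> g' w) (at_right 0)"
    proof -
      have "((\<lambda>t. g (x0 + t *\<^sub>R w)) has_derivative (\<lambda>t. g' (t *\<^sub>R w))) (at 0)"
        by (rule has_derivative_compose[of "\<lambda>t. x0 + t *\<^sub>R w" "\<lambda>t. t *\<^sub>R w"])
          (use D in \<open>auto intro!: derivative_eq_intros\<close>)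
      then have "((\<lambda>t. g (x0 + t *\<^sub>R w)) has_real_derivative g' w) (at 0)"
        by (simp add: has_field_derivative_def g'.scaleR mult_commute_abs)
      then have "((\<lambda>t. (g (x0 + t *\<^sub>R w) - g x0) / t) \<longlongrightarrow> g' w) (at 0)"
        by (simp add: DERIV_def)
      then show ?thesis
        by (rule tendsto_mono[rotated]) (simp add: at_le)
    qed
    have "((\<lambda>t. x0 + t *\<^sub>R w) \<longlongrightarrow> x0) (at_right 0)"
      by (auto intro!: tendsto_eq_intros)
    then have ev: "\<forall>\<^sub>F t in at_right 0. g (x0 + t *\<^sub>R w) \<le> g x0 + a (t *\<^sub>R w) - d * norm (t *\<^sub>R w)"
      using eventually_compose_filterlim[OF assms(3)] by fastforce
    have "\<forall>\<^sub>F t in at_right 0. (g (x0 + t *\<^sub>R w) - g x0) / t \<le> a w - d * norm w"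
      using ev eventually_at_right_less[of 0]
    proof eventually_elim
      case (elim t)
      then show ?case
        by (simp add: a.scaleR field_simps)
    qed
    from tendsto_upperbound[OF lim this] show ?thesis
      by simp
  qed
  have "- d * norm v < 0"
    using assms by simp
  then show False
    using key[of v] key[of "- v"] by (simp add: g'.neg a.neg)
qed

text \<open>On a line through \<open>x0\<close>, \<open>f\<close> minus the affine function plus the
  square is maximal at parameter 0. Its first derivative vanishes there, and a positive second
  derivative would make it increase to the right.\<close>

lemma second_derivative_test:
  fixes f :: "real^3 \<Rightarrow> real"
  assumes U: "open U" "x0 \<in> U" and D: "\<And>x. x \<in> U \<Longrightarrow> (f has_derivative (\<lambda>h. G x \<bullet> h)) (at x)"
    and D2: "(G has_derivative (\<lambda>h. H *v h)) (at x0)"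
    and max: "\<And>x. x \<in> U \<Longrightarrow> f x \<le> f x0 + a \<bullet> (x - x0) - d * (norm (x - x0))\<^sup>2"
  shows "y \<bullet> (H *v y) \<le> - 2 * d * (y \<bullet> y)"
proof (rule ccontr)
  assume neg: "\<not> ?thesis"
  define \<phi> where "\<phi> = (\<lambda>t. f (x0 + t *\<^sub>R y) - t * (a \<bullet> y) + d * t\<^sup>2 * (y \<bullet> y))"
  define \<phi>' where "\<phi>' = (\<lambda>t. G (x0 + t *\<^sub>R y) \<bullet> y - a \<bullet> y + 2 * d * t * (y \<bullet> y))"
  have "((\<lambda>t. x0 + t *\<^sub>R y) \<longlongrightarrow> x0) (at 0)"
    by (auto intro!: tendsto_eq_intros)
  then have "\<forall>\<^sub>F t in at 0. x0 + t *\<^sub>R y \<in> U"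
    using U by (simp add: tendsto_def)
  then obtain e where e: "e > 0" "\<And>t. \<bar>t\<bar> < e \<Longrightarrow> x0 + t *\<^sub>R y \<in> U"
    unfolding eventually_at using U by (auto simp: dist_real_def) (metis add.right_neutral scale_zero_left)
  have d1: "(\<phi> has_real_derivative \<phi>' t) (at t)" if "\<bar>t\<bar> < e" for t
  proof -
    have "((\<lambda>t. f (x0 + t *\<^sub>R y)) has_derivative (\<lambda>s. G (x0 + t *\<^sub>R y) \<bullet> (s *\<^sub>R y))) (at t)"
      by (rule has_derivative_compose[of "\<lambda>t. x0 + t *\<^sub>R y" "\<lambda>t. t *\<^sub>R y"])
        (use D[OF e(2)[OF that]] in \<open>auto intro!: derivative_eq_intros\<close>)
    then have "((\<lambda>t. f (x0 + t *\<^sub>R y)) has_real_derivative G (x0 + t *\<^sub>R y) \<bullet> y) (at t)"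
      by (simp add: has_field_derivative_def mult_commute_abs)
    then show ?thesis
      unfolding \<phi>_def \<phi>'_def by (auto intro!: derivative_eq_intros)
  qed
  have d2: "(\<phi>' has_real_derivative (y \<bullet> (H *v y) + 2 * d * (y \<bullet> y))) (at 0)"
  proof -
    have "((\<lambda>t. G (x0 + t *\<^sub>R y)) has_derivative (\<lambda>s. H *v (s *\<^sub>R y))) (at 0)"
      by (rule has_derivative_compose[of "\<lambda>t. x0 + t *\<^sub>R y" "\<lambda>t. t *\<^sub>R y"])
        (use D2 in \<open>auto intro!: derivative_eq_intros\<close>)
    then have "((\<lambda>t. G (x0 + t *\<^sub>R y) \<bullet> y) has_derivative (\<lambda>s. (H *v (s *\<^sub>R y)) \<bullet> y)) (at 0)"
      by (rule has_derivative_inner_left)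
    then have "((\<lambda>t. G (x0 + t *\<^sub>R y) \<bullet> y) has_real_derivative y \<bullet> (H *v y)) (at 0)"
      by (simp add: has_field_derivative_def mult_commute_abs matrix_vector_mult_scaleR inner_commute)
    then show ?thesis
      unfolding \<phi>'_def by (auto intro!: derivative_eq_intros)
  qed
  have max': "\<phi> t \<le> \<phi> 0" if "\<bar>t\<bar> < e" for t
    using max[OF e(2)[OF that]] by (simp add: \<phi>_def power_mult_distrib power2_norm_eq_inner)
  have "\<phi>' 0 = 0"
    by (rule DERIV_local_max[OF d1[of 0] e(1)]) (use e max' in auto)
  moreover have "0 < y \<bullet> (H *v y) + 2 * d * (y \<bullet> y)"
    using neg by simp
  ultimately obtain b where b: "b > 0" "\<And>h. 0 < h \<Longrightarrow> h < b \<Longrightarrow> 0 < \<phi>' h"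
    using DERIV_pos_inc_right[OF d2] by auto
  define t where "t = min e b / 2"
  have t: "0 < t" "t < e" "t < b"
    using e(1) b(1) by (auto simp: t_def)
  have "\<phi> 0 < \<phi> t"
  proof (rule DERIV_pos_imp_increasing_open[OF t(1)])
    show "\<exists>y. (\<phi> has_real_derivative y) (at x) \<and> 0 < y" if "0 < x" "x < t" for x
      using that t d1[of x] b(2)[of x] by auto
    show "continuous_on {0..t} \<phi>"
      by (rule DERIV_continuous_on[of _ _ \<phi>'], rule has_field_derivative_at_within, rule d1) (use t in auto)
  qed
  then show False
    using max'[of t] t by simp
qed

lemma has_derivative_grad:
  assumes "v differentiable (at x)"
  shows "(v has_derivative (\<lambda>h. grad v x \<bullet> h)) (at x)"
proof -
  let ?D = "frechet_derivative v (at x)"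
  have D: "(v has_derivative ?D) (at x)"
    using assms by (simp add: frechet_derivative_works)
  interpret D: bounded_linear ?D
    using D by (rule has_derivative_bounded_linear)
  have "?D h = grad v x \<bullet> h" for h
  proof -
    have "?D h = ?D (\<Sum>i\<in>UNIV. h $ i *\<^sub>R axis i 1)"
      by (simp add: basis_expansion scalar_mult_eq_scaleR[symmetric])
    also have "\<dots> = (\<Sum>i\<in>UNIV. h $ i * ?D (axis i 1))"
      by (simp add: D.sum D.scaleR)
    finally show ?thesis
      by (simp add: grad_def inner_vec_def mult.commute)
  qed
  then have "?D = (\<lambda>h. grad v x \<bullet> h)"
    by blast
  then show ?thesis
    using D by simp
qed

lemma grad_eqI:
  assumes "(v has_derivative (\<lambda>h. g \<bullet> h)) (at x)"
  shows "grad v x = g"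
proof -
  have "frechet_derivative v (at x) = (\<lambda>h. g \<bullet> h)"
    using assms by (metis frechet_derivative_at)
  then show ?thesis
    by (simp add: grad_def vec_eq_iff inner_axis)
qed

lemma has_derivative_hessian:
  assumes "grad v differentiable (at x)"
  shows "(grad v has_derivative (\<lambda>h. hessian v x *v h)) (at x)"
  using assms unfolding hessian_def by (simp add: jacobian_works)

lemma hessian_eqI:
  assumes U: "open U" "x \<in> U" and G: "\<And>x. x \<in> U \<Longrightarrow> (v has_derivative (\<lambda>h. G x \<bullet> h)) (at x)"
    and H: "(G has_derivative (\<lambda>h. H *v h)) (at x)"
  shows "(grad v has_derivative (\<lambda>h. H *v h)) (at x)" "hessian v x = H"
proof -
  show *: "(grad v has_derivative (\<lambda>h. H *v h)) (at x)"
    by (rule has_derivative_transform_within_open[OF H U]) (simp add: grad_eqI[OF G])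
  show "hessian v x = H"
    unfolding hessian_def jacobian_def using frechet_derivative_at[OF *] by (metis matrix_of_matrix_vector_mul)
qed

lemma C2_onI:
  assumes U: "open U" and G: "\<And>x. x \<in> U \<Longrightarrow> (v has_derivative (\<lambda>h. G x \<bullet> h)) (at x)"
    and H: "\<And>x. x \<in> U \<Longrightarrow> (G has_derivative (\<lambda>h. H x *v h)) (at x)" and "continuous_on U H"
  shows "C2_on U v"
proof -
  have "continuous_on U (hessian v)"
    by (rule continuous_on_cong[THEN iffD1, OF refl _ assms(4)]) (simp add: hessian_eqI(2)[OF U _ G H])
  then show ?thesis
    unfolding C2_on_def differentiable_def using G hessian_eqI(1)[OF U _ G H] by blast
qed

lemma C2_on_subset: "C2_on U v \<Longrightarrow> V \<subseteq> U \<Longrightarrow> C2_on V v"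
  unfolding C2_on_def by (meson continuous_on_subset subsetD)

lemma C2_on_uminus:
  assumes "C2_on U v" "open U"
  shows "C2_on U (\<lambda>x. - v x)" "\<And>x. x \<in> U \<Longrightarrow> hessian (\<lambda>x. - v x) x = - hessian v x"
proof -
  have G: "((\<lambda>x. - v x) has_derivative (\<lambda>h. - grad v x \<bullet> h)) (at x)" if "x \<in> U" for x
    using has_derivative_minus[OF has_derivative_grad[of v x]] assms that by (simp add: C2_on_def)
  have m: "- A *v h = - (A *v h)" for A :: mat3 and h
    using matrix_vector_mult_diff_rdistrib[of 0 A h] by simp
  have H: "((\<lambda>x. - grad v x) has_derivative (\<lambda>h. - hessian v x *v h)) (at x)" if "x \<in> U" for x
    using has_derivative_minus[OF has_derivative_hessian[of v x]] assms that by (simp add: C2_on_def m)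
  show "C2_on U (\<lambda>x. - v x)"
    by (rule C2_onI[OF assms(2) G H]) (use assms in \<open>auto simp: C2_on_def intro!: continuous_intros\<close>)
  show "hessian (\<lambda>x. - v x) x = - hessian v x" if "x \<in> U" for x
    by (rule hessian_eqI(2)[OF assms(2) that G H[OF that]])
qed

lemma C2_on_imp_continuous_on: "C2_on U v \<Longrightarrow> continuous_on U v"
  unfolding C2_on_def
  by (meson continuous_at_imp_continuous_on differentiable_imp_continuous_within)

lemma usc_on_continuous_on:
  assumes "continuous_on U w"
  shows "usc_on U w"
  unfolding usc_on_def
proof
  fix c
  have "openin (top_of_set U) (U \<inter> w -` {..<c})"
    using assms by (simp add: continuous_openin_preimage_gen)
  moreover have "U \<inter> w -` {..<c} = {x \<in> U. w x < c}"
    by auto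
  ultimately show "openin (top_of_set U) {x \<in> U. w x < c}"
    by simp
qed

lemma C2_touching:
  assumes U: "open U" "x0 \<in> U" and u: "C2_on U u" and v: "C2_on U v"
    and max: "\<And>x. x \<in> U \<Longrightarrow> u x + v x \<le> u x0 + v x0 + a \<bullet> (x - x0) - d * (norm (x - x0))\<^sup>2"
  shows "y \<bullet> (hessian u x0 *v y) + y \<bullet> (hessian v x0 *v y) \<le> - 2 * d * (y \<bullet> y)"
proof -
  have "y \<bullet> ((hessian u x0 + hessian v x0) *v y) \<le> - 2 * d * (y \<bullet> y)"
  proof (rule second_derivative_test[OF U, where f="\<lambda>x. u x + v x" and G="\<lambda>x. grad u x + grad v x"])
    show "((\<lambda>x. u x + v x) has_derivative (\<lambda>h. (grad u x + grad v x) \<bullet> h)) (at x)" if "x \<in> U" for x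
      using has_derivative_add[OF has_derivative_grad[of u x] has_derivative_grad[of v x]] u v that
      by (simp add: C2_on_def inner_add_left)
    show "((\<lambda>x. grad u x + grad v x) has_derivative (\<lambda>h. (hessian u x0 + hessian v x0) *v h)) (at x0)"
      using has_derivative_add[OF has_derivative_hessian[of u x0] has_derivative_hessian[of v x0]] u v U
      by (simp add: C2_on_def matrix_vector_mult_add_rdistrib)
  qed (rule max)
  then show ?thesis
    by (simp add: matrix_vector_mult_add_rdistrib inner_add_right)
qed

text \<open>A violation of subaffinity yields, after subtraction of the affine function, a positive
  interior value. By \<open>perturbed_maximum\<close> there is then a strict paraboloid above
  \<open>g\<close> at a point off the origin, which is left to \<open>touch\<close>, or a cone at
  the origin, which differentiability excludes. Second order information is thus only consulted off
  the origin.\<close>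

lemma subaffine_onI:
  fixes g :: "real^3 \<Rightarrow> real"
  assumes cont: "continuous_on U g" and diff: "0 \<in> U \<Longrightarrow> g differentiable (at 0)"
    and touch: "\<And>x0 r a d. 0 < r \<Longrightarrow> ball x0 r \<subseteq> U \<Longrightarrow> 0 \<notin> ball x0 r \<Longrightarrow> d > 0 \<Longrightarrow>
      (\<And>x. x \<in> ball x0 r \<Longrightarrow> g x \<le> g x0 + a \<bullet> (x - x0) - d * (norm (x - x0))\<^sup>2) \<Longrightarrow> False"
  shows "subaffine_on U g"
  unfolding subaffine_on_def
proof (intro conjI allI impI)
  show "usc_on U g"
    by (rule usc_on_continuous_on[OF cont])
  fix c :: "real^3" and r p b
  assume r: "r > 0" "cball c r \<subseteq> U" and bd: "\<forall>x\<in>sphere c r. g x \<le> p \<bullet> x + b"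
  show "\<forall>x\<in>cball c r. g x \<le> p \<bullet> x + b"
  proof (rule ccontr)
    define k where "k = (\<lambda>x. g x - p \<bullet> x - b)"
    assume "\<not> ?thesis"
    then obtain x1 where x1: "x1 \<in> cball c r" "k x1 > 0"
      by (auto simp: k_def not_le)
    have ck: "continuous_on (cball c r) k"
      unfolding k_def by (intro continuous_intros continuous_on_subset[OF cont r(2)])
    have bk: "k x \<le> 0" if "x \<in> sphere c r" for x
      using bspec[OF bd that] by (simp add: k_def)
    show False
    proof (rule perturbed_maximum[OF ck bk x1])
      fix d x0 e a
      assume d: "d > 0" and e: "e > 0" and sub: "ball x0 e \<subseteq> ball c r" and z: "0 \<notin> ball x0 e"
        and le: "\<And>x. x \<in> ball x0 e \<Longrightarrow> k x \<le> k x0 + a \<bullet> (x - x0) - d * (norm (x - x0))\<^sup>2"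
      show False
      proof (rule touch[OF e _ z d])
        show "ball x0 e \<subseteq> U"
          using sub r ball_subset_cball by blast
        show "g x \<le> g x0 + (a + p) \<bullet> (x - x0) - d * (norm (x - x0))\<^sup>2" if "x \<in> ball x0 e" for x
          using le[OF that] by (simp add: k_def inner_add_left inner_diff_right)
      qed
    next
      fix d a
      assume d: "d > 0" and 0: "0 \<in> ball c r"
        and le: "\<And>x. x \<in> cball c r \<Longrightarrow> k x \<le> k 0 + a \<bullet> x - d * norm x"
      have "g differentiable (at 0)"
        using 0 r ball_subset_cball by (intro diff) blast
      then obtain g' where g': "(g has_derivative g') (at 0)"
        by (auto simp: differentiable_def)
      show False
      proof (rule has_derivative_not_below_cone[OF g' d, where a="\<lambda>x. (a + p) \<bullet> x" and v="axis 1 1"])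
        have "\<forall>\<^sub>F x in nhds 0. x \<in> ball c r"
          by (rule eventually_nhds_in_open[OF open_ball 0])
        then show "\<forall>\<^sub>F x in nhds 0. g x \<le> g 0 + (a + p) \<bullet> (x - 0) - d * norm (x - 0)"
        proof eventually_elim
          case (elim x)
          then show ?case
            using le[of x] by (simp add: k_def inner_add_left)
        qed
        show "bounded_linear (\<lambda>x. (a + p) \<bullet> x)"
          by (rule bounded_linear_inner_right)
      qed (simp add: axis_eq_0_iff)
    qed
  qed
qed

lemma subaffine_on_sum:
  assumes f: "continuous_on (ball c r) f" "f differentiable (at 0)" "C2_on (ball c r - {0}) f"
    and v: "C2_on (ball c r) v"
    and no: "\<And>x0 d. x0 \<in> ball c r - {0} \<Longrightarrow> d > 0 \<Longrightarrow>
      (\<And>y. y \<bullet> (hessian f x0 *v y) + y \<bullet> (hessian v x0 *v y) \<le> - d * (y \<bullet> y)) \<Longrightarrow> False"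
  shows "subaffine_on (ball c r) (\<lambda>x. f x + v x)"
proof (rule subaffine_onI)
  show "continuous_on (ball c r) (\<lambda>x. f x + v x)"
    by (intro continuous_intros f C2_on_imp_continuous_on v)
  show "(\<lambda>x. f x + v x) differentiable (at 0)" if "0 \<in> ball c r"
    using v that by (intro differentiable_add f) (simp add: C2_on_def)
  fix x0 s a d
  assume s: "0 < s" "ball x0 s \<subseteq> ball c r" "0 \<notin> ball x0 s" and d: "0 < (d::real)"
    and le: "\<And>x. x \<in> ball x0 s \<Longrightarrow> f x + v x \<le> f x0 + v x0 + a \<bullet> (x - x0) - d * (norm (x - x0))\<^sup>2"
  have x0: "x0 \<in> ball x0 s"
    using s by simp
  have "C2_on (ball x0 s) f"
    using s by (intro C2_on_subset[OF f(3)]) blast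
  then have "y \<bullet> (hessian f x0 *v y) + y \<bullet> (hessian v x0 *v y) \<le> - 2 * d * (y \<bullet> y)" for y
    using C2_touching[OF open_ball x0 _ C2_on_subset[OF v s(2)] le] by blast
  moreover have "x0 \<in> ball c r - {0}"
    using s x0 by blast
  ultimately show False
    using no[of x0 "2 * d"] d by simp
qed

lemma half_square_C2: "C2_on U (\<lambda>x. (1 / 2) * (x \<bullet> x))" "hessian (\<lambda>x. (1 / 2) * (x \<bullet> x)) x = mat 1"
proof -
  have G: "((\<lambda>x. (1 / 2) * (x \<bullet> x)) has_derivative (\<lambda>h. x \<bullet> h)) (at x)" for x :: "real^3"
    by (auto intro!: derivative_eq_intros simp: inner_commute)
  have H: "((\<lambda>x. x) has_derivative (\<lambda>h. mat 1 *v h)) (at x)" for x :: "real^3"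
    by simp
  show "C2_on U (\<lambda>x. (1 / 2) * (x \<bullet> x))"
    by (rule C2_on_subset[OF C2_onI[OF open_UNIV G H]]) auto
  show "hessian (\<lambda>x. (1 / 2) * (x \<bullet> x)) x = mat 1"
    by (rule hessian_eqI(2)[OF open_UNIV _ G H]) simp
qed

lemma half_square_type: "mat 1 \<in> G \<Longrightarrow> C2_of_type G U (\<lambda>x. (1 / 2) * (x \<bullet> x))"
  unfolding C2_of_type_def half_square_C2(2) by (simp only: half_square_C2(1)) simp

section \<open>Existence and uniqueness for a function that solves the equation off the
  origin\<close>

context
  fixes u :: "real^3 \<Rightarrow> real" and \<epsilon> \<theta> :: real
  assumes eps: "\<epsilon> > 0" and cont: "continuous_on (cball 0 \<epsilon>) u" and diff0: "u differentiable (at 0)"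
    and C2: "C2_on (ball 0 \<epsilon> - {0}) u"
    and sym: "\<And>x. x \<in> ball 0 \<epsilon> - {0} \<Longrightarrow> hessian u x \<in> Sym2"
    and angle: "\<And>x. x \<in> ball 0 \<epsilon> - {0} \<Longrightarrow> lag_angle (hessian u x) = \<theta>"
begin

lemma ball_off_zero:
  assumes "ball x0 r \<subseteq> ball 0 \<epsilon>" "0 \<notin> ball x0 r" "r > 0"
  shows "C2_on (ball x0 r) u" "x0 \<in> ball 0 \<epsilon> - {0}"
proof -
  have "ball x0 r \<subseteq> ball 0 \<epsilon> - {0}" "x0 \<in> ball x0 r"
    using assms by auto
  then show "C2_on (ball x0 r) u" "x0 \<in> ball 0 \<epsilon> - {0}"
    using C2_on_subset[OF C2] by blast+
qed

lemma isolated_singularity_solution: "HL_solution (F_set \<theta>) 0 \<epsilon> u u"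
  unfolding HL_solution_def F_Dirichlet_def of_type_def of_dual_type_def usc_tested_by_def
proof (intro conjI ballI allI impI cont)
  have cb: "continuous_on (ball 0 \<epsilon>) u"
    using cont by (rule continuous_on_subset) auto
  show "usc_on (ball 0 \<epsilon>) u" "usc_on (ball 0 \<epsilon>) (\<lambda>x. - u x)"
    by (auto intro!: usc_on_continuous_on continuous_intros cb)
  fix c :: "real^3" and r v
  assume r: "r > 0" "ball c r \<subseteq> ball 0 \<epsilon>"
  have opn: "open (ball c r - {0})"
    by (intro open_delete) simp
  have sub: "ball c r - {0} \<subseteq> ball 0 \<epsilon> - {0}"
    using r by blast
  have u2: "C2_on (ball c r - {0}) u"
    by (rule C2_on_subset[OF C2 sub])
  have hyp: "hessian u x0 \<in> Sym2" "lag_angle (hessian u x0) = \<theta>" if "x0 \<in> ball c r - {0}" for x0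
    using sym angle sub that by blast+
  show "subaffine_on (ball c r) (\<lambda>x. u x + v x)" if v: "C2_of_type (dirichlet_dual (F_set \<theta>)) (ball c r) v"
  proof (rule subaffine_on_sum[OF continuous_on_subset[OF cb r(2)] diff0 u2])
    fix x0 :: "real^3" and d :: real
    assume x0: "x0 \<in> ball c r - {0}" and d: "d > 0"
      and le: "\<And>y. y \<bullet> (hessian u x0 *v y) + y \<bullet> (hessian v x0 *v y) \<le> - d * (y \<bullet> y)"
    have "hessian v x0 \<in> dirichlet_dual (F_set \<theta>)"
      using v x0 unfolding C2_of_type_def by blast
    then show False
      using le hyp[OF x0] d by (intro dirichlet_dual_not_below[of "hessian v x0" \<theta> "hessian u x0" d]) (auto simp: add.commute)
  qed (use v in \<open>simp add: C2_of_type_def\<close>)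
  show "subaffine_on (ball c r) (\<lambda>x. - u x + v x)" if v: "C2_of_type (F_set \<theta>) (ball c r) v"
  proof (rule subaffine_on_sum[OF continuous_on_minus[OF continuous_on_subset[OF cb r(2)]]
        differentiable_minus[OF diff0] C2_on_uminus(1)[OF u2 opn]])
    fix x0 :: "real^3" and d :: real
    assume x0: "x0 \<in> ball c r - {0}" and d: "d > 0"
      and le: "\<And>y. y \<bullet> (hessian (\<lambda>x. - u x) x0 *v y) + y \<bullet> (hessian v x0 *v y) \<le> - d * (y \<bullet> y)"
    have "hessian v x0 \<in> F_set \<theta>"
      using v x0 unfolding C2_of_type_def by blast
    moreover have "- A *v y = - (A *v y)" for A :: mat3 and y
      using matrix_vector_mult_diff_rdistrib[of 0 A y] by simp
    ultimately show False
      using le hyp[OF x0] d unfolding C2_on_uminus(2)[OF u2 opn x0]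
      by (intro F_set_not_below[of "hessian v x0" \<theta> "hessian u x0" d]) (auto simp: add.commute)
  qed (use v in \<open>simp add: C2_of_type_def\<close>)
qed simp

text \<open>Near the origin \<open>k\<close> is close to its tangent plane, so \<open>w\<close> lies
  below an affine function minus half of the cone. On a small sphere this outweighs the added half
  square. The subaffine sum is then below an affine function by a margin on the sphere, but not at
  the centre.\<close>

lemma no_cone_from_above:
  assumes cont: "continuous_on (cball 0 \<epsilon>) w"
    and sub: "\<And>r. r > 0 \<Longrightarrow> r \<le> \<epsilon> \<Longrightarrow> subaffine_on (ball 0 r) (\<lambda>x. w x + (1 / 2) * (x \<bullet> x))"
    and k: "k differentiable (at 0)" and d: "d > 0"
    and le: "\<And>x. x \<in> cball 0 \<epsilon> \<Longrightarrow> w x - k x \<le> w 0 - k 0 + a \<bullet> x - d * norm x"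
  shows False
proof -
  have "(k has_derivative (\<lambda>h. grad k 0 \<bullet> h)) (at 0)"
    by (rule has_derivative_grad[OF k])
  then have "\<forall>\<^sub>F y in at 0. norm (k y - k 0 - grad k 0 \<bullet> (y - 0)) \<le> (d / 2) * norm (y - 0)"
    using half_gt_zero[OF d] unfolding has_derivative_within_alt2 by blast
  then have "\<forall>\<^sub>F y in nhds 0. norm (k y - k 0 - grad k 0 \<bullet> (y - 0)) \<le> (d / 2) * norm (y - 0)"
    unfolding eventually_at_filter by (rule eventually_mono) auto
  then obtain e where e: "e > 0" "\<And>y. norm y < e \<Longrightarrow> \<bar>k y - k 0 - grad k 0 \<bullet> y\<bar> \<le> (d / 2) * norm y"
    unfolding eventually_nhds_metric by auto
  \<comment> \<open>With \<open>r \<le> d / 2\<close> the half square is at most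
    \<open>(d / 4) * r\<close> on the sphere. This uses up half of the \<open>(d / 2) * r\<close>
    that the cone retains after the deviation of \<open>k\<close> has been paid for.\<close>
  define r where "r = min (min e \<epsilon>) d / 2"
  have r: "r > 0" "r < e" "r < \<epsilon>" "r \<le> d / 2"
    using e eps d by (auto simp: r_def)
  define p where "p = a + grad k 0"
  have "w x + (1 / 2) * (x \<bullet> x) \<le> p \<bullet> x + (w 0 - d * r / 4)" if "x \<in> sphere 0 r" for x
  proof -
    have x: "norm x = r"
      using that by simp
    have "w x \<le> w 0 + a \<bullet> x - d * r + (k x - k 0)"
      using le[of x] x r by simp
    also have "k x - k 0 \<le> grad k 0 \<bullet> x + (d / 2) * r"
      using abs_le_D1[OF e(2)[of x]] x r by simp
    finally have "w x \<le> w 0 + p \<bullet> x - (d / 2) * r"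
      by (simp add: p_def inner_add_left)
    moreover have "(1 / 2) * (x \<bullet> x) \<le> (d / 4) * r"
      using x r by (simp add: power2_norm_eq_inner[symmetric] power2_eq_square)
    ultimately show ?thesis
      by (simp add: field_simps)
  qed
  moreover have "subaffine_on (ball 0 \<epsilon>) (\<lambda>x. w x + (1 / 2) * (x \<bullet> x))"
    using sub[of \<epsilon>] eps by simp
  moreover have "cball 0 r \<subseteq> ball 0 \<epsilon>"
    using r by auto
  ultimately have "\<forall>x\<in>cball 0 r. w x + (1 / 2) * (x \<bullet> x) \<le> p \<bullet> x + (w 0 - d * r / 4)"
    using r(1) unfolding subaffine_on_def by blast
  then have "w 0 \<le> w 0 - d * r / 4"
    using r(1) by (auto dest!: bspec[of _ _ 0])
  then show False
    using d r by (simp add: mult_le_0_iff)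
qed

text \<open>Subaffinity of \<open>w - k\<close> contradicts a strict paraboloid at a point off the
  origin. At the origin, regularity of \<open>k\<close> and subaffinity of \<open>w\<close> plus the
  half square take over, through \<open>no_cone_from_above\<close>.\<close>

lemma comparison:
  assumes w: "continuous_on (cball 0 \<epsilon>) w" and bd: "\<And>x. x \<in> sphere 0 \<epsilon> \<Longrightarrow> w x \<le> k x"
    and k: "continuous_on (cball 0 \<epsilon>) k" "k differentiable (at 0)"
    and par: "\<And>r. r > 0 \<Longrightarrow> r \<le> \<epsilon> \<Longrightarrow> subaffine_on (ball 0 r) (\<lambda>x. w x + (1 / 2) * (x \<bullet> x))"
    and sub: "\<And>x0 r. r > 0 \<Longrightarrow> ball x0 r \<subseteq> ball 0 \<epsilon> \<Longrightarrow> 0 \<notin> ball x0 r \<Longrightarrow> subaffine_on (ball x0 r) (\<lambda>x. w x + - k x)"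
    and x: "x \<in> cball 0 \<epsilon>"
  shows "w x \<le> k x"
proof (rule ccontr)
  assume "\<not> w x \<le> k x"
  then have x1: "w x - k x > 0"
    by simp
  have cg: "continuous_on (cball 0 \<epsilon>) (\<lambda>x. w x - k x)"
    by (intro continuous_intros w k)
  have bg: "w x - k x \<le> 0" if "x \<in> sphere 0 \<epsilon>" for x
    using bd[OF that] by simp
  show False
  proof (rule perturbed_maximum[OF cg bg x x1])
    fix d x0 e a
    assume d: "d > 0" and e: "e > 0" and sub': "ball x0 e \<subseteq> ball 0 \<epsilon>" and z: "0 \<notin> ball x0 e"
      and le: "\<And>x. x \<in> ball x0 e \<Longrightarrow> w x - k x \<le> w x0 - k x0 + a \<bullet> (x - x0) - d * (norm (x - x0))\<^sup>2"
    \<comment> \<open>The paraboloid has dropped by \<open>d * (e / 2)\<^sup>2\<close> on the sphere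
      of radius \<open>e / 2\<close>. Putting this drop into the affine function keeps the bound on
      the sphere and breaks it at the centre.\<close>
    define p where "p = w x0 - k x0 - a \<bullet> x0 - d * (e / 2)\<^sup>2"
    have cb: "cball x0 (e / 2) \<subseteq> ball x0 e"
      using e by auto
    have "w x + - k x \<le> a \<bullet> x + p" if "x \<in> sphere x0 (e / 2)" for x
    proof -
      have n: "norm (x - x0) = e / 2"
        using that by (simp add: dist_norm norm_minus_commute)
      moreover have "x \<in> ball x0 e"
        using that cb by (meson sphere_cball subsetD)
      ultimately show ?thesis
        using le[of x] unfolding n by (simp add: p_def inner_diff_right)
    qed
    then have "\<forall>x\<in>cball x0 (e / 2). w x + - k x \<le> a \<bullet> x + p"
      using sub[OF e sub' z] e cb unfolding subaffine_on_def by (meson half_gt_zero)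
    then have "w x0 - k x0 \<le> a \<bullet> x0 + p"
      using e by (auto dest!: bspec[of _ _ x0])
    then show False
      using d e by (simp add: p_def mult_le_0_iff)
  next
    fix d a
    assume "d > 0" "0 \<in> ball (0::real^3) \<epsilon>"
      "\<And>x. x \<in> cball 0 \<epsilon> \<Longrightarrow> w x - k x \<le> w 0 - k 0 + a \<bullet> x - d * norm x"
    then show False
      by (intro no_cone_from_above[OF w par k(2), of d a])
  qed
qed

text \<open>Off the origin \<open>u\<close> has angle exactly \<open>\<theta>\<close>, so there
  \<open>- u\<close> is a test function for type \<open>F\<close> and \<open>u\<close> one for the
  dual type. Comparison applies to \<open>w\<close> against \<open>u\<close> and to
  \<open>- w\<close> against \<open>- u\<close>.\<close>

lemma isolated_singularity_unique:
  assumes \<theta>: "- pi / 2 < \<theta>" "\<theta> < pi / 2" and w: "HL_solution (F_set \<theta>) 0 \<epsilon> u w" and x: "x \<in> cball 0 \<epsilon>"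
  shows "w x = u x"
proof (rule antisym)
  have wc: "continuous_on (cball 0 \<epsilon>) w" and wb: "\<And>x. x \<in> sphere 0 \<epsilon> \<Longrightarrow> w x = u x"
    and w1: "\<And>c r v. r > 0 \<Longrightarrow> ball c r \<subseteq> ball 0 \<epsilon> \<Longrightarrow> C2_of_type (dirichlet_dual (F_set \<theta>)) (ball c r) v
      \<Longrightarrow> subaffine_on (ball c r) (\<lambda>x. w x + v x)"
    and w2: "\<And>c r v. r > 0 \<Longrightarrow> ball c r \<subseteq> ball 0 \<epsilon> \<Longrightarrow> C2_of_type (F_set \<theta>) (ball c r) v
      \<Longrightarrow> subaffine_on (ball c r) (\<lambda>x. - w x + v x)"
    using w by (auto simp: HL_solution_def F_Dirichlet_def of_type_def of_dual_type_def usc_tested_by_def)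
  have "- mat 1 = (mat (- 1) :: mat3)"
    by (simp add: mat_def vec_eq_iff)
  \<comment> \<open>The identity has angle 3 pi / 4 and its negative - 3 pi / 4;
    \<open>\<theta>\<close> lies between the two, so the half square may be added to
    \<open>w\<close> as well as to \<open>- w\<close>.\<close>
  then have "lag_angle (- mat 1) \<le> \<theta>"
    using \<theta> by (simp only: lag_angle_mat arctan_minus arctan_one)
  then have m1: "mat 1 \<in> dirichlet_dual (F_set \<theta>)"
    using uminus_in_dirichlet_dual[of "- mat 1" \<theta>] by (simp add: Sym2_simps)
  have m2: "mat 1 \<in> F_set \<theta>"
    using \<theta> by (simp add: F_set_iff lag_angle_mat arctan_one)
  show "w x \<le> u x"
  proof (rule comparison[OF wc _ cont diff0 _ _ x])
    show "subaffine_on (ball 0 r) (\<lambda>x. w x + (1 / 2) * (x \<bullet> x))" if "r > 0" "r \<le> \<epsilon>" for r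
      using that by (intro w1 half_square_type m1) auto
    show "subaffine_on (ball x0 r) (\<lambda>x. w x + - u x)" if r: "r > 0" "ball x0 r \<subseteq> ball 0 \<epsilon>" "0 \<notin> ball x0 r" for x0 r
    proof (rule w1[OF r(1,2)])
      have "hessian u x \<in> Sym2" "lag_angle (hessian u x) = \<theta>" if "x \<in> ball x0 r" for x
      proof -
        have "x \<in> ball 0 \<epsilon> - {0}"
          using that r by blast
        then show "hessian u x \<in> Sym2" "lag_angle (hessian u x) = \<theta>"
          by (auto simp only: sym angle)
      qed
      then show "C2_of_type (dirichlet_dual (F_set \<theta>)) (ball x0 r) (\<lambda>x. - u x)"
        using C2_on_uminus[OF ball_off_zero(1)[OF r(2,3,1)] open_ball]
        by (simp add: C2_of_type_def uminus_in_dirichlet_dual)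
    qed
  qed (simp add: wb)
  have "- w x \<le> - u x"
  proof (rule comparison[OF _ _ _ _ _ _ x])
    show "continuous_on (cball 0 \<epsilon>) (\<lambda>x. - w x)" "continuous_on (cball 0 \<epsilon>) (\<lambda>x. - u x)"
      by (intro continuous_intros wc cont)+
    show "(\<lambda>x. - u x) differentiable (at 0)"
      by (intro differentiable_minus diff0)
    show "subaffine_on (ball 0 r) (\<lambda>x. - w x + (1 / 2) * (x \<bullet> x))" if "r > 0" "r \<le> \<epsilon>" for r
      using that by (intro w2 half_square_type m2) auto
    show "subaffine_on (ball x0 r) (\<lambda>x. - w x + - (- u x))" if r: "r > 0" "ball x0 r \<subseteq> ball 0 \<epsilon>" "0 \<notin> ball x0 r" for x0 r
    proof (rule w2[OF r(1,2)])
      have "hessian u x \<in> F_set \<theta>" if "x \<in> ball x0 r" for x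
      proof -
        have "x \<in> ball 0 \<epsilon> - {0}"
          using that r by blast
        then show ?thesis
          by (simp only: F_set_iff sym angle) simp
      qed
      then show "C2_of_type (F_set \<theta>) (ball x0 r) (\<lambda>x. - (- u x))"
        using ball_off_zero(1)[OF r(2,3,1)] by (simp add: C2_of_type_def)
    qed
  qed (simp add: wb)
  then show "u x \<le> w x"
    by simp
qed

end

section \<open>Rank one perturbations of diagonal matrices\<close>

text \<open>The bracket is the imaginary part of exp(- i \<open>\<theta>\<close>) (1 + i a) (1 + i
  b) (1 + i c). The product of the cosines is the inverse of the modulus of that number.\<close>

lemma sum_arctan_phase:
  "sin (arctan a + arctan b + arctan c - \<theta>) =
    (cos \<theta> * (a + b + c - a * b * c) - sin \<theta> * (1 - (a * b + a * c + b * c))) *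
    (cos (arctan a) * cos (arctan b) * cos (arctan c))"
proof -
  have s: "sin (arctan x) = x * cos (arctan x)" for x
    using tan_arctan[of x] by (simp add: tan_def nonzero_divide_eq_eq)
  show ?thesis
    by (simp add: sin_diff sin_add cos_add s algebra_simps)
qed

text \<open>The shape of the Hessian of an envelope of diagonal quadratic forms: differentiating the
  coefficients through the critical parameter contributes the rank one term.\<close>

definition diag_rank_one :: "(3 \<Rightarrow> real) \<Rightarrow> real \<Rightarrow> (3 \<Rightarrow> real) \<Rightarrow> mat3" where
  "diag_rank_one m k w = (\<chi> i j. (if i = j then m i else 0) + k * w i * w j)"

lemma diag_rank_one_Sym2: "diag_rank_one m k w \<in> Sym2"
  by (simp add: Sym2_def diag_rank_one_def transpose_def vec_eq_iff ac_simps)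

lemma diag_rank_one_form:
  "x \<bullet> (diag_rank_one m k w *v x) = (\<Sum>i\<in>UNIV. m i * (x $ i)\<^sup>2) + k * (\<Sum>i\<in>UNIV. w i * x $ i)\<^sup>2"
  by (simp add: diag_rank_one_def inner_vec_def matrix_vector_mult_def sum_3 power2_eq_square algebra_simps)

lemma lag_angle_diag: "lag_angle (diag_rank_one m 0 w) = arctan (m 1) + arctan (m 2) + arctan (m 3)"
proof -
  have "eigenvalues (diag_rank_one m 0 w) = {#m 1, m 2, m 3#}"
    by (rule eigenvalues_eqI) (simp add: det_3 diag_rank_one_def mat_def)
  then show ?thesis
    by (simp add: lag_angle_def)
qed

text \<open>Assumption \<open>eq\<close> says that the sine of the angle minus
  \<open>\<theta>\<close> is 0, written in the elementary symmetric functions of the eigenvalues. As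
  \<open>k\<close> is nonnegative, the angle lies above that of the diagonal part by less than pi;
  with \<open>lower\<close> and \<open>upper\<close>, only the zero of the sine at 0 is
  left.\<close>

lemma lag_angle_diag_rank_one:
  fixes m w :: "3 \<Rightarrow> real"
  defines "a \<equiv> m 1" and "b \<equiv> m 2" and "c \<equiv> m 3"
  assumes k: "k \<ge> 0"
    and lower: "\<theta> - pi < arctan a + arctan b + arctan c" and upper: "arctan a + arctan b + arctan c < \<theta>"
    and eq: "cos \<theta> * (a + b + c - a * b * c) - sin \<theta> * (1 - (a * b + a * c + b * c)) +
      k * ((w 1)\<^sup>2 * (cos \<theta> * (1 - b * c) + sin \<theta> * (b + c)) +
           (w 2)\<^sup>2 * (cos \<theta> * (1 - a * c) + sin \<theta> * (a + c)) +
           (w 3)\<^sup>2 * (cos \<theta> * (1 - a * b) + sin \<theta> * (a + b))) = 0"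
  shows "lag_angle (diag_rank_one m k w) = \<theta>"
proof -
  let ?M = "diag_rank_one m k w" and ?D = "diag_rank_one m 0 w"
  obtain q l where l: "eigensystem ?M q l"
    using eigensystem_exists[OF diag_rank_one_Sym2] by blast
  define x y z where "x = l 1" and "y = l 2" and "z = l 3"
  have det: "det (mat t - ?M) = (t - x) * (t - y) * (t - z)" for t
    by (simp add: eigensystem_det[OF l] prod_UNIV_3 x_def y_def z_def)
  define u v r where "u = k * (w 1)\<^sup>2" and "v = k * (w 2)\<^sup>2" and "r = k * (w 3)\<^sup>2"
  have det': "det (mat t - ?M) = (t - a) * (t - b) * (t - c)
      - u * (t - b) * (t - c) - v * (t - a) * (t - c) - r * (t - a) * (t - b)" for t
    by (simp add: det_3 diag_rank_one_def mat_def a_def b_def c_def u_def v_def r_def power2_eq_square algebra_simps)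
  \<comment> \<open>The elementary symmetric functions of the eigenvalues are read off by comparing
    both forms of the characteristic polynomial at 0, 1 and -1.\<close>
  note d = det[unfolded det']
  have e3: "x * y * z = a * b * c + u * b * c + v * a * c + r * a * b"
    using d[of 0] by (simp add: algebra_simps)
  have e2: "x * y + x * z + y * z = a * b + a * c + b * c + u * (b + c) + v * (a + c) + r * (a + b)"
    using d[of 1] d[of "- 1"] by (simp add: algebra_simps)
  have e1: "x + y + z = a + b + c + u + v + r"
    using d[of 1] d[of "- 1"] e3 by (simp add: algebra_simps)
  have "sin (arctan x + arctan y + arctan z - \<theta>) = 0"
    unfolding sum_arctan_phase e1 e2 e3 using eq
    by (simp add: u_def v_def r_def algebra_simps)
  moreover have "lag_angle ?M = arctan x + arctan y + arctan z"
    by (simp add: lag_angle_eigensystem[OF l] x_def y_def z_def)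
  moreover have "lag_angle ?D \<le> lag_angle ?M"
    by (intro lag_angle_mono diag_rank_one_Sym2) (simp add: diag_rank_one_form k)
  moreover have "lag_angle ?M < lag_angle ?D + pi"
  proof (intro lag_angle_rank_one[of _ _ "\<chi> i. w i"] diag_rank_one_Sym2)
    fix x :: "real^3" assume "x \<bullet> (\<chi> i. w i) = 0"
    then have "(\<Sum>i\<in>UNIV. w i * x $ i) = 0"
      by (simp add: inner_vec_def mult.commute)
    then show "x \<bullet> (?M *v x) \<le> x \<bullet> (?D *v x)"
      by (simp add: diag_rank_one_form)
  qed
  ultimately show ?thesis
    using lower upper sin_eq_0_pi[of "lag_angle ?M - \<theta>"]
    by (simp add: lag_angle_diag a_def b_def c_def)
qed

text \<open>A secant criterion: the slope \<open>v\<close> may depend on \<open>y\<close>, as it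
  does when a difference of squares is factored. It allows \<open>U\<close> and
  \<open>\<sigma>\<close> to be differentiated from exact algebraic identities, with continuity of
  \<open>\<sigma>\<close> as the only input about \<open>\<sigma>\<close>.\<close>

lemma has_derivative_slope:
  fixes f :: "'a::real_inner \<Rightarrow> real"
  assumes ev: "\<forall>\<^sub>F y in at x. \<bar>f y - f x - v y \<bullet> (y - x)\<bar> \<le> r y * norm (y - x)"
    and v: "(v \<longlongrightarrow> v0) (at x)" and r: "(r \<longlongrightarrow> 0) (at x)"
  shows "(f has_derivative (\<lambda>h. v0 \<bullet> h)) (at x)"
  unfolding has_derivative_at
proof
  show "bounded_linear (\<lambda>h. v0 \<bullet> h)"
    by (rule bounded_linear_inner_right)
  have "((\<lambda>y. r y + norm (v y - v0)) \<longlongrightarrow> 0) (at x)"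
    using tendsto_add[OF r tendsto_norm[OF tendsto_diff[OF v tendsto_const[of v0]]]] by simp
  moreover have "\<forall>\<^sub>F y in at x. norm (norm (f y - f x - v0 \<bullet> (y - x)) / norm (y - x)) \<le> r y + norm (v y - v0)"
    using ev eventually_neq_at_within[of x]
  proof eventually_elim
    case (elim y)
    have "f y - f x - v0 \<bullet> (y - x) = (f y - f x - v y \<bullet> (y - x)) + (v y - v0) \<bullet> (y - x)"
      by (simp add: inner_diff_left)
    then have "\<bar>f y - f x - v0 \<bullet> (y - x)\<bar> \<le> r y * norm (y - x) + norm (v y - v0) * norm (y - x)"
      using elim(1) Cauchy_Schwarz_ineq2[of "v y - v0" "y - x"] by linarith
    then show ?case
      using elim(2) by (simp add: divide_le_eq algebra_simps)
  qed
  ultimately have "((\<lambda>y. norm (f y - f x - v0 \<bullet> (y - x)) / norm (y - x)) \<longlongrightarrow> 0) (at x)"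
    by (rule Lim_null_comparison[rotated])
  then show "((\<lambda>h. norm (f (x + h) - f x - v0 \<bullet> h) / norm h) \<longlongrightarrow> 0) (at 0)"
    by (subst (asm) LIM_offset_zero_iff[of x]) (auto simp: algebra_simps)
qed

section \<open>Envelopes of quadrics\<close>

text \<open>The worst case is an interval symmetric about 0, where the cube is flattest: for
  \<open>s = - t\<close> equality holds.\<close>

lemma cube_diff_ge:
  fixes s t :: real
  assumes "s \<le> t"
  shows "t ^ 3 - s ^ 3 \<ge> (t - s) ^ 3 / 4"
proof -
  have "t ^ 3 - s ^ 3 - (t - s) ^ 3 / 4 = (t - s) * (3 * (t + s)\<^sup>2 / 4)"
    by (simp add: power2_eq_square power3_eq_cube field_simps)
  also have "\<dots> \<ge> 0"
    using assms by (intro mult_nonneg_nonneg) auto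
  finally show ?thesis
    by simp
qed

text \<open>\<open>P\<close> is the derivative of \<open>p\<close>. Where \<open>p j s\<close> is
  nonzero, \<open>P_eq\<close> says that \<open>(1 + (m j s)\<^sup>2) / p j s\<close> has derivative
  1. Assumption \<open>phase\<close> relates the imaginary part of exp(- i \<open>\<theta>\<close>)
  times the product of the 1 + i \<open>m j s\<close> to its real part, with factor
  \<open>- 2 * q s\<close>; \<open>angle\<close> selects the branch. The quadratic bounds
  \<open>P1\<close> encode the degeneracy along the first axis.\<close>

locale envelope =
  fixes p P m :: "3 \<Rightarrow> real \<Rightarrow> real" and q h :: "real \<Rightarrow> real" and K \<delta> c C \<theta> :: real
  assumes delta: "\<delta> > 0" and c: "c > 0" and K: "K > 0" and p10: "p 1 0 = K"
    and dp: "\<And>j s. \<bar>s\<bar> \<le> \<delta> \<Longrightarrow> (p j has_real_derivative P j s) (at s)"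
    and dm: "\<And>j s. \<bar>s\<bar> \<le> \<delta> \<Longrightarrow> (m j has_real_derivative q s * p j s) (at s)"
    and dh: "\<And>s. \<bar>s\<bar> \<le> \<delta> \<Longrightarrow> (h has_real_derivative - (K / 2) * q s) (at s)"
    and contP: "\<And>j s. \<bar>s\<bar> \<le> \<delta> \<Longrightarrow> isCont (P j) s" and contq: "\<And>s. \<bar>s\<bar> \<le> \<delta> \<Longrightarrow> isCont q s"
    and P1: "\<And>s. \<bar>s\<bar> \<le> \<delta> \<Longrightarrow> c * s\<^sup>2 \<le> P 1 s" "\<And>s. \<bar>s\<bar> \<le> \<delta> \<Longrightarrow> P 1 s \<le> C * s\<^sup>2"
    and P23: "\<And>j s. \<bar>s\<bar> \<le> \<delta> \<Longrightarrow> j \<noteq> 1 \<Longrightarrow> c \<le> P j s"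
    and q_neg: "\<And>s. \<bar>s\<bar> \<le> \<delta> \<Longrightarrow> q s < 0"
    and P_eq: "\<And>j s. \<bar>s\<bar> \<le> \<delta> \<Longrightarrow> P j s * (1 + (m j s)\<^sup>2) = (p j s)\<^sup>2 * (2 * m j s * q s - 1)"
    and angle: "\<And>s. \<bar>s\<bar> \<le> \<delta> \<Longrightarrow> \<theta> - pi < arctan (m 1 s) + arctan (m 2 s) + arctan (m 3 s)"
      "\<And>s. \<bar>s\<bar> \<le> \<delta> \<Longrightarrow> arctan (m 1 s) + arctan (m 2 s) + arctan (m 3 s) < \<theta>"
    and phase: "\<And>s. \<bar>s\<bar> \<le> \<delta> \<Longrightarrow>
      cos \<theta> * (m 1 s + m 2 s + m 3 s - m 1 s * m 2 s * m 3 s)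
        - sin \<theta> * (1 - (m 1 s * m 2 s + m 1 s * m 3 s + m 2 s * m 3 s)) =
      - 2 * q s * (cos \<theta> * (1 - (m 1 s * m 2 s + m 1 s * m 3 s + m 2 s * m 3 s))
        + sin \<theta> * (m 1 s + m 2 s + m 3 s - m 1 s * m 2 s * m 3 s))"
begin

definition sh :: "real^3 \<Rightarrow> 3 \<Rightarrow> real" where "sh x j = x $ j + (if j = 1 then 1 else 0)"

definition G :: "real \<Rightarrow> real^3 \<Rightarrow> real" where "G s x = (\<Sum>j\<in>UNIV. p j s * (sh x j)\<^sup>2) - K"

definition GS :: "real \<Rightarrow> real^3 \<Rightarrow> real" where "GS s x = (\<Sum>j\<in>UNIV. P j s * (sh x j)\<^sup>2)"

definition \<Phi> :: "real \<Rightarrow> real^3 \<Rightarrow> real" where "\<Phi> s x = (\<Sum>j\<in>UNIV. m j s * (sh x j)\<^sup>2) / 2 + h s"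

lemma sh_simps: "sh x 1 = x $ 1 + 1" "sh x 2 = x $ 2" "sh x 3 = x $ 3"
  by (simp_all add: sh_def)

lemma DERIV_G: "\<bar>s\<bar> \<le> \<delta> \<Longrightarrow> ((\<lambda>s. G s x) has_real_derivative GS s x) (at s)"
  unfolding G_def GS_def by (auto intro!: derivative_eq_intros dp)

lemma DERIV_\<Phi>:
  assumes "\<bar>s\<bar> \<le> \<delta>"
  shows "((\<lambda>s. \<Phi> s x) has_real_derivative (q s / 2) * G s x) (at s)"
proof -
  have "((\<lambda>s. \<Phi> s x) has_real_derivative (\<Sum>j\<in>UNIV. q s * p j s * (sh x j)\<^sup>2) / 2 + - (K / 2) * q s) (at s)"
    unfolding \<Phi>_def using assms by (auto intro!: derivative_eq_intros dm dh)
  then show ?thesis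
    unfolding G_def by (simp add: sum_distrib_left sum_divide_distrib algebra_simps diff_divide_distrib)
qed

text \<open>The bound degenerates only for \<open>s = 0\<close> on the first axis. The factor 1 / 4
  is due to \<open>x $ 1 + 1\<close>, which is at least 1 / 2.\<close>

lemma GS_lower:
  assumes s: "\<bar>s\<bar> \<le> \<delta>" and x: "norm x \<le> 1 / 2"
  shows "GS s x \<ge> (c / 4) * s\<^sup>2 + c * ((x $ 2)\<^sup>2 + (x $ 3)\<^sup>2)"
proof -
  have "\<bar>x $ 1\<bar> \<le> 1 / 2"
    using component_le_norm_cart[of x 1] x by linarith
  then have "(1 / 2)\<^sup>2 \<le> (x $ 1 + 1)\<^sup>2"
    by (intro power_mono) auto
  then have "(c * s\<^sup>2) * (1 / 2)\<^sup>2 \<le> P 1 s * (x $ 1 + 1)\<^sup>2"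
    using P1(1)[OF s] c by (intro mult_mono) (auto intro: order_trans[OF _ P1(1)[OF s]])
  moreover have "c * (x $ 2)\<^sup>2 \<le> P 2 s * (x $ 2)\<^sup>2" "c * (x $ 3)\<^sup>2 \<le> P 3 s * (x $ 3)\<^sup>2"
    using P23[OF s] by (auto intro!: mult_right_mono)
  ultimately show ?thesis
    by (simp add: GS_def sum_3 sh_simps power2_eq_square algebra_simps)
qed

text \<open>Integrating \<open>GS_lower\<close> gives a multiple of \<open>t ^ 3 - s ^ 3\<close>,
  and \<open>cube_diff_ge\<close> turns it into a bound in \<open>t - s\<close> alone. This uniform
  growth is behind both the uniqueness of the root and the exponent 1/3.\<close>

lemma G_growth:
  assumes st: "- \<delta> \<le> s" "s \<le> t" "t \<le> \<delta>" and x: "norm x \<le> 1 / 2"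
  shows "G t x - G s x \<ge> (c / 48) * (t - s) ^ 3"
proof -
  have "G s x - (c / 12) * s ^ 3 \<le> G t x - (c / 12) * t ^ 3"
  proof (rule DERIV_nonneg_imp_nondecreasing[OF st(2)])
    fix r assume r: "s \<le> r" "r \<le> t"
    then have r': "\<bar>r\<bar> \<le> \<delta>"
      using st by simp
    have "((\<lambda>s. G s x - (c / 12) * s ^ 3) has_real_derivative GS r x - (c / 4) * r\<^sup>2) (at r)"
      using DERIV_G[OF r'] by (auto intro!: derivative_eq_intros)
    moreover have "c * ((x $ 2)\<^sup>2 + (x $ 3)\<^sup>2) \<ge> 0"
      using c by (intro mult_nonneg_nonneg) auto
    then have "GS r x - (c / 4) * r\<^sup>2 \<ge> 0"
      using GS_lower[OF r' x] by linarith
    ultimately show "\<exists>y. ((\<lambda>s. G s x - (c / 12) * s ^ 3) has_real_derivative y) (at r) \<and> 0 \<le> y"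
      by blast
  qed
  then have "G t x - G s x \<ge> (c / 12) * (t ^ 3 - s ^ 3)"
    by (simp add: algebra_simps)
  moreover have "(c / 12) * (t ^ 3 - s ^ 3) \<ge> (c / 12) * ((t - s) ^ 3 / 4)"
    using c cube_diff_ge[OF st(2)] by (intro mult_left_mono) auto
  ultimately show ?thesis
    by simp
qed

lemma compact_bound:
  assumes "\<And>s. \<bar>s\<bar> \<le> \<delta> \<Longrightarrow> isCont f s"
  obtains B where "B > 0" "\<And>s. \<bar>s\<bar> \<le> \<delta> \<Longrightarrow> \<bar>f s\<bar> \<le> (B::real)"
proof -
  have "continuous_on {-\<delta>..\<delta>} f"
    using assms by (intro continuous_at_imp_continuous_on) auto
  then have "bounded (f ` {-\<delta>..\<delta>})"
    by (intro compact_imp_bounded compact_continuous_image) auto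
  then obtain B where B: "B > 0" "\<And>y. y \<in> f ` {-\<delta>..\<delta>} \<Longrightarrow> norm y \<le> B"
    unfolding bounded_pos by blast
  show thesis
  proof (rule that[OF B(1)])
    fix s assume "\<bar>s\<bar> \<le> \<delta>"
    then have "f s \<in> f ` {-\<delta>..\<delta>}"
      by (intro imageI) auto
    then show "\<bar>f s\<bar> \<le> B"
      using B(2) by fastforce
  qed
qed

lemma isCont_p: "\<bar>s\<bar> \<le> \<delta> \<Longrightarrow> isCont (p j) s"
  by (rule DERIV_isCont[OF dp])

lemma isCont_m: "\<bar>s\<bar> \<le> \<delta> \<Longrightarrow> isCont (m j) s"
  by (rule DERIV_isCont[OF dm])

lemma ex_Lipschitz:
  obtains L where "L > 0" "\<And>s x y. \<bar>s\<bar> \<le> \<delta> \<Longrightarrow> norm x \<le> 1 / 2 \<Longrightarrow> norm y \<le> 1 / 2 \<Longrightarrow>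
    \<bar>G s x - G s y\<bar> \<le> L * norm (x - y)"
proof -
  have "\<exists>B>0. \<forall>s. \<bar>s\<bar> \<le> \<delta> \<longrightarrow> \<bar>p j s\<bar> \<le> B" for j
    by (rule compact_bound[OF isCont_p]) auto
  then obtain B where B: "\<And>j. B j > 0" "\<And>j s. \<bar>s\<bar> \<le> \<delta> \<Longrightarrow> \<bar>p j s\<bar> \<le> B j"
    by metis
  show thesis
  proof
    show "(\<Sum>j\<in>UNIV. B j * 3) > 0"
      using B(1) by (intro sum_pos) auto
    fix s and x y :: "real^3"
    assume s: "\<bar>s\<bar> \<le> \<delta>" and xy: "norm x \<le> 1 / 2" "norm y \<le> 1 / 2"
    have "\<bar>p j s * (sh x j)\<^sup>2 - p j s * (sh y j)\<^sup>2\<bar> \<le> B j * 3 * norm (x - y)" for j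
    proof -
      have "p j s * (sh x j)\<^sup>2 - p j s * (sh y j)\<^sup>2 = p j s * (sh x j + sh y j) * (x $ j - y $ j)"
        by (simp add: sh_def power2_eq_square algebra_simps)
      moreover have "\<bar>sh x j + sh y j\<bar> \<le> 3"
        using component_le_norm_cart[of x j] component_le_norm_cart[of y j] xy by (auto simp: sh_def)
      moreover have "\<bar>x $ j - y $ j\<bar> \<le> norm (x - y)"
        using component_le_norm_cart[of "x - y" j] by simp
      ultimately show ?thesis
        using B(2)[OF s, of j] B(1)[of j] by (auto simp: abs_mult intro!: mult_mono)
    qed
    then have "(\<Sum>j\<in>UNIV. \<bar>p j s * (sh x j)\<^sup>2 - p j s * (sh y j)\<^sup>2\<bar>) \<le> (\<Sum>j\<in>UNIV. B j * 3 * norm (x - y))"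
      by (intro sum_mono)
    then show "\<bar>G s x - G s y\<bar> \<le> (\<Sum>j\<in>UNIV. B j * 3) * norm (x - y)"
      unfolding G_def sum_distrib_right
      using order_trans[OF sum_abs[of "\<lambda>j. p j s * (sh x j)\<^sup>2 - p j s * (sh y j)\<^sup>2" UNIV]]
      by (simp add: sum_subtractf)
  qed
qed

section \<open>The critical value: existence, uniqueness and Hoelder continuity\<close>

lemma G00: "G 0 0 = 0"
  by (simp add: G_def sum_3 sh_simps p10)

text \<open>At the origin \<open>G\<close> has opposite signs at the two end points and modulus at
  least \<open>g\<close>. For \<open>x\<close> of norm at most \<open>\<rho>\<close> it changes by
  at most half of \<open>g\<close>, so the signs persist.\<close>

lemma ex_radius:
  obtains \<rho> where "\<rho> > 0" "\<rho> \<le> 1 / 2" "\<And>x. norm x \<le> \<rho> \<Longrightarrow> \<exists>s. \<bar>s\<bar> < \<delta> \<and> G s x = 0"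
proof -
  obtain L where L: "L > 0" "\<And>s x y. \<bar>s\<bar> \<le> \<delta> \<Longrightarrow> norm x \<le> 1 / 2 \<Longrightarrow> norm y \<le> 1 / 2 \<Longrightarrow>
    \<bar>G s x - G s y\<bar> \<le> L * norm (x - y)"
    using ex_Lipschitz by blast
  define g where "g = (c / 48) * \<delta> ^ 3"
  have g: "g > 0"
    using c delta by (simp add: g_def)
  have "G \<delta> 0 \<ge> g" "G (- \<delta>) 0 \<le> - g"
    using G_growth[of 0 \<delta> 0] G_growth[of "- \<delta>" 0 0] delta by (auto simp: G00 g_def)
  define \<rho> where "\<rho> = min (1 / 2) (g / (2 * L))"
  have "\<exists>s. \<bar>s\<bar> < \<delta> \<and> G s x = 0" if x: "norm x \<le> \<rho>" for x
  proof -
    have x': "norm x \<le> 1 / 2"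
      using x by (simp add: \<rho>_def)
    have "L * norm x \<le> L * (g / (2 * L))"
      using x L by (intro mult_left_mono) (auto simp: \<rho>_def)
    then have "L * norm x < g"
      using L g by simp
    then have e: "G \<delta> x > 0" "G (- \<delta>) x < 0"
      using L(2)[of \<delta> x 0] L(2)[of "- \<delta>" x 0] x' delta \<open>G \<delta> 0 \<ge> g\<close> \<open>G (- \<delta>) 0 \<le> - g\<close> by auto
    have "\<exists>s\<ge>- \<delta>. s \<le> \<delta> \<and> G s x = 0"
      by (rule IVT) (use e delta in \<open>auto intro!: DERIV_isCont DERIV_G\<close>)
    then show ?thesis
      using e by (metis abs_less_iff less_le minus_minus neg_less_iff_less less_irrefl)
  qed
  moreover have "\<rho> > 0" "\<rho> \<le> 1 / 2"
    using L g by (auto simp: \<rho>_def)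
  ultimately show thesis
    using that by blast
qed

lemma root_unique:
  assumes "\<bar>s\<bar> \<le> \<delta>" "\<bar>t\<bar> \<le> \<delta>" "norm x \<le> 1 / 2" "G s x = G t x"
  shows "s = t"
proof -
  have *: "b \<le> a" if "- \<delta> \<le> a" "b \<le> \<delta>" "G a x = G b x" for a b
  proof (rule ccontr)
    assume "\<not> b \<le> a"
    then show False
      using G_growth[of a b x] that assms c zero_less_power[of "b - a" 3] by (auto simp: mult_le_0_iff)
  qed
  have "- \<delta> \<le> s" "s \<le> \<delta>" "- \<delta> \<le> t" "t \<le> \<delta>"
    using assms by auto
  then show ?thesis
    using *[of s t] *[of t s] assms(4) by simp
qed

definition \<rho> :: real where
  "\<rho> = (SOME r. r > 0 \<and> r \<le> 1 / 2 \<and> (\<forall>x. norm x \<le> r \<longrightarrow> (\<exists>s. \<bar>s\<bar> < \<delta> \<and> G s x = 0)))"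

lemma rho: "\<rho> > 0" "\<rho> \<le> 1 / 2" "norm x \<le> \<rho> \<Longrightarrow> \<exists>s. \<bar>s\<bar> < \<delta> \<and> G s x = 0"
proof -
  have "\<exists>r. r > 0 \<and> r \<le> 1 / 2 \<and> (\<forall>x. norm x \<le> r \<longrightarrow> (\<exists>s. \<bar>s\<bar> < \<delta> \<and> G s x = 0))"
    using ex_radius by metis
  then have "\<rho> > 0 \<and> \<rho> \<le> 1 / 2 \<and> (\<forall>x. norm x \<le> \<rho> \<longrightarrow> (\<exists>s. \<bar>s\<bar> < \<delta> \<and> G s x = 0))"
    unfolding \<rho>_def by (rule someI_ex)
  then show "\<rho> > 0" "\<rho> \<le> 1 / 2" "norm x \<le> \<rho> \<Longrightarrow> \<exists>s. \<bar>s\<bar> < \<delta> \<and> G s x = 0"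
    by blast+
qed

definition \<sigma> :: "real^3 \<Rightarrow> real" where "\<sigma> x = (SOME s. \<bar>s\<bar> < \<delta> \<and> G s x = 0)"

lemma sigma:
  assumes "norm x \<le> \<rho>"
  shows "\<bar>\<sigma> x\<bar> < \<delta>" "\<bar>\<sigma> x\<bar> \<le> \<delta>" "G (\<sigma> x) x = 0"
proof -
  have "\<bar>\<sigma> x\<bar> < \<delta> \<and> G (\<sigma> x) x = 0"
    unfolding \<sigma>_def by (rule someI_ex[OF rho(3)[OF assms]])
  then show "\<bar>\<sigma> x\<bar> < \<delta>" "\<bar>\<sigma> x\<bar> \<le> \<delta>" "G (\<sigma> x) x = 0"
    by auto
qed

lemma sigma_eqI:
  assumes "norm x \<le> \<rho>" "\<bar>s\<bar> \<le> \<delta>" "G s x = 0"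
  shows "\<sigma> x = s"
proof (rule root_unique)
  show "\<bar>\<sigma> x\<bar> \<le> \<delta>" "norm x \<le> 1 / 2" "G (\<sigma> x) x = G s x"
    using sigma[OF assms(1)] assms rho(2) by auto
qed (rule assms(2))

lemma sigma_0: "\<sigma> 0 = 0"
  using rho(1) delta by (intro sigma_eqI) (simp_all add: G00)

text \<open>Moving from \<open>x\<close> to \<open>y\<close> changes \<open>G\<close> by at most a
  multiple of the distance, and by \<open>G_growth\<close> the cube of the displacement of the root
  is bounded by that change.\<close>

lemma sigma_Hoelder:
  obtains B where "B > 0" "\<And>x y. norm x \<le> \<rho> \<Longrightarrow> norm y \<le> \<rho> \<Longrightarrow> \<bar>\<sigma> x - \<sigma> y\<bar> \<le> B * dist x y powr (1 / 3)"
proof -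
  obtain L where L: "L > 0" "\<And>s x y. \<bar>s\<bar> \<le> \<delta> \<Longrightarrow> norm x \<le> 1 / 2 \<Longrightarrow> norm y \<le> 1 / 2 \<Longrightarrow>
    \<bar>G s x - G s y\<bar> \<le> L * norm (x - y)"
    using ex_Lipschitz by blast
  define A where "A = 48 * L / c"
  have A: "A > 0"
    using L c by (simp add: A_def)
  have main: "\<sigma> y - \<sigma> x \<le> A powr (1 / 3) * dist x y powr (1 / 3)"
    if xy: "norm x \<le> \<rho>" "norm y \<le> \<rho>" and le: "\<sigma> x \<le> \<sigma> y" for x y
  proof -
    have n: "norm x \<le> 1 / 2" "norm y \<le> 1 / 2"
      using xy rho by auto
    have "(c / 48) * (\<sigma> y - \<sigma> x) ^ 3 \<le> G (\<sigma> y) x - G (\<sigma> x) x"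
      using sigma(2)[OF xy(1)] sigma(2)[OF xy(2)] le n by (intro G_growth) auto
    also have "\<dots> = G (\<sigma> y) x - G (\<sigma> y) y"
      by (simp add: sigma xy)
    also have "\<dots> \<le> L * norm (x - y)"
      using L(2)[OF sigma(2)[OF xy(2)] n] by simp
    finally have "(\<sigma> y - \<sigma> x) ^ 3 \<le> A * dist x y"
      using c by (simp add: A_def dist_norm field_simps)
    then have "((\<sigma> y - \<sigma> x) ^ 3) powr (1 / 3) \<le> (A * dist x y) powr (1 / 3)"
      using le by (intro powr_mono2) auto
    moreover have "((\<sigma> y - \<sigma> x) ^ 3) powr (1 / 3) = \<sigma> y - \<sigma> x"
    proof (cases "\<sigma> y = \<sigma> x")
      case False
      then have "\<sigma> y - \<sigma> x > 0"
        using le by simp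
      then show ?thesis
        using powr_powr[of "\<sigma> y - \<sigma> x" 3 "1 / 3"] by simp
    qed simp
    ultimately show ?thesis
      using A by (simp add: powr_mult)
  qed
  have "\<bar>\<sigma> x - \<sigma> y\<bar> \<le> A powr (1 / 3) * dist x y powr (1 / 3)" if "norm x \<le> \<rho>" "norm y \<le> \<rho>" for x y
    using main[of x y] main[of y x] that by (auto simp: abs_if dist_commute)
  then show thesis
    using A by (intro that[of "A powr (1 / 3)"]) auto
qed

lemma sigma_tendsto:
  assumes "norm x < \<rho>"
  shows "(\<sigma> \<longlongrightarrow> \<sigma> x) (at x)"
proof -
  obtain B where B: "B > 0" "\<And>x y. norm x \<le> \<rho> \<Longrightarrow> norm y \<le> \<rho> \<Longrightarrow> \<bar>\<sigma> x - \<sigma> y\<bar> \<le> B * dist x y powr (1 / 3)"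
    using sigma_Hoelder by blast
  have "((\<lambda>y. dist y x) \<longlongrightarrow> dist x x) (at x)"
    by (intro tendsto_intros)
  then have "((\<lambda>y. B * dist y x powr (1 / 3)) \<longlongrightarrow> B * 0) (at x)"
    by (intro tendsto_intros tendsto_zero_powrI[where b="1/3"]) auto
  moreover have "\<forall>\<^sub>F y in at x. norm (\<sigma> y - \<sigma> x) \<le> B * dist y x powr (1 / 3)"
  proof -
    have "\<forall>\<^sub>F y in at x. y \<in> ball 0 \<rho>"
      using assms by (intro eventually_at_in_open') auto
    then show ?thesis
      by eventually_elim (use B assms in auto)
  qed
  ultimately have "((\<lambda>y. \<sigma> y - \<sigma> x) \<longlongrightarrow> 0) (at x)"
    by (intro Lim_null_comparison[of "\<lambda>y. \<sigma> y - \<sigma> x"]) simp_all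
  then show ?thesis
    by (rule LIM_zero_cancel)
qed

section \<open>The envelope and its derivatives\<close>

definition U :: "real^3 \<Rightarrow> real" where "U x = \<Phi> (\<sigma> x) x"

definition gradU :: "real^3 \<Rightarrow> real^3" where "gradU x = (\<chi> j. m j (\<sigma> x) * sh x j)"

lemma sh_tendsto: "((\<lambda>y. sh y j) \<longlongrightarrow> sh x j) (at x)"
  unfolding sh_def by (intro tendsto_intros)

lemma compose_sigma_tendsto:
  assumes "norm x < \<rho>" "isCont f (\<sigma> x)"
  shows "((\<lambda>y. f (\<sigma> y)) \<longlongrightarrow> f (\<sigma> x)) (at x)"
  by (rule isCont_tendsto_compose[OF assms(2) sigma_tendsto[OF assms(1)]])

lemma eventually_in_ball:
  assumes "norm x < \<rho>"
  shows "\<forall>\<^sub>F y in at x. norm y < \<rho>"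
proof -
  have "\<forall>\<^sub>F y in at x. y \<in> ball 0 \<rho>"
    using assms by (intro eventually_at_in_open') auto
  then show ?thesis
    by simp
qed

text \<open>The \<open>s\<close>-derivative of \<open>\<Phi>\<close> is \<open>q / 2\<close> times
  \<open>G\<close>, and \<open>G\<close> vanishes at \<open>\<sigma> x\<close> and is monotone in
  \<open>s\<close>. So between \<open>\<sigma> x\<close> and \<open>t\<close> its modulus is largest
  at \<open>t\<close>.\<close>

lemma \<Phi>_variation:
  assumes x: "norm x \<le> \<rho>" and t: "\<bar>t\<bar> \<le> \<delta>" and B: "\<And>s. \<bar>s\<bar> \<le> \<delta> \<Longrightarrow> \<bar>q s\<bar> \<le> B"
  shows "\<bar>\<Phi> t x - \<Phi> (\<sigma> x) x\<bar> \<le> B * \<bar>G t x\<bar> * \<bar>t - \<sigma> x\<bar>"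
proof -
  define S where "S = closed_segment (\<sigma> x) t"
  have S: "\<bar>s\<bar> \<le> \<delta>" if "s \<in> S" for s
    using that sigma(2)[OF x] t by (auto simp: S_def closed_segment_eq_real_ivl split: if_splits)
  have mono: "G a x \<le> G b x" if "\<bar>a\<bar> \<le> \<delta>" "a \<le> b" "\<bar>b\<bar> \<le> \<delta>" for a b
  proof -
    have "0 \<le> (c / 48) * (b - a) ^ 3"
      using c that by auto
    also have "\<dots> \<le> G b x - G a x"
      using that x rho(2) by (intro G_growth) auto
    finally show ?thesis
      by simp
  qed
  have bound: "\<bar>(q s / 2) * G s x\<bar> \<le> B * \<bar>G t x\<bar>" if s: "s \<in> S" for s
  proof -
    have "\<bar>G s x\<bar> \<le> \<bar>G t x\<bar>"
    proof (cases "\<sigma> x \<le> t")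
      case True
      then have "\<sigma> x \<le> s" "s \<le> t"
        using s by (auto simp: S_def closed_segment_eq_real_ivl)
      then show ?thesis
        using mono[of "\<sigma> x" s] mono[of s t] sigma[OF x] t S[OF s] by auto
    next
      case False
      then have "t \<le> s" "s \<le> \<sigma> x"
        using s by (auto simp: S_def closed_segment_eq_real_ivl)
      then show ?thesis
        using mono[of t s] mono[of s "\<sigma> x"] sigma[OF x] t S[OF s] by auto
    qed
    moreover have "\<bar>q s / 2\<bar> \<le> B"
      using B[OF S[OF s]] by auto
    ultimately show ?thesis
      unfolding abs_mult by (intro mult_mono) auto
  qed
  have "norm (\<Phi> t x - \<Phi> (\<sigma> x) x) \<le> (B * \<bar>G t x\<bar>) * norm (t - \<sigma> x)"
  proof (rule field_differentiable_bound[of S "\<lambda>s. \<Phi> s x" "\<lambda>s. (q s / 2) * G s x"])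
    show "((\<lambda>s. \<Phi> s x) has_real_derivative q s / 2 * G s x) (at s within S)" if "s \<in> S" for s
      using DERIV_\<Phi>[OF S[OF that]] by (rule has_field_derivative_at_within)
  qed (use bound in \<open>auto simp: S_def\<close>)
  then show ?thesis
    by simp
qed

text \<open>The linearization error is exactly the change of \<open>\<Phi>\<close> at the fixed
  point \<open>x\<close> as the parameter goes from \<open>\<sigma> x\<close> to
  \<open>\<sigma> y\<close>. By \<open>\<Phi>_variation\<close> it is at most a multiple of
  \<open>G (\<sigma> y) x\<close>, which is of the order of \<open>norm (y - x)\<close> since
  \<open>G (\<sigma> y) y = 0\<close>, times \<open>\<sigma> y - \<sigma> x\<close>, which tends to
  0. The origin is included.\<close>

lemma has_derivative_U:
  assumes x: "norm x < \<rho>"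
  shows "(U has_derivative (\<lambda>h. gradU x \<bullet> h)) (at x)"
proof -
  obtain B where B: "\<And>s. \<bar>s\<bar> \<le> \<delta> \<Longrightarrow> \<bar>q s\<bar> \<le> B"
    using compact_bound[OF contq] by blast
  obtain L where L: "L > 0" "\<And>s x y. \<bar>s\<bar> \<le> \<delta> \<Longrightarrow> norm x \<le> 1 / 2 \<Longrightarrow> norm y \<le> 1 / 2 \<Longrightarrow>
    \<bar>G s x - G s y\<bar> \<le> L * norm (x - y)"
    using ex_Lipschitz by blast
  have B0: "B \<ge> 0"
    using B[of 0] delta by auto
  define v where "v = (\<lambda>y. \<chi> j. m j (\<sigma> y) * (sh y j + sh x j) / 2)"
  show ?thesis
  proof (rule has_derivative_slope[where v=v and r="\<lambda>y. B * L * \<bar>\<sigma> y - \<sigma> x\<bar>"])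
    have "(v \<longlongrightarrow> (\<chi> j. m j (\<sigma> x) * (sh x j + sh x j) / 2)) (at x)"
      unfolding v_def
      using sigma(2)[of x] x by (intro tendsto_vec_lambda tendsto_intros sh_tendsto compose_sigma_tendsto isCont_m) auto
    then show "(v \<longlongrightarrow> gradU x) (at x)"
      by (simp add: gradU_def)
    have "((\<lambda>y. B * L * \<bar>\<sigma> y - \<sigma> x\<bar>) \<longlongrightarrow> B * L * \<bar>\<sigma> x - \<sigma> x\<bar>) (at x)"
      by (intro tendsto_intros sigma_tendsto x)
    then show "((\<lambda>y. B * L * \<bar>\<sigma> y - \<sigma> x\<bar>) \<longlongrightarrow> 0) (at x)"
      by simp
    show "\<forall>\<^sub>F y in at x. \<bar>U y - U x - v y \<bullet> (y - x)\<bar> \<le> B * L * \<bar>\<sigma> y - \<sigma> x\<bar> * norm (y - x)"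
      using eventually_in_ball[OF x]
    proof eventually_elim
      case (elim y)
      have "v y \<bullet> (y - x) = (\<Sum>j\<in>UNIV. m j (\<sigma> y) * ((sh y j)\<^sup>2 - (sh x j)\<^sup>2)) / 2"
        unfolding inner_vec_def v_def sum_divide_distrib
        by (intro sum.cong) (auto simp: sh_def power2_eq_square algebra_simps diff_divide_distrib add_divide_distrib)
      then have "U y - U x - v y \<bullet> (y - x) = \<Phi> (\<sigma> y) x - \<Phi> (\<sigma> x) x"
        unfolding U_def \<Phi>_def by (simp add: sum_subtractf right_diff_distrib diff_divide_distrib)
      also have "\<bar>\<dots>\<bar> \<le> B * \<bar>G (\<sigma> y) x\<bar> * \<bar>\<sigma> y - \<sigma> x\<bar>"
        using x elim by (intro \<Phi>_variation sigma B) auto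
      also have "\<dots> \<le> B * (L * norm (y - x)) * \<bar>\<sigma> y - \<sigma> x\<bar>"
        using L(2)[of "\<sigma> y" y x] sigma[of y] elim x rho B0 by (intro mult_right_mono mult_left_mono) auto
      finally show ?case
        by (simp add: ac_simps)
    qed
  qed
qed

text \<open>The lower bound for \<open>GS\<close> is 0 only if \<open>\<sigma> x = 0\<close> and
  \<open>x\<close> is on the first axis. The equation for the root is then
  \<open>(x $ 1 + 1)\<^sup>2 = 1\<close>, whose only small solution is the origin.\<close>

lemma sigma_nonzero:
  assumes "norm x \<le> \<rho>" "x \<noteq> 0"
  shows "GS (\<sigma> x) x > 0"
proof -
  have x: "norm x \<le> 1 / 2"
    using assms rho by auto
  have "\<sigma> x \<noteq> 0 \<or> x $ 2 \<noteq> 0 \<or> x $ 3 \<noteq> 0"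
  proof (rule ccontr)
    assume "\<not> ?thesis"
    then have z: "\<sigma> x = 0" "x $ 2 = 0" "x $ 3 = 0"
      by auto
    then have "K * ((x $ 1 + 1)\<^sup>2 - 1) = 0"
      using sigma(3)[OF assms(1)] by (simp add: G_def sum_3 sh_simps p10 algebra_simps)
    then have "(x $ 1 + 1)\<^sup>2 - 1 = 0"
      using K by simp
    then have "x $ 1 * (x $ 1 + 2) = 0"
      by (simp add: power2_eq_square algebra_simps)
    moreover have "\<bar>x $ 1\<bar> \<le> 1 / 2"
      using component_le_norm_cart[of x 1] x by linarith
    ultimately have "x $ 1 = 0"
      by auto
    then show False
      using z assms(2) by (simp add: vec_eq_iff forall_3)
  qed
  then have "(1 / 4) * (\<sigma> x)\<^sup>2 + ((x $ 2)\<^sup>2 + (x $ 3)\<^sup>2) > 0"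
    by (elim disjE) (simp_all add: add_pos_nonneg add_nonneg_pos)
  then have "c * ((1 / 4) * (\<sigma> x)\<^sup>2 + ((x $ 2)\<^sup>2 + (x $ 3)\<^sup>2)) > 0"
    by (rule mult_pos_pos[OF c])
  also have "\<dots> = (c / 4) * (\<sigma> x)\<^sup>2 + c * ((x $ 2)\<^sup>2 + (x $ 3)\<^sup>2)"
    by (simp add: distrib_left)
  also have "\<dots> \<le> GS (\<sigma> x) x"
    by (rule GS_lower[OF sigma(2)[OF assms(1)] x])
  finally show ?thesis .
qed

text \<open>Implicit differentiation in Caratheodory form. The identity
  \<open>G (\<sigma> y) y = G (\<sigma> x) x\<close> is split into a change of the point at fixed
  \<open>\<sigma> y\<close> and a change of the parameter at fixed \<open>x\<close>, and is then
  solved exactly for \<open>\<sigma> y - \<sigma> x\<close>.\<close>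

lemma has_derivative_sigma:
  assumes x: "norm x < \<rho>" "x \<noteq> 0"
  shows "(\<sigma> has_derivative (\<lambda>h. (\<chi> j. - 2 * p j (\<sigma> x) * sh x j / GS (\<sigma> x) x) \<bullet> h)) (at x)"
proof -
  have sx: "\<bar>\<sigma> x\<bar> \<le> \<delta>" and pos: "GS (\<sigma> x) x > 0"
    using sigma[of x] sigma_nonzero[of x] x by auto
  obtain D where D: "\<And>s. G s x - G (\<sigma> x) x = D s * (s - \<sigma> x)" "isCont D (\<sigma> x)" "D (\<sigma> x) = GS (\<sigma> x) x"
    using DERIV_G[OF sx, of x] unfolding CARAT_DERIV by blast
  define v where "v = (\<lambda>y. \<chi> j. - p j (\<sigma> y) * (sh y j + sh x j) / D (\<sigma> y))"
  have limD: "((\<lambda>y. D (\<sigma> y)) \<longlongrightarrow> GS (\<sigma> x) x) (at x)"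
    using compose_sigma_tendsto[OF x(1) D(2)] D(3) by simp
  show ?thesis
  proof (rule has_derivative_slope[where v=v and r="\<lambda>y. 0"])
    have "(v \<longlongrightarrow> (\<chi> j. - p j (\<sigma> x) * (sh x j + sh x j) / GS (\<sigma> x) x)) (at x)"
      unfolding v_def using pos
      by (intro tendsto_vec_lambda tendsto_intros sh_tendsto compose_sigma_tendsto isCont_p sx x limD) auto
    then show "(v \<longlongrightarrow> (\<chi> j. - 2 * p j (\<sigma> x) * sh x j / GS (\<sigma> x) x)) (at x)"
      by (simp add: ac_simps)
    show "\<forall>\<^sub>F y in at x. \<bar>\<sigma> y - \<sigma> x - v y \<bullet> (y - x)\<bar> \<le> 0 * norm (y - x)"
      using eventually_in_ball[OF x(1)] order_tendstoD(1)[OF limD pos]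
    proof eventually_elim
      case (elim y)
      have "v y \<bullet> (y - x) = - (\<Sum>j\<in>UNIV. p j (\<sigma> y) * ((sh y j)\<^sup>2 - (sh x j)\<^sup>2)) / D (\<sigma> y)"
        unfolding inner_vec_def v_def sum_negf[symmetric] sum_divide_distrib
        by (intro sum.cong) (auto simp: sh_def power2_eq_square algebra_simps diff_divide_distrib add_divide_distrib)
      also have "\<dots> = (G (\<sigma> y) x - G (\<sigma> y) y) / D (\<sigma> y)"
        by (simp add: G_def sum_subtractf right_diff_distrib)
      also have "G (\<sigma> y) y = G (\<sigma> x) x"
        using sigma(3) elim x by simp
      also have "(G (\<sigma> y) x - G (\<sigma> x) x) / D (\<sigma> y) = \<sigma> y - \<sigma> x"
        using elim by (simp add: D(1))
      finally show ?case
        by simp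
    qed
  qed simp
qed

definition hessU :: "real^3 \<Rightarrow> mat3" where
  "hessU x = diag_rank_one (\<lambda>j. m j (\<sigma> x)) (- 2 * q (\<sigma> x) / GS (\<sigma> x) x) (\<lambda>j. p j (\<sigma> x) * sh x j)"

lemma has_derivative_gradU:
  assumes x: "norm x < \<rho>" "x \<noteq> 0"
  shows "(gradU has_derivative (\<lambda>h. hessU x *v h)) (at x)"
proof -
  let ?s = "\<lambda>h. (\<chi> j. - 2 * p j (\<sigma> x) * sh x j / GS (\<sigma> x) x) \<bullet> h"
  have sx: "\<bar>\<sigma> x\<bar> \<le> \<delta>"
    using sigma[of x] x by auto
  have "((\<lambda>y. gradU y $ i) has_derivative (\<lambda>h. (hessU x *v h) $ i)) (at x)" for i
  proof -
    have "((\<lambda>y. m i (\<sigma> y)) has_derivative (\<lambda>h. (q (\<sigma> x) * p i (\<sigma> x)) * ?s h)) (at x)"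
      using has_derivative_compose[OF has_derivative_sigma[OF x] dm[OF sx, of i, unfolded has_field_derivative_def]] .
    moreover have "((\<lambda>y. sh y i) has_derivative (\<lambda>h. h $ i)) (at x)"
      unfolding sh_def by (auto intro!: derivative_eq_intros bounded_linear_vec_nth bounded_linear_imp_has_derivative)
    ultimately have "((\<lambda>y. m i (\<sigma> y) * sh y i) has_derivative
        (\<lambda>h. m i (\<sigma> x) * h $ i + (q (\<sigma> x) * p i (\<sigma> x)) * ?s h * sh x i)) (at x)"
      by (rule has_derivative_mult)
    moreover have "m i (\<sigma> x) * h $ i + (q (\<sigma> x) * p i (\<sigma> x)) * ?s h * sh x i = (hessU x *v h) $ i" for h
    proof -
      have "(hessU x *v h) $ i = (\<Sum>j\<in>UNIV. (if i = j then m i (\<sigma> x) * h $ j else 0)) +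
          (\<Sum>j\<in>UNIV. (- 2 * q (\<sigma> x) / GS (\<sigma> x) x * (p i (\<sigma> x) * sh x i) * (p j (\<sigma> x) * sh x j)) * h $ j)"
        unfolding hessU_def diag_rank_one_def matrix_vector_mult_def vec_lambda_beta sum.distrib[symmetric]
        by (intro sum.cong) (auto simp: algebra_simps)
      then show ?thesis
        by (simp add: inner_vec_def sum_distrib_left sum_distrib_right ac_simps)
    qed
    ultimately show ?thesis
      by (simp add: gradU_def)
  qed
  then show ?thesis
    unfolding has_derivative_componentwise_within[of gradU] Basis_vec_def
    by (auto simp: inner_axis)
qed

text \<open>Let A and D be the real and imaginary part of exp(- i \<open>\<theta>\<close>) times the
  product of the 1 + i \<open>m j s\<close>. Omitting factor j leaves a number with real part (A + D
  \<open>m j s\<close>) / (1 + \<open>(m j s)\<^sup>2\<close>). By \<open>phase\<close> and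
  \<open>P_eq\<close>, its product with \<open>(p j s)\<^sup>2\<close> is - A \<open>P j s\<close>.
  Summed with the squared coordinates this is - A \<open>GS s x\<close>, which the coefficient
  \<open>- 2 * q s / GS s x\<close> cancels against D.\<close>

lemma hessU_angle:
  assumes x: "norm x < \<rho>" "x \<noteq> 0"
  shows "lag_angle (hessU x) = \<theta>"
proof -
  define s where "s = \<sigma> x"
  have s: "\<bar>s\<bar> \<le> \<delta>" and pos: "GS s x > 0"
    unfolding s_def using sigma(2)[of x] sigma_nonzero[of x] x by simp_all
  define a b d where "a = m 1 s" and "b = m 2 s" and "d = m 3 s"
  define A where "A = cos \<theta> * (1 - (a * b + a * d + b * d)) + sin \<theta> * (a + b + d - a * b * d)"
  define D where "D = cos \<theta> * (a + b + d - a * b * d) - sin \<theta> * (1 - (a * b + a * d + b * d))"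
  have DA: "D = - 2 * q s * A"
    using phase[OF s] by (simp add: D_def A_def a_def b_def d_def)
  have R: "(p j s)\<^sup>2 * R = - A * P j s" if "(1 + (m j s)\<^sup>2) * R = A + D * m j s" for j R
  proof -
    have "(1 + (m j s)\<^sup>2) * ((p j s)\<^sup>2 * R) = (p j s)\<^sup>2 * (A + D * m j s)"
      using that by (simp add: ac_simps)
    also have "\<dots> = - A * ((p j s)\<^sup>2 * (2 * m j s * q s - 1))"
      by (simp add: DA algebra_simps)
    also have "\<dots> = (1 + (m j s)\<^sup>2) * (- A * P j s)"
      unfolding P_eq[OF s, of j, symmetric] by (simp add: ac_simps)
    finally show ?thesis
      by (metis add_nonneg_eq_0_iff mult_left_cancel zero_le_one zero_le_power2 zero_neq_one)
  qed
  have R1: "(p 1 s)\<^sup>2 * (cos \<theta> * (1 - b * d) + sin \<theta> * (b + d)) = - A * P 1 s"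
    by (rule R) (simp add: A_def D_def a_def b_def d_def power2_eq_square algebra_simps)
  have R2: "(p 2 s)\<^sup>2 * (cos \<theta> * (1 - a * d) + sin \<theta> * (a + d)) = - A * P 2 s"
    by (rule R) (simp add: A_def D_def a_def b_def d_def power2_eq_square algebra_simps)
  have R3: "(p 3 s)\<^sup>2 * (cos \<theta> * (1 - a * b) + sin \<theta> * (a + b)) = - A * P 3 s"
    by (rule R) (simp add: A_def D_def a_def b_def d_def power2_eq_square algebra_simps)
  define k where "k = - 2 * q s / GS s x"
  have k: "k \<ge> 0" "k * GS s x = - 2 * q s"
    using q_neg[OF s] pos by (auto simp: k_def divide_nonpos_pos)
  have "lag_angle (diag_rank_one (\<lambda>j. m j s) k (\<lambda>j. p j s * sh x j)) = \<theta>"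
  proof (rule lag_angle_diag_rank_one[OF k(1) angle[OF s]])
    have "(p 1 s * sh x 1)\<^sup>2 * (cos \<theta> * (1 - b * d) + sin \<theta> * (b + d)) +
        (p 2 s * sh x 2)\<^sup>2 * (cos \<theta> * (1 - a * d) + sin \<theta> * (a + d)) +
        (p 3 s * sh x 3)\<^sup>2 * (cos \<theta> * (1 - a * b) + sin \<theta> * (a + b)) =
        (sh x 1)\<^sup>2 * ((p 1 s)\<^sup>2 * (cos \<theta> * (1 - b * d) + sin \<theta> * (b + d))) +
        (sh x 2)\<^sup>2 * ((p 2 s)\<^sup>2 * (cos \<theta> * (1 - a * d) + sin \<theta> * (a + d))) +
        (sh x 3)\<^sup>2 * ((p 3 s)\<^sup>2 * (cos \<theta> * (1 - a * b) + sin \<theta> * (a + b)))"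
      by (simp add: power_mult_distrib ac_simps)
    also have "\<dots> = - A * GS s x"
      unfolding R1 R2 R3 GS_def sum_3 by (simp add: algebra_simps)
    finally have sum: "(p 1 s * sh x 1)\<^sup>2 * (cos \<theta> * (1 - b * d) + sin \<theta> * (b + d)) +
        (p 2 s * sh x 2)\<^sup>2 * (cos \<theta> * (1 - a * d) + sin \<theta> * (a + d)) +
        (p 3 s * sh x 3)\<^sup>2 * (cos \<theta> * (1 - a * b) + sin \<theta> * (a + b)) = - A * GS s x" .
    have "k * (- A * GS s x) = - A * (k * GS s x)"
      by (simp add: ac_simps)
    then have "D + k * (- A * GS s x) = 0"
      unfolding k(2) by (simp add: DA)
    then show "cos \<theta> * (m 1 s + m 2 s + m 3 s - m 1 s * m 2 s * m 3 s) -
        sin \<theta> * (1 - (m 1 s * m 2 s + m 1 s * m 3 s + m 2 s * m 3 s)) +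
        k * ((p 1 s * sh x 1)\<^sup>2 * (cos \<theta> * (1 - m 2 s * m 3 s) + sin \<theta> * (m 2 s + m 3 s)) +
          (p 2 s * sh x 2)\<^sup>2 * (cos \<theta> * (1 - m 1 s * m 3 s) + sin \<theta> * (m 1 s + m 3 s)) +
          (p 3 s * sh x 3)\<^sup>2 * (cos \<theta> * (1 - m 1 s * m 2 s) + sin \<theta> * (m 1 s + m 2 s))) = 0"
      using sum by (simp only: D_def a_def b_def d_def)
  qed
  then show ?thesis
    by (simp add: hessU_def k_def s_def)
qed

lemma continuous_on_hessU: "continuous_on (ball 0 \<rho> - {0}) hessU"
proof (rule continuous_at_imp_continuous_on, rule ballI)
  fix x assume "x \<in> ball (0::real^3) \<rho> - {0}"
  then have x: "norm x < \<rho>" "x \<noteq> 0"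
    by auto
  then have sx: "\<bar>\<sigma> x\<bar> \<le> \<delta>" and pos: "GS (\<sigma> x) x > 0"
    using sigma[of x] sigma_nonzero[of x] by auto
  have GSlim: "((\<lambda>y. GS (\<sigma> y) y) \<longlongrightarrow> GS (\<sigma> x) x) (at x)"
    unfolding GS_def by (intro tendsto_intros sh_tendsto compose_sigma_tendsto x contP sx)
  have mlim: "((\<lambda>y. if i = j then m i (\<sigma> y) else 0) \<longlongrightarrow> (if i = j then m i (\<sigma> x) else 0)) (at x)" for i j
    using compose_sigma_tendsto[OF x(1) isCont_m[OF sx, of i]] by auto
  show "isCont hessU x"
    unfolding isCont_def hessU_def diag_rank_one_def using pos
    by (intro tendsto_vec_lambda tendsto_intros sh_tendsto compose_sigma_tendsto x GSlim mlim contq isCont_p sx) auto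
qed

lemma gradU_Hoelder:
  obtains A where "\<And>x y. norm x < \<rho> \<Longrightarrow> norm y < \<rho> \<Longrightarrow> norm (gradU x - gradU y) \<le> A * dist x y powr (1 / 3)"
proof -
  obtain B where B: "B > 0" "\<And>x y. norm x \<le> \<rho> \<Longrightarrow> norm y \<le> \<rho> \<Longrightarrow> \<bar>\<sigma> x - \<sigma> y\<bar> \<le> B * dist x y powr (1 / 3)"
    using sigma_Hoelder by blast
  have "\<exists>M>0. \<forall>s. \<bar>s\<bar> \<le> \<delta> \<longrightarrow> \<bar>m j s\<bar> \<le> M" for j
    by (rule compact_bound[OF isCont_m]) auto
  then obtain M where M: "\<And>j. M j > 0" "\<And>j s. \<bar>s\<bar> \<le> \<delta> \<Longrightarrow> \<bar>m j s\<bar> \<le> M j"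
    by metis
  have "\<exists>N>0. \<forall>s. \<bar>s\<bar> \<le> \<delta> \<longrightarrow> \<bar>q s * p j s\<bar> \<le> N" for j
    by (rule compact_bound[OF isCont_mult[OF contq isCont_p]]) auto
  then obtain N where N: "\<And>j. N j > 0" "\<And>j s. \<bar>s\<bar> \<le> \<delta> \<Longrightarrow> \<bar>q s * p j s\<bar> \<le> N j"
    by metis
  have lip: "\<bar>m j s - m j t\<bar> \<le> N j * \<bar>s - t\<bar>" if "\<bar>s\<bar> \<le> \<delta>" "\<bar>t\<bar> \<le> \<delta>" for j s t
  proof -
    have "norm (m j s - m j t) \<le> N j * norm (s - t)"
    proof (rule field_differentiable_bound[of "{-\<delta>..\<delta>}"])
      show "(m j has_real_derivative q r * p j r) (at r within {-\<delta>..\<delta>})" if "r \<in> {-\<delta>..\<delta>}" for r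
        using that by (intro has_field_derivative_at_within[OF dm]) auto
      show "norm (q r * p j r) \<le> N j" if "r \<in> {-\<delta>..\<delta>}" for r
        using N(2)[of r j] that by auto
    qed (use that in auto)
    then show ?thesis
      by simp
  qed
  define A where "A = (\<Sum>j\<in>UNIV. 2 * N j * B + M j)"
  have "norm (gradU x - gradU y) \<le> A * dist x y powr (1 / 3)" if xy: "norm x < \<rho>" "norm y < \<rho>" for x y
  proof -
    define d where "d = dist x y powr (1 / 3)"
    \<comment> \<open>Distances in the ball are at most 1, so a Lipschitz term is also bounded by
      the power 1/3.\<close>
    have "dist x y \<le> 1"
      using norm_triangle_ineq4[of x y] xy rho(2) by (simp add: dist_norm)
    then have d1: "dist x y \<le> d"
      using powr_mono'[of "1 / 3" 1 "dist x y"] by (simp add: d_def)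
    have "\<bar>(gradU x - gradU y) $ j\<bar> \<le> (2 * N j * B + M j) * d" for j
    proof -
      have s: "\<bar>\<sigma> x\<bar> \<le> \<delta>" "\<bar>\<sigma> y\<bar> \<le> \<delta>" "\<bar>\<sigma> x - \<sigma> y\<bar> \<le> B * d"
        using sigma(2) B(2) xy by (auto simp: d_def)
      have "(gradU x - gradU y) $ j = (m j (\<sigma> x) - m j (\<sigma> y)) * sh x j + m j (\<sigma> y) * (x $ j - y $ j)"
        by (simp add: gradU_def sh_def algebra_simps)
      also have "\<bar>\<dots>\<bar> \<le> \<bar>m j (\<sigma> x) - m j (\<sigma> y)\<bar> * \<bar>sh x j\<bar> + \<bar>m j (\<sigma> y)\<bar> * \<bar>x $ j - y $ j\<bar>"
        by (metis abs_mult abs_triangle_ineq)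
      also have "\<dots> \<le> (N j * (B * d)) * 2 + M j * d"
      proof (intro add_mono mult_mono)
        have "N j * \<bar>\<sigma> x - \<sigma> y\<bar> \<le> N j * (B * d)"
          using s(3) N(1)[of j] by (intro mult_left_mono) auto
        then show "\<bar>m j (\<sigma> x) - m j (\<sigma> y)\<bar> \<le> N j * (B * d)"
          using lip[OF s(1,2), of j] by linarith
        show "\<bar>sh x j\<bar> \<le> 2"
          using component_le_norm_cart[of x j] xy rho(2) by (auto simp: sh_def)
        show "\<bar>m j (\<sigma> y)\<bar> \<le> M j"
          by (rule M(2)[OF s(2)])
        show "\<bar>x $ j - y $ j\<bar> \<le> d"
          using component_le_norm_cart[of "x - y" j] d1 by (simp add: dist_norm)
        show "0 \<le> N j * (B * d)" "0 \<le> M j"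
          using N(1)[of j] B(1) M(1)[of j] by (auto simp: d_def)
      qed auto
      finally show ?thesis
        by (simp add: algebra_simps)
    qed
    then have "norm (gradU x - gradU y) \<le> (\<Sum>j\<in>UNIV. (2 * N j * B + M j) * d)"
      by (intro order_trans[OF norm_le_l1_cart] sum_mono)
    then show ?thesis
      by (simp add: A_def d_def sum_distrib_right)
  qed
  then show thesis
    by (rule that)
qed

section \<open>Sharpness of the Hoelder exponent\<close>

lemma C_nonneg: "C \<ge> 0"
proof -
  have "c * \<delta>\<^sup>2 \<le> C * \<delta>\<^sup>2"
    using P1[of \<delta>] delta by linarith
  then show ?thesis
    using c delta by simp
qed

lemma p1_bounds:
  assumes "0 \<le> s" "s \<le> \<delta>"
  shows "K \<le> p 1 s" "p 1 s \<le> K + C * s ^ 3"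
proof -
  have "p 1 0 \<le> p 1 s"
  proof (rule DERIV_nonneg_imp_nondecreasing[OF assms(1)])
    fix r assume r: "0 \<le> r" "r \<le> s"
    then have "\<bar>r\<bar> \<le> \<delta>"
      using assms by auto
    moreover have "0 \<le> c * r\<^sup>2"
      using c by simp
    ultimately show "\<exists>y. (p 1 has_real_derivative y) (at r) \<and> 0 \<le> y"
      using dp P1(1) order_trans by blast
  qed
  then show "K \<le> p 1 s"
    by (simp add: p10)
  have "p 1 s - C * s ^ 3 \<le> p 1 0 - C * 0 ^ 3"
  proof (rule DERIV_nonpos_imp_nonincreasing[OF assms(1)])
    fix r assume r: "0 \<le> r" "r \<le> s"
    then have r': "\<bar>r\<bar> \<le> \<delta>"
      using assms by auto
    have "((\<lambda>s. p 1 s - C * s ^ 3) has_real_derivative P 1 r - C * (3 * r\<^sup>2)) (at r)"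
      by (auto intro!: derivative_eq_intros dp r')
    moreover have "0 \<le> C * r\<^sup>2"
      using C_nonneg by simp
    then have "P 1 r - C * (3 * r\<^sup>2) \<le> 0"
      using P1(2)[OF r'] by simp
    ultimately show "\<exists>y. ((\<lambda>s. p 1 s - C * s ^ 3) has_real_derivative y) (at r) \<and> y \<le> 0"
      by blast
  qed
  then show "p 1 s \<le> K + C * s ^ 3"
    by (simp add: p10)
qed

text \<open>The point \<open>t s\<close> on the first axis has critical value \<open>s\<close> and
  distance of order at most \<open>s ^ 3\<close> from the origin, whereas the first gradient
  component moves by at least a multiple of \<open>s\<close>. A Hoelder bound with exponent
  \<open>\<alpha>\<close> would bound a positive constant by terms of order \<open>s\<^sup>2\<close>
  and \<open>s powr (3 * \<alpha> - 1)\<close>.\<close>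

lemma gradU_not_Hoelder:
  assumes \<epsilon>: "0 < \<epsilon>" "\<epsilon> \<le> \<rho>" and \<alpha>: "\<alpha> > 1 / 3"
    and H: "\<And>x y. norm x < \<epsilon> \<Longrightarrow> norm y < \<epsilon> \<Longrightarrow> norm (gradU x - gradU y) \<le> A * dist x y powr \<alpha>"
  shows False
proof -
  define t where "t = (\<lambda>s. sqrt (K / p 1 s) - 1)"
  define E where "E = C / K"
  have E: "E \<ge> 0"
    using C_nonneg K by (simp add: E_def)
  have t: "- t s \<le> E * s ^ 3" "t s \<le> 0" "p 1 s * (t s + 1)\<^sup>2 = K" if s: "0 \<le> s" "s \<le> \<delta>" for s
  proof -
    have p: "p 1 s > 0" "K \<le> p 1 s" "p 1 s \<le> K + C * s ^ 3"
      using p1_bounds[OF s] K by auto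
    have r: "0 \<le> K / p 1 s" "K / p 1 s \<le> 1"
      using p K by auto
    then have sq: "sqrt (K / p 1 s) \<le> 1"
      by simp
    then show "t s \<le> 0"
      by (simp add: t_def)
    show "p 1 s * (t s + 1)\<^sup>2 = K"
      using p r by (simp add: t_def)
    have "1 - K / p 1 s = (p 1 s - K) / p 1 s"
      using p by (simp add: field_simps)
    also have "\<dots> \<le> (C * s ^ 3) / K"
      using p K by (intro frac_le) auto
    finally have "1 - K / p 1 s \<le> E * s ^ 3"
      by (simp add: E_def)
    \<comment> \<open>On the unit interval the square root is at least the identity, which replaces
      an expansion of \<open>t\<close>.\<close>
    moreover have "K / p 1 s \<le> sqrt (K / p 1 s)"
      unfolding power2_eq_square by (rule real_le_rsqrt, unfold power2_eq_square) (intro mult_left_le r)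
    ultimately show "- t s \<le> E * s ^ 3"
      by (simp add: t_def)
  qed
  obtain M where M: "M > 0" "\<And>s. \<bar>s\<bar> \<le> \<delta> \<Longrightarrow> \<bar>m 1 s\<bar> \<le> M"
    using compact_bound[OF isCont_m] by blast
  \<comment> \<open>The slope of \<open>m 1\<close> at 0 is \<open>q 0 * K\<close>, a negative
    number; \<open>k\<close> is half its modulus.\<close>
  define k where "k = - (q 0 * K) / 2"
  have k: "k > 0"
    using q_neg[of 0] K delta by (simp add: k_def mult_neg_pos)
  have "((\<lambda>s. (m 1 s - m 1 0) / s) \<longlongrightarrow> q 0 * K) (at 0)"
    using dm[of 0 1] delta by (simp add: DERIV_def p10)
  then have lim: "((\<lambda>s. (m 1 s - m 1 0) / s) \<longlongrightarrow> q 0 * K) (at_right 0)"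
    by (rule tendsto_mono[rotated]) (simp add: at_le)
  have slope: "\<forall>\<^sub>F s in at_right 0. (m 1 s - m 1 0) / s < - k"
    using k unfolding k_def by (intro order_tendstoD(2)[OF lim]) linarith
  have "((\<lambda>s. E * s ^ 3) \<longlongrightarrow> E * 0 ^ 3) (at_right 0)"
    by (intro tendsto_intros)
  then have small: "\<forall>\<^sub>F s in at_right 0. E * s ^ 3 < \<epsilon>"
    using \<epsilon> by (intro order_tendstoD(2)) auto
  have "\<forall>\<^sub>F s in at_right 0. k \<le> M * E * s\<^sup>2 + \<bar>A\<bar> * E powr \<alpha> * s powr (3 * \<alpha> - 1)"
    using slope small eventually_at_right_less[of 0] eventually_at_right_real[OF delta]
  proof eventually_elim
    case (elim s)
    then have s: "0 \<le> s" "s \<le> \<delta>" "\<bar>s\<bar> \<le> \<delta>" "s > 0"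
      by auto
    define x where "x = (t s) *\<^sub>R (axis 1 1 :: real^3)"
    have nx: "norm x = - t s"
      using t(2)[OF s(1,2)] by (simp add: x_def)
    have x: "norm x < \<epsilon>"
      using t(1)[OF s(1,2)] elim by (simp add: nx)
    have "sh x 1 = t s + 1" "sh x 2 = 0" "sh x 3 = 0"
      by (simp_all add: sh_simps x_def axis_def)
    then have G: "G s x = 0"
      using t(3)[OF s(1,2)] by (simp add: G_def sum_3)
    have "\<sigma> x = s"
      using x \<epsilon> by (intro sigma_eqI s G) auto
    then have g: "gradU x $ 1 = m 1 s * (t s + 1)" "gradU 0 $ 1 = m 1 0"
      by (simp_all add: gradU_def sigma_0 sh_simps x_def axis_def)
    have "k * s < m 1 0 - m 1 s"
      using elim s by (simp add: field_simps)
    also have "\<dots> = m 1 s * t s - (gradU x - gradU 0) $ 1"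
      by (simp add: g algebra_simps)
    also have "\<dots> \<le> M * (E * s ^ 3) + \<bar>A\<bar> * (E * s ^ 3) powr \<alpha>"
    proof -
      have "\<bar>m 1 s * t s\<bar> \<le> M * (E * s ^ 3)"
        unfolding abs_mult using M(2)[OF s(3)] t[OF s(1,2)] by (intro mult_mono) auto
      moreover have "\<bar>(gradU x - gradU 0) $ 1\<bar> \<le> \<bar>A\<bar> * (E * s ^ 3) powr \<alpha>"
      proof -
        have "\<bar>(gradU x - gradU 0) $ 1\<bar> \<le> A * dist x 0 powr \<alpha>"
          using component_le_norm_cart[of "gradU x - gradU 0" 1] H[OF x, of 0] \<epsilon> by simp
        also have "\<dots> \<le> \<bar>A\<bar> * (E * s ^ 3) powr \<alpha>"
          using t[OF s(1,2)] \<alpha> by (intro mult_mono powr_mono2) (auto simp: nx)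
        finally show ?thesis .
      qed
      ultimately show ?thesis
        by linarith
    qed
    also have "(E * s ^ 3) powr \<alpha> = E powr \<alpha> * (s powr (3 * \<alpha> - 1) * s)"
    proof -
      have "(s ^ 3) powr \<alpha> = s powr (3 * \<alpha>)"
        using powr_powr[of s 3 \<alpha>] s by simp
      also have "s powr (3 * \<alpha>) = s powr (3 * \<alpha> - 1) * s"
        using powr_mult_base[of s "3 * \<alpha> - 1"] s by (simp add: mult.commute)
      finally show ?thesis
        using E s by (simp add: powr_mult)
    qed
    finally have "k * s < (M * E * s\<^sup>2 + \<bar>A\<bar> * E powr \<alpha> * s powr (3 * \<alpha> - 1)) * s"
      by (simp add: power2_eq_square power3_eq_cube algebra_simps)
    then show ?case
      using s by simp
  qed
  moreover have "((\<lambda>s. M * E * s\<^sup>2 + \<bar>A\<bar> * E powr \<alpha> * s powr (3 * \<alpha> - 1)) \<longlongrightarrow>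
      M * E * 0\<^sup>2 + \<bar>A\<bar> * E powr \<alpha> * 0) (at_right 0)"
  proof (intro tendsto_intros)
    show "((\<lambda>s. s powr (3 * \<alpha> - 1)) \<longlongrightarrow> 0) (at_right (0::real))"
    proof (rule tendsto_zero_powrI)
      show "\<forall>\<^sub>F s in at_right 0. 0 \<le> (s::real)"
        using eventually_at_right_less[of 0] by eventually_elim simp
    qed (use \<alpha> in \<open>auto intro!: tendsto_intros\<close>)
  qed
  ultimately have "k \<le> 0"
    by (intro tendsto_lowerbound[of _ 0 "at_right 0"]) auto
  then show False
    using k by simp
qed

lemma U_solution:
  assumes \<epsilon>: "0 < \<epsilon>" "\<epsilon> < \<rho>" and \<theta>: "- pi / 2 < \<theta>" "\<theta> < pi / 2"
  shows "HL_solution (F_set \<theta>) 0 \<epsilon> U U"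
    and "\<And>w x. HL_solution (F_set \<theta>) 0 \<epsilon> U w \<Longrightarrow> x \<in> cball 0 \<epsilon> \<Longrightarrow> w x = U x"
    and "C1_Hoelder_on (1 / 3) (ball 0 \<epsilon>) U"
    and "\<And>\<alpha>. \<alpha> > 1 / 3 \<Longrightarrow> \<not> C1_Hoelder_on \<alpha> (ball 0 \<epsilon>) U"
proof -
  have diff: "U differentiable (at x)" if "norm x < \<rho>" for x
    using has_derivative_U[OF that] differentiable_def by blast
  have g: "grad U x = gradU x" if "norm x < \<rho>" for x
    by (rule grad_eqI[OF has_derivative_U[OF that]])
  have cont: "continuous_on (cball 0 \<epsilon>) U"
    using \<epsilon> by (intro continuous_at_imp_continuous_on ballI differentiable_imp_continuous_within diff) auto
  have opn: "open (ball (0::real^3) \<epsilon> - {0})"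
    by (intro open_delete) auto
  have D1: "(U has_derivative (\<lambda>h. gradU x \<bullet> h)) (at x)" if "x \<in> ball 0 \<epsilon> - {0}" for x
    using that \<epsilon> by (intro has_derivative_U) auto
  have D2: "(gradU has_derivative (\<lambda>h. hessU x *v h)) (at x)" if "x \<in> ball 0 \<epsilon> - {0}" for x
    using that \<epsilon> by (intro has_derivative_gradU) auto
  have C2: "C2_on (ball 0 \<epsilon> - {0}) U"
  proof (rule C2_onI[OF opn D1 D2])
    show "continuous_on (ball 0 \<epsilon> - {0}) hessU"
      using \<epsilon> by (intro continuous_on_subset[OF continuous_on_hessU]) auto
  qed
  have h: "hessian U x = hessU x" if "x \<in> ball 0 \<epsilon> - {0}" for x
    by (rule hessian_eqI(2)[OF opn that D1 D2[OF that]])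
  have sym: "hessian U x \<in> Sym2" if "x \<in> ball 0 \<epsilon> - {0}" for x
    unfolding h[OF that] hessU_def by (rule diag_rank_one_Sym2)
  have ang: "lag_angle (hessian U x) = \<theta>" if "x \<in> ball 0 \<epsilon> - {0}" for x
    unfolding h[OF that] using that \<epsilon> by (intro hessU_angle) auto
  have d0: "U differentiable (at 0)"
    using rho(1) by (intro diff) simp
  show "HL_solution (F_set \<theta>) 0 \<epsilon> U U"
    by (rule isolated_singularity_solution[OF \<epsilon>(1) cont d0 C2 sym ang])
  show "w x = U x" if "HL_solution (F_set \<theta>) 0 \<epsilon> U w" "x \<in> cball 0 \<epsilon>" for w x
    by (rule isolated_singularity_unique[OF \<epsilon>(1) cont d0 C2 sym ang \<theta> that])
  obtain A where A: "\<And>x y. norm x < \<rho> \<Longrightarrow> norm y < \<rho> \<Longrightarrow> norm (gradU x - gradU y) \<le> A * dist x y powr (1 / 3)"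
    using gradU_Hoelder by blast
  have bound: "\<forall>x\<in>ball 0 \<epsilon>. \<forall>y\<in>ball 0 \<epsilon>. norm (grad U x - grad U y) \<le> A * dist x y powr (1 / 3)"
    using A \<epsilon> by (auto simp: g)
  have "continuous_on (ball 0 \<epsilon>) gradU"
  proof (rule continuous_at_imp_continuous_on, rule ballI)
    fix x assume "x \<in> ball (0::real^3) \<epsilon>"
    then have x: "norm x < \<rho>"
      using \<epsilon> by simp
    then have sx: "\<bar>\<sigma> x\<bar> \<le> \<delta>"
      using sigma(2) by simp
    show "isCont gradU x"
      unfolding isCont_def gradU_def
      by (intro tendsto_vec_lambda tendsto_intros sh_tendsto compose_sigma_tendsto x isCont_m sx)
  qed
  then have "continuous_on (ball 0 \<epsilon>) (grad U)"
    by (rule continuous_on_cong[THEN iffD1, rotated -1]) (use \<epsilon> in \<open>auto simp: g\<close>)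
  then show "C1_Hoelder_on (1 / 3) (ball 0 \<epsilon>) U"
    unfolding C1_Hoelder_on_def using bound diff \<epsilon> by auto
  show "\<not> C1_Hoelder_on \<alpha> (ball 0 \<epsilon>) U" if "\<alpha> > 1 / 3" for \<alpha>
  proof
    assume "C1_Hoelder_on \<alpha> (ball 0 \<epsilon>) U"
    then obtain A where A: "\<forall>x\<in>ball 0 \<epsilon>. \<forall>y\<in>ball 0 \<epsilon>. norm (grad U x - grad U y) \<le> A * dist x y powr \<alpha>"
      unfolding C1_Hoelder_on_def by blast
    have "norm (gradU x - gradU y) \<le> A * dist x y powr \<alpha>" if "norm x < \<epsilon>" "norm y < \<epsilon>" for x y
      using A[rule_format, of x y] that \<epsilon> by (simp add: g)
    then show False
      using gradU_not_Hoelder[OF \<epsilon>(1) _ that] \<epsilon> by (meson less_imp_le)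
  qed
qed

end

section \<open>Real analytic functions\<close>

lemma has_sum_fibers:
  fixes f :: "'i \<Rightarrow> real" and e :: "'i \<Rightarrow> 'j"
  assumes "(f has_sum S) I" "\<And>\<alpha>. (f has_sum b \<alpha>) {i \<in> I. e i = \<alpha>}"
  shows "(b has_sum S) UNIV"
proof (rule has_sum_SigmaD)
  show "((\<lambda>(\<alpha>, i). f i) has_sum S) (Sigma UNIV (\<lambda>\<alpha>. {i \<in> I. e i = \<alpha>}))"
    using assms(1) by (subst has_sum_reindex_bij_witness[where i = "\<lambda>i. (e i, i)" and j = snd and T = I and h = f]) auto
  show "((\<lambda>y. case (\<alpha>, y) of (\<alpha>, i) \<Rightarrow> f i) has_sum b \<alpha>) {i \<in> I. e i = \<alpha>}" for \<alpha>
    using assms(2) by simp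
qed

abbreviation monomial :: "(3 \<Rightarrow> nat) \<Rightarrow> real^3 \<Rightarrow> real" where
  "monomial \<alpha> x \<equiv> \<Prod>j\<in>UNIV. (x $ j) ^ \<alpha> j"

lemma real_analytic_at_iff:
  "real_analytic_at g a \<longleftrightarrow> (\<exists>r>0. \<exists>c. \<forall>x\<in>ball a r. ((\<lambda>\<alpha>. c \<alpha> * monomial \<alpha> (x - a)) has_sum g x) UNIV)"
  by (simp add: real_analytic_at_def)

text \<open>The terms may come from any family of monomials, with repeated exponents; those with the
  same exponent are collected. Summability of the weighted moduli makes each collected coefficient
  converge.\<close>

lemma real_analytic_atI:
  fixes d :: "'i \<Rightarrow> real" and e :: "'i \<Rightarrow> 3 \<Rightarrow> nat"
  assumes r: "r > 0" and summ: "(\<lambda>i. \<bar>d i\<bar> * r ^ (\<Sum>j\<in>UNIV. e i j)) summable_on I"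
    and sum: "\<And>x. x \<in> ball a r \<Longrightarrow> ((\<lambda>i. d i * monomial (e i) (x - a)) has_sum g x) I"
  shows "real_analytic_at g a"
proof -
  define C where "C = (\<lambda>\<alpha>. infsum d {i \<in> I. e i = \<alpha>})"
  have "((\<lambda>\<alpha>. C \<alpha> * monomial \<alpha> (x - a)) has_sum g x) UNIV" if x: "x \<in> ball a r" for x
  proof (rule has_sum_fibers[OF sum[OF x]])
    fix \<alpha>
    have "(\<lambda>i. \<bar>d i\<bar> * r ^ (\<Sum>j\<in>UNIV. e i j)) summable_on {i \<in> I. e i = \<alpha>}"
      by (rule summable_on_subset_banach[OF summ]) auto
    then have "(\<lambda>i. \<bar>d i\<bar> * r ^ sum \<alpha> UNIV) summable_on {i \<in> I. e i = \<alpha>}"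
      by (rule summable_on_cong[THEN iffD1, rotated]) auto
    then have "(\<lambda>i. (\<bar>d i\<bar> * r ^ sum \<alpha> UNIV) * inverse (r ^ sum \<alpha> UNIV)) summable_on {i \<in> I. e i = \<alpha>}"
      by (rule summable_on_cmult_left)
    then have "(\<lambda>i. norm (d i)) summable_on {i \<in> I. e i = \<alpha>}"
      using r by (simp add: mult.assoc)
    then have "d summable_on {i \<in> I. e i = \<alpha>}"
      by (rule abs_summable_summable)
    then have "(d has_sum C \<alpha>) {i \<in> I. e i = \<alpha>}"
      unfolding C_def by (rule has_sum_infsum)
    then have "((\<lambda>i. d i * monomial \<alpha> (x - a)) has_sum (C \<alpha> * monomial \<alpha> (x - a)))
        {i \<in> I. e i = \<alpha>}"
      by (rule has_sum_cmult_left)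
    then show "((\<lambda>i. d i * monomial (e i) (x - a)) has_sum (C \<alpha> * monomial \<alpha> (x - a)))
        {i \<in> I. e i = \<alpha>}"
      by (rule has_sum_cong[THEN iffD1, rotated]) auto
  qed
  then show ?thesis
    unfolding real_analytic_at_iff using r by blast
qed

text \<open>All monomials of a given total degree agree at the point whose coordinates exceed those
  of \<open>a\<close> by \<open>r\<close>. Unordered convergence at that one point already gives the
  weighted summability.\<close>

lemma real_analytic_atE:
  assumes "real_analytic_at g a"
  obtains r C where "r > 0" "(\<lambda>\<alpha>::3 \<Rightarrow> nat. \<bar>C \<alpha>\<bar> * r ^ sum \<alpha> UNIV) summable_on UNIV"
    "\<And>x. x \<in> ball a r \<Longrightarrow> ((\<lambda>\<alpha>. C \<alpha> * monomial \<alpha> (x - a)) has_sum g x) UNIV"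
proof -
  obtain R C where R: "R > 0" and sum: "\<And>x. x \<in> ball a R \<Longrightarrow>
      ((\<lambda>\<alpha>. C \<alpha> * monomial \<alpha> (x - a)) has_sum g x) UNIV"
    using assms unfolding real_analytic_at_iff by blast
  define r where "r = R / 4"
  have r0: "r > 0"
    using R by (simp add: r_def)
  define x where "x = (\<chi> j. a $ j + r)"
  have "norm (x - a) \<le> (\<Sum>j\<in>UNIV. \<bar>(x - a) $ j\<bar>)"
    by (rule norm_le_l1_cart)
  also have "\<dots> = 3 * r"
    using R by (simp add: x_def r_def)
  finally have "x \<in> ball a R"
    using R by (simp add: r_def dist_norm norm_minus_commute)
  from sum[OF this] have "(\<lambda>\<alpha>. C \<alpha> * (\<Prod>j\<in>UNIV. r ^ \<alpha> j)) summable_on UNIV"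
    unfolding x_def by (auto intro: has_sum_imp_summable)
  then have "(\<lambda>\<alpha>. C \<alpha> * r ^ sum \<alpha> UNIV) summable_on UNIV"
    by (simp add: power_sum)
  then have "(\<lambda>\<alpha>. norm (C \<alpha> * r ^ sum \<alpha> UNIV)) summable_on UNIV"
    by (rule summable_on_iff_abs_summable_on_real[THEN iffD1])
  then have "(\<lambda>\<alpha>. \<bar>C \<alpha>\<bar> * r ^ sum \<alpha> UNIV) summable_on UNIV"
    using r0 by (simp add: abs_mult)
  moreover have "x \<in> ball a R" if "x \<in> ball a r" for x
    using that R by (simp add: r_def)
  ultimately show thesis
    using r0 sum by (intro that[of r C]) blast+
qed

lemma real_analytic_at_cong:
  assumes "real_analytic_at f a" "\<forall>\<^sub>F x in nhds a. f x = g x"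
  shows "real_analytic_at g a"
proof -
  obtain r C where r: "r > 0" "\<And>x. x \<in> ball a r \<Longrightarrow>
      ((\<lambda>\<alpha>. C \<alpha> * monomial \<alpha> (x - a)) has_sum f x) UNIV"
    using assms(1) unfolding real_analytic_at_iff by blast
  obtain e where e: "e > 0" "\<And>x. dist x a < e \<Longrightarrow> f x = g x"
    using assms(2) unfolding eventually_nhds_metric by blast
  have "((\<lambda>\<alpha>. C \<alpha> * monomial \<alpha> (x - a)) has_sum g x) UNIV" if "x \<in> ball a (min r e)" for x
    using r(2)[of x] e(2)[of x] that by (simp add: dist_commute)
  then show ?thesis
    unfolding real_analytic_at_iff using r(1) e(1) by (intro exI[of _ "min r e"] conjI exI[of _ C]) auto
qed

lemma real_analytic_at_add:
  assumes "real_analytic_at f a" "real_analytic_at g a"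
  shows "real_analytic_at (\<lambda>x. f x + g x) a"
proof -
  obtain r C where r: "r > 0" "\<And>x. x \<in> ball a r \<Longrightarrow>
      ((\<lambda>\<alpha>. C \<alpha> * monomial \<alpha> (x - a)) has_sum f x) UNIV"
    using assms(1) unfolding real_analytic_at_iff by blast
  obtain s D where s: "s > 0" "\<And>x. x \<in> ball a s \<Longrightarrow>
      ((\<lambda>\<alpha>. D \<alpha> * monomial \<alpha> (x - a)) has_sum g x) UNIV"
    using assms(2) unfolding real_analytic_at_iff by blast
  have "((\<lambda>\<alpha>. (C \<alpha> + D \<alpha>) * monomial \<alpha> (x - a)) has_sum f x + g x) UNIV"
    if "x \<in> ball a (min r s)" for x
    unfolding distrib_right using that by (intro has_sum_add r s) auto
  then show ?thesis
    unfolding real_analytic_at_iff using r(1) s(1)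
    by (intro exI[of _ "min r s"] conjI exI[of _ "\<lambda>\<alpha>. C \<alpha> + D \<alpha>"]) auto
qed

lemma real_analytic_at_mult:
  assumes "real_analytic_at f a" "real_analytic_at g a"
  shows "real_analytic_at (\<lambda>x. f x * g x) a"
proof -
  have *: "((\<lambda>(\<alpha>, \<beta>). u \<alpha> * v \<beta>) has_sum s * t) (UNIV \<times> UNIV)"
    if u: "(u has_sum s) UNIV" and v: "(v has_sum t) UNIV"
    for u v :: "(3 \<Rightarrow> nat) \<Rightarrow> real" and s t
  proof (rule has_sum_SigmaI)
    show "((\<lambda>\<beta>. case (\<alpha>, \<beta>) of (\<alpha>, \<beta>) \<Rightarrow> u \<alpha> * v \<beta>) has_sum u \<alpha> * t) UNIV" for \<alpha>
      using has_sum_cmult_right[OF v] by simp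
    show "((\<lambda>\<alpha>. u \<alpha> * t) has_sum s * t) UNIV"
      by (rule has_sum_cmult_left[OF u])
    have av: "((\<lambda>\<beta>. \<bar>v \<beta>\<bar>) has_sum (\<Sum>\<^sub>\<infinity>\<beta>. \<bar>v \<beta>\<bar>)) UNIV"
      using summable_on_iff_abs_summable_on_real[THEN iffD1, OF has_sum_imp_summable[OF v]] by simp
    have au: "(\<lambda>\<alpha>. \<bar>u \<alpha>\<bar>) summable_on UNIV"
      using summable_on_iff_abs_summable_on_real[THEN iffD1, OF has_sum_imp_summable[OF u]] by simp
    have "(\<lambda>(\<alpha>, \<beta>). \<bar>u \<alpha>\<bar> * \<bar>v \<beta>\<bar>) summable_on (UNIV \<times> UNIV)"
    proof (rule summable_on_SigmaI)
      show "((\<lambda>\<beta>. case (\<alpha>, \<beta>) of (\<alpha>, \<beta>) \<Rightarrow> \<bar>u \<alpha>\<bar> * \<bar>v \<beta>\<bar>) has_sum \<bar>u \<alpha>\<bar> * (\<Sum>\<^sub>\<infinity>\<beta>. \<bar>v \<beta>\<bar>)) UNIV" for \<alpha>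
        using has_sum_cmult_right[OF av] by simp
      show "(\<lambda>\<alpha>. \<bar>u \<alpha>\<bar> * (\<Sum>\<^sub>\<infinity>\<beta>. \<bar>v \<beta>\<bar>)) summable_on UNIV"
        by (rule summable_on_cmult_left[OF au])
    qed auto
    then have "(\<lambda>i. norm (case i of (\<alpha>, \<beta>) \<Rightarrow> u \<alpha> * v \<beta>)) summable_on (UNIV \<times> UNIV)"
      by (simp add: case_prod_unfold abs_mult)
    then show "(\<lambda>(\<alpha>, \<beta>). u \<alpha> * v \<beta>) summable_on (UNIV \<times> UNIV)"
      by (rule abs_summable_summable)
  qed
  obtain r C where r: "r > 0" "(\<lambda>\<alpha>::3 \<Rightarrow> nat. \<bar>C \<alpha>\<bar> * r ^ sum \<alpha> UNIV) summable_on UNIV"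
    "\<And>x. x \<in> ball a r \<Longrightarrow> ((\<lambda>\<alpha>. C \<alpha> * monomial \<alpha> (x - a)) has_sum f x) UNIV"
    by (rule real_analytic_atE[OF assms(1)]) (rule that)
  obtain s D where s: "s > 0" "(\<lambda>\<alpha>::3 \<Rightarrow> nat. \<bar>D \<alpha>\<bar> * s ^ sum \<alpha> UNIV) summable_on UNIV"
    "\<And>x. x \<in> ball a s \<Longrightarrow> ((\<lambda>\<alpha>. D \<alpha> * monomial \<alpha> (x - a)) has_sum g x) UNIV"
    by (rule real_analytic_atE[OF assms(2)]) (rule that)
  define t where "t = min r s"
  have t: "t > 0" "t \<le> r" "t \<le> s"
    using r s by (auto simp: t_def)
  have le: "(\<lambda>\<alpha>. \<bar>B \<alpha>\<bar> * t ^ sum \<alpha> UNIV) summable_on UNIV"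
    if "(\<lambda>\<alpha>::3 \<Rightarrow> nat. \<bar>B \<alpha>\<bar> * q ^ sum \<alpha> UNIV) summable_on UNIV" "t \<le> q" for B q
    by (rule summable_on_comparison_test[OF that(1)]) (use t that(2) in \<open>auto intro!: mult_left_mono power_mono\<close>)
  show ?thesis
  proof (rule real_analytic_atI[where I="UNIV \<times> UNIV" and d="\<lambda>(\<alpha>, \<beta>). C \<alpha> * D \<beta>" and e="\<lambda>(\<alpha>, \<beta>) j. \<alpha> j + \<beta> j", OF t(1)])
    have "((\<lambda>(\<alpha>, \<beta>). (\<bar>C \<alpha>\<bar> * t ^ sum \<alpha> UNIV) * (\<bar>D \<beta>\<bar> * t ^ sum \<beta> UNIV)) summable_on (UNIV \<times> UNIV))"
      using *[OF has_sum_infsum[OF le[OF r(2) t(2)]] has_sum_infsum[OF le[OF s(2) t(3)]]] by (rule has_sum_imp_summable)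
    then show "(\<lambda>i. \<bar>case i of (\<alpha>, \<beta>) \<Rightarrow> C \<alpha> * D \<beta>\<bar> * t ^ (\<Sum>j\<in>UNIV. (case i of (\<alpha>, \<beta>) \<Rightarrow> \<lambda>j. \<alpha> j + \<beta> j) j)) summable_on UNIV \<times> UNIV"
      by (simp add: case_prod_unfold abs_mult sum.distrib power_add ac_simps)
    fix x assume "x \<in> ball a t"
    then have "((\<lambda>(\<alpha>, \<beta>). (C \<alpha> * monomial \<alpha> (x - a)) * (D \<beta> * monomial \<beta> (x - a)))
        has_sum (f x * g x)) (UNIV \<times> UNIV)"
      using t by (intro * r(3) s(3)) auto
    then show "((\<lambda>i. (case i of (\<alpha>, \<beta>) \<Rightarrow> C \<alpha> * D \<beta>) * monomial (case i of (\<alpha>, \<beta>) \<Rightarrow> \<lambda>j. \<alpha> j + \<beta> j) (x - a))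
        has_sum f x * g x) (UNIV \<times> UNIV)"
      by (simp add: case_prod_unfold prod.distrib power_add ac_simps)
  qed
qed

lemma real_analytic_at_const: "real_analytic_at (\<lambda>x. k) a"
proof (rule real_analytic_atI[where I="{()}" and d="\<lambda>_. k" and e="\<lambda>_ _. 0" and r=1])
  show "((\<lambda>i. k * (\<Prod>j\<in>UNIV. ((x - a) $ j) ^ 0)) has_sum k) {()}" for x
    using has_sum_finite[of "{()}" "\<lambda>_. k"] by simp
qed auto

lemma real_analytic_at_nth: "real_analytic_at (\<lambda>x. x $ k) a"
proof -
  have "real_analytic_at (\<lambda>x. x $ k - a $ k) a"
  proof (rule real_analytic_atI[where I="{()}" and d="\<lambda>_. 1" and e="\<lambda>_ j. if j = k then 1 else 0" and r=1])
    have "(\<Prod>j\<in>UNIV. ((x - a) $ j) ^ (if j = k then 1 else 0)) = (\<Prod>j\<in>UNIV. if j = k then (x - a) $ j else 1)" for x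
      by (intro prod.cong) auto
    then show "((\<lambda>i. 1 * (\<Prod>j\<in>UNIV. ((x - a) $ j) ^ (if j = k then 1 else 0))) has_sum (x $ k - a $ k)) {()}" for x
      using has_sum_finite[of "{()}" "\<lambda>_. x $ k - a $ k"] by simp
  qed auto
  from real_analytic_at_add[OF this real_analytic_at_const[of "a $ k"]] show ?thesis
    by simp
qed

lemma real_analytic_at_sum:
  "finite S \<Longrightarrow> (\<And>i. i \<in> S \<Longrightarrow> real_analytic_at (f i) a) \<Longrightarrow> real_analytic_at (\<lambda>x. \<Sum>i\<in>S. f i x) a"
  by (induction S rule: finite_induct) (auto intro: real_analytic_at_const real_analytic_at_add)

section \<open>Expansion of contour integrals into power series\<close>

lemma sum_lists_length:
  fixes w :: "'k::finite \<Rightarrow> 'a::comm_semiring_1"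
  shows "(\<Sum>l | length l = n. prod_list (map w l)) = (\<Sum>k\<in>UNIV. w k) ^ n"
proof (induction n)
  case (Suc n)
  have "{l. length l = Suc n} = (\<lambda>(k, l). k # l) ` (UNIV \<times> {l :: 'k list. length l = n})"
    by (auto simp: length_Suc_conv image_iff)
  moreover have "inj_on (\<lambda>(k, l). k # l) (UNIV \<times> {l :: 'k list. length l = n})"
    by (auto simp: inj_on_def)
  ultimately have "(\<Sum>l | length l = Suc n. prod_list (map w l)) =
      (\<Sum>(k, l)\<in>UNIV \<times> {l. length l = n}. w k * prod_list (map w l))"
    by (simp add: sum.reindex case_prod_unfold)
  also have "\<dots> = (\<Sum>k\<in>UNIV. w k) * (\<Sum>l | length l = n. prod_list (map w l))"
    by (simp add: sum_product sum.cartesian_product)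
  finally show ?case
    by (simp add: Suc.IH)
qed simp

lemma finite_lists_length: "finite {l :: 'k::finite list. length l = n}"
  using finite_lists_length_eq[of "UNIV :: 'k set" n] by simp

lemma summable_on_lists:
  fixes w :: "'k::finite \<Rightarrow> real"
  assumes w: "\<And>k. w k \<ge> 0" and less: "(\<Sum>k\<in>UNIV. w k) < 1"
  shows "(\<lambda>l. prod_list (map w l)) summable_on UNIV"
proof -
  have nn: "prod_list (map w l) \<ge> 0" for l
    by (induction l) (auto simp: w)
  have "(\<lambda>(n, l). prod_list (map w l)) summable_on (SIGMA n:UNIV. {l. length l = n})"
  proof (rule summable_on_SigmaI)
    show "((\<lambda>l. case (n, l) of (n, l) \<Rightarrow> prod_list (map w l)) has_sum (\<Sum>k\<in>UNIV. w k) ^ n) {l. length l = n}" for n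
      using has_sum_finite[OF finite_lists_length[of n], of "\<lambda>l. prod_list (map w l)"] by (simp add: sum_lists_length)
    have "summable (\<lambda>n. (\<Sum>k\<in>UNIV. w k) ^ n)"
      using less w by (intro summable_geometric) (simp add: sum_nonneg)
    then show "(\<lambda>n. (\<Sum>k\<in>UNIV. w k) ^ n) summable_on UNIV"
      using w by (intro summable_nonneg_imp_summable_on zero_le_power sum_nonneg) auto
  qed (use nn in auto)
  then show ?thesis
    by (subst (asm) summable_on_reindex_bij_witness[where i = "\<lambda>l. (length l, l)" and j = snd and T = UNIV
        and h = "\<lambda>l. prod_list (map w l)"]) auto
qed

text \<open>The geometric series with its powers multiplied out into words. Words keep the order of
  the factors, so no multinomial coefficients occur; monomials that arise repeatedly are merged
  later by \<open>real_analytic_atI\<close>.\<close>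

lemma has_sum_lists:
  fixes w :: "'k::finite \<Rightarrow> complex"
  assumes less: "(\<Sum>k\<in>UNIV. norm (w k)) < 1"
  shows "((\<lambda>l. prod_list (map w l)) has_sum 1 / (1 - (\<Sum>k\<in>UNIV. w k))) UNIV"
proof -
  have n: "norm (prod_list (map w l)) = prod_list (map (\<lambda>k. norm (w k)) l)" for l
    by (induction l) (auto simp: norm_mult)
  have "(\<lambda>l. prod_list (map (\<lambda>k. norm (w k)) l)) summable_on UNIV"
    by (rule summable_on_lists[OF norm_ge_zero less])
  then have "(\<lambda>l. norm (prod_list (map w l))) summable_on UNIV"
    by (simp add: n)
  then have "(\<lambda>l. prod_list (map w l)) summable_on UNIV"
    by (rule abs_summable_summable)
  then obtain S where S: "((\<lambda>l. prod_list (map w l)) has_sum S) UNIV"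
    using has_sum_infsum by blast
  have "((\<lambda>n. (\<Sum>k\<in>UNIV. w k) ^ n) has_sum S) UNIV"
  proof (rule has_sum_SigmaD)
    show "((\<lambda>(n, l). prod_list (map w l)) has_sum S) (SIGMA n:UNIV. {l. length l = n})"
      using S by (subst has_sum_reindex_bij_witness[where i = "\<lambda>l. (length l, l)" and j = snd and T = UNIV
        and h = "\<lambda>l. prod_list (map w l)"]) auto
    show "((\<lambda>l. case (n, l) of (n, l) \<Rightarrow> prod_list (map w l)) has_sum (\<Sum>k\<in>UNIV. w k) ^ n) {l. length l = n}" for n
      using has_sum_finite[OF finite_lists_length[of n], of "\<lambda>l. prod_list (map w l)"] by (simp add: sum_lists_length)
  qed
  then have "(\<lambda>n. (\<Sum>k\<in>UNIV. w k) ^ n) sums S"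
    by (rule has_sum_imp_sums)
  moreover have "norm (\<Sum>k\<in>UNIV. w k) < 1"
    by (rule le_less_trans[OF norm_sum less])
  then have "(\<lambda>n. (\<Sum>k\<in>UNIV. w k) ^ n) sums (1 / (1 - (\<Sum>k\<in>UNIV. w k)))"
    by (rule geometric_sums)
  ultimately show ?thesis
    using S sums_unique2 by blast
qed

lemma has_sum_contour_integral_circlepath:
  fixes f :: "'i \<Rightarrow> complex \<Rightarrow> complex"
  assumes r: "r > 0" and cont: "\<And>i. continuous_on (sphere z r) (f i)"
    and bound: "\<And>i w. w \<in> sphere z r \<Longrightarrow> norm (f i w) \<le> W i" and W: "W summable_on UNIV"
    and sum: "\<And>w. w \<in> sphere z r \<Longrightarrow> ((\<lambda>i. f i w) has_sum F w) UNIV"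
  shows "((\<lambda>i. contour_integral (circlepath z r) (f i)) has_sum contour_integral (circlepath z r) F) UNIV"
proof -
  have int: "f i contour_integrable_on circlepath z r" for i
    using cont[of i] r by (intro contour_integrable_continuous_circlepath) simp
  have "((\<lambda>I. contour_integral (circlepath z r) (\<lambda>w. \<Sum>i\<in>I. f i w)) \<longlongrightarrow> contour_integral (circlepath z r) F)
      (finite_subsets_at_top UNIV)"
  proof (rule contour_integral_uniform_limit_circlepath(2))
    show "uniform_limit (sphere z r) (\<lambda>I w. \<Sum>i\<in>I. f i w) F (finite_subsets_at_top UNIV)"
      by (rule Weierstrass_m_test_general'[OF bound sum W])
    show "\<forall>\<^sub>F I in finite_subsets_at_top UNIV. (\<lambda>w. \<Sum>i\<in>I. f i w) contour_integrable_on circlepath z r"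
      by (rule eventually_finite_subsets_at_top_weakI) (auto intro!: contour_integrable_sum int)
  qed (use r in auto)
  moreover have "\<forall>\<^sub>F I in finite_subsets_at_top UNIV. contour_integral (circlepath z r) (\<lambda>w. \<Sum>i\<in>I. f i w) =
      (\<Sum>i\<in>I. contour_integral (circlepath z r) (f i))"
    by (rule eventually_finite_subsets_at_top_weakI) (auto intro!: contour_integral_sum int)
  ultimately show ?thesis
    unfolding has_sum_def by (rule Lim_transform_eventually)
qed

text \<open>The letters \<open>(j, False)\<close> and \<open>(j, True)\<close> stand for the monomials \<open>x j\<close> and
  \<open>(x j)\<^sup>2\<close> of a polynomial of degree two.\<close>

definition letter_deg :: "3 \<times> bool \<Rightarrow> 3 \<Rightarrow> nat" where
  "letter_deg k j = (if j = fst k then (if snd k then 2 else 1) else 0)"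

definition word_deg :: "(3 \<times> bool) list \<Rightarrow> 3 \<Rightarrow> nat" where
  "word_deg l j = (\<Sum>k\<leftarrow>l. letter_deg k j)"

lemma prod_list_monomials:
  fixes w :: "3 \<times> bool \<Rightarrow> 'a::comm_semiring_1"
  shows "prod_list (map (\<lambda>k. w k * (\<Prod>j\<in>UNIV. y j ^ letter_deg k j)) l) =
    prod_list (map w l) * (\<Prod>j\<in>UNIV. y j ^ word_deg l j)"
  by (induction l) (auto simp: word_deg_def power_add prod.distrib ac_simps)

lemma letter_monomial: "(\<Prod>j\<in>UNIV. y j ^ letter_deg k j) = (if snd k then (y (fst k))\<^sup>2 else y (fst k))"
  for y :: "3 \<Rightarrow> 'a::comm_semiring_1"
proof -
  have "(\<Prod>j\<in>UNIV. y j ^ letter_deg k j) = (\<Prod>j\<in>UNIV. if j = fst k then (if snd k then (y j)\<^sup>2 else y j) else 1)"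
    by (intro prod.cong) (auto simp: letter_deg_def)
  then show ?thesis
    by simp
qed

text \<open>Near \<open>a\<close> the denominator is \<open>G z\<close> times 1 - S, where S has six
  terms, each a continuous function of \<open>z\<close> times a letter monomial in
  \<open>x - a\<close>. Expanding 1 / (1 - S) over words and integrating termwise gives the series.
  The circle is compact, so all bounds are uniform.\<close>

lemma real_analytic_contour_integral:
  fixes p :: "3 \<Rightarrow> complex \<Rightarrow> complex" and \<phi> :: "complex \<Rightarrow> complex" and b :: "3 \<Rightarrow> real"
  assumes r: "r > 0" and p: "\<And>j. continuous_on (sphere z0 r) (p j)" and \<phi>: "continuous_on (sphere z0 r) \<phi>"
    and nz: "\<And>z. z \<in> sphere z0 r \<Longrightarrow> (\<Sum>j\<in>UNIV. p j z * of_real ((a $ j + b j)\<^sup>2)) - K \<noteq> 0"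
  shows "real_analytic_at (\<lambda>x. Re (contour_integral (circlepath z0 r)
    (\<lambda>z. \<phi> z / ((\<Sum>j\<in>UNIV. p j z * of_real ((x $ j + b j)\<^sup>2)) - K)) / (2 * of_real pi * \<i>))) a"
proof -
  let ?I = "contour_integral (circlepath z0 r)"
  let ?D = "\<lambda>(x :: real^3) z. (\<Sum>j\<in>UNIV. p j z * of_real ((x $ j + b j)\<^sup>2)) - K"
  define G where "G = (\<lambda>z. (\<Sum>j\<in>UNIV. p j z * of_real ((a $ j + b j)\<^sup>2)) - K)"
  \<comment> \<open>The coefficients of the linear and square terms of \<open>x - a\<close> in the
    expansion of \<open>(x $ j + b j)\<^sup>2\<close> about \<open>a\<close>, divided by
    \<open>- G z\<close>.\<close>
  define E where "E = (\<lambda>(k :: 3 \<times> bool) z. - (p (fst k) z * of_real (if snd k then 1 else 2 * (a $ fst k + b (fst k)))) / G z)"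
  have G: "continuous_on (sphere z0 r) G" "\<And>z. z \<in> sphere z0 r \<Longrightarrow> G z \<noteq> 0"
    unfolding G_def using nz by (auto intro!: continuous_intros p)
  have cE: "continuous_on (sphere z0 r) (E k)" for k
    unfolding E_def by (intro continuous_intros p G) (use G(2) in auto)
  have bounded: "\<exists>B>0. \<forall>z\<in>sphere z0 r. norm (f z) \<le> B" if "continuous_on (sphere z0 r) f" for f :: "complex \<Rightarrow> complex"
    using compact_imp_bounded[OF compact_continuous_image[OF that compact_sphere]] unfolding bounded_pos by auto
  obtain B where B: "B > 0" "\<And>z. z \<in> sphere z0 r \<Longrightarrow> norm (\<phi> z / G z) \<le> B"
    using bounded[OF continuous_on_divide[OF \<phi> G(1)]] G(2) by blast
  have "\<forall>k. \<exists>B>0. \<forall>z\<in>sphere z0 r. norm (E k z) \<le> B"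
    using bounded[OF cE] by blast
  then obtain M where M: "\<And>k. M k > 0" "\<And>k z. z \<in> sphere z0 r \<Longrightarrow> norm (E k z) \<le> M k"
    by metis
  define N where "N = (\<Sum>k\<in>UNIV. M k)"
  have N: "N > 0"
    unfolding N_def using M(1) by (intro sum_pos) auto
  \<comment> \<open>The bound 1 lets squared letters be estimated by \<open>\<rho>\<close> too; the
    other bound keeps the sum of the six majorants below 1.\<close>
  define \<rho> where "\<rho> = min 1 (1 / (2 * N))"
  have \<rho>: "\<rho> > 0" "\<rho> \<le> 1" "\<rho> * N < 1"
  proof -
    show "\<rho> > 0" "\<rho> \<le> 1"
      using N by (auto simp: \<rho>_def)
    have "\<rho> * N \<le> 1 / (2 * N) * N"
      using N by (intro mult_right_mono) (auto simp: \<rho>_def)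
    then show "\<rho> * N < 1"
      using N by simp
  qed
  define W where "W = (\<lambda>l. prod_list (map (\<lambda>k. M k * \<rho>) l))"
  have W: "W summable_on UNIV"
    unfolding W_def using M(1) \<rho> by (intro summable_on_lists) (auto simp: N_def mult.commute sum_distrib_left intro: less_imp_le)
  define c where "c = (\<lambda>l. ?I (\<lambda>z. \<phi> z / G z * prod_list (map (\<lambda>k. E k z) l)) / (2 * of_real pi * \<i>))"
  have cont: "continuous_on (sphere z0 r) (\<lambda>z. prod_list (map (\<lambda>k. E k z) l))" for l
    by (induction l) (auto intro!: continuous_intros cE)
  have cont': "continuous_on (sphere z0 r) (\<lambda>z. \<phi> z / G z * prod_list (map (\<lambda>k. E k z) l))" for l
    using G by (intro continuous_intros cont \<phi>) auto
  have EM: "norm (prod_list (map (\<lambda>k. E k z) l)) \<le> prod_list (map M l)" if "z \<in> sphere z0 r" for z l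
    by (induction l) (auto simp: norm_mult intro!: mult_mono M(2)[OF that] less_imp_le[OF M(1)])
  \<comment> \<open>Every letter has degree at least one, so \<open>\<rho>\<close> to the degree of
    a word is at most \<open>\<rho>\<close> to its length, which is the weight in
    \<open>W\<close>.\<close>
  have degs: "length l \<le> (\<Sum>j\<in>UNIV. word_deg l j)" for l
  proof (induction l)
    case (Cons k l)
    have "1 \<le> letter_deg k (fst k)"
      by (simp add: letter_deg_def)
    also have "\<dots> \<le> (\<Sum>j\<in>UNIV. letter_deg k j)"
      by (rule member_le_sum) auto
    finally show ?case
      using Cons by (simp add: word_deg_def sum.distrib)
  qed simp
  have WM: "W l = prod_list (map M l) * \<rho> ^ length l" for l
    by (induction l) (auto simp: W_def ac_simps)
  have Mpos: "prod_list (map M l) \<ge> 0" for l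
    by (induction l) (auto intro!: mult_nonneg_nonneg less_imp_le[OF M(1)])
  have WW: "prod_list (map M l) * \<rho> ^ (\<Sum>j\<in>UNIV. word_deg l j) \<le> W l" for l
    unfolding WM using \<rho> by (intro mult_left_mono power_decreasing degs Mpos) auto
  have cb: "norm (c l) \<le> B * r * prod_list (map M l)" for l
  proof -
    have "norm (?I (\<lambda>z. \<phi> z / G z * prod_list (map (\<lambda>k. E k z) l)))
        \<le> (B * prod_list (map M l)) * (2 * pi * r)"
    proof (rule has_contour_integral_bound_circlepath[OF has_contour_integral_integral])
      show "(\<lambda>z. \<phi> z / G z * prod_list (map (\<lambda>k. E k z) l)) contour_integrable_on circlepath z0 r"
        using cont'[of l] r by (intro contour_integrable_continuous_circlepath) simp
      show "norm (\<phi> z / G z * prod_list (map (\<lambda>k. E k z) l)) \<le> B * prod_list (map M l)" if "norm (z - z0) = r" for z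
        unfolding norm_mult using that B EM[of z l]
        by (intro mult_mono) (auto simp: dist_norm norm_minus_commute less_imp_le)
    qed (use r B Mpos[of l] in auto)
    then show ?thesis
      by (simp add: c_def norm_divide norm_mult field_simps)
  qed
  show ?thesis
  proof (rule real_analytic_atI[where d="\<lambda>l. Re (c l)" and e=word_deg and I=UNIV, OF \<rho>(1)])
    show "(\<lambda>l. \<bar>Re (c l)\<bar> * \<rho> ^ (\<Sum>j\<in>UNIV. word_deg l j)) summable_on UNIV"
    proof (rule summable_on_comparison_test[OF summable_on_cmult_right[OF W, of "B * r"]])
      fix l
      have "\<bar>Re (c l)\<bar> \<le> B * r * prod_list (map M l)"
        using cb[of l] abs_Re_le_cmod[of "c l"] by linarith
      then have "\<bar>Re (c l)\<bar> * \<rho> ^ (\<Sum>j\<in>UNIV. word_deg l j) \<le> (B * r * prod_list (map M l)) * \<rho> ^ (\<Sum>j\<in>UNIV. word_deg l j)"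
        using \<rho> by (intro mult_right_mono) auto
      also have "\<dots> = (B * r) * (prod_list (map M l) * \<rho> ^ (\<Sum>j\<in>UNIV. word_deg l j))"
        by simp
      also have "\<dots> \<le> (B * r) * W l"
        using WW[of l] B r by (intro mult_left_mono) auto
      finally show "\<bar>Re (c l)\<bar> * \<rho> ^ (\<Sum>j\<in>UNIV. word_deg l j) \<le> B * r * W l" .
    qed (use \<rho> in auto)
    fix x assume x: "x \<in> ball a \<rho>"
    define y where "y = (\<lambda>j. x $ j - a $ j)"
    have y: "\<bar>y j\<bar> \<le> \<rho>" for j
      using component_le_norm_cart[of "x - a" j] x by (simp add: y_def dist_norm norm_minus_commute)
    define w where "w = (\<lambda>k z. E k z * (\<Prod>j\<in>UNIV. of_real (y j) ^ letter_deg k j))"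
    have mon: "norm (\<Prod>j\<in>UNIV. (of_real (y j) :: complex) ^ letter_deg k j) \<le> \<rho>" for k
    proof -
      have "(y (fst k))\<^sup>2 \<le> \<rho> * \<rho>"
        using power_mono[OF y[of "fst k"], of 2] by (simp add: power2_eq_square)
      also have "\<dots> \<le> \<rho>"
        by (rule mult_left_le) (use \<rho> in auto)
      finally have "(y (fst k))\<^sup>2 \<le> \<rho>" .
      then show ?thesis
        using y[of "fst k"] by (simp add: letter_monomial norm_power)
    qed
    have wM: "norm (w k z) \<le> M k * \<rho>" if "z \<in> sphere z0 r" for k z
      unfolding w_def norm_mult by (intro mult_mono M(2) mon that less_imp_le[OF M(1)]) auto
    have split: "?D x z = G z * (1 - (\<Sum>k\<in>UNIV. w k z))"
      if z: "z \<in> sphere z0 r" for z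
    proof -
      define T where "T = (\<lambda>j. p j z * of_real (2 * (a $ j + b j) * y j + (y j)\<^sup>2))"
      have "(\<Sum>k\<in>UNIV. w k z) = (\<Sum>j\<in>UNIV. \<Sum>t\<in>UNIV. w (j, t) z)"
        by (simp add: UNIV_Times_UNIV[symmetric] sum.cartesian_product del: UNIV_Times_UNIV)
      also have "\<dots> = (\<Sum>j\<in>UNIV. - T j / G z)"
        by (intro sum.cong) (auto simp: T_def UNIV_bool w_def letter_monomial E_def add_divide_distrib diff_divide_distrib algebra_simps)
      finally have "G z * (\<Sum>k\<in>UNIV. w k z) = (\<Sum>j\<in>UNIV. - T j)"
        using G(2)[OF z] by (simp add: sum_distrib_left)
      then have "G z * (1 - (\<Sum>k\<in>UNIV. w k z)) = (\<Sum>j\<in>UNIV. p j z * of_real ((a $ j + b j)\<^sup>2) + T j) - K"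
        by (simp add: G_def right_diff_distrib sum_negf sum.distrib)
      also have "(\<Sum>j\<in>UNIV. p j z * of_real ((a $ j + b j)\<^sup>2) + T j) = (\<Sum>j\<in>UNIV. p j z * of_real ((x $ j + b j)\<^sup>2))"
      proof (intro sum.cong refl)
        show "p j z * of_real ((a $ j + b j)\<^sup>2) + T j = p j z * of_real ((x $ j + b j)\<^sup>2)" for j
          unfolding T_def distrib_left[symmetric] of_real_add[symmetric] by (simp add: y_def power2_eq_square algebra_simps)
      qed
      finally show ?thesis
        by simp
    qed
    have sums: "((\<lambda>l. \<phi> z / G z * prod_list (map (\<lambda>k. w k z) l)) has_sum
        \<phi> z / ?D x z) UNIV" if z: "z \<in> sphere z0 r" for z
    proof -
      have "(\<Sum>k\<in>UNIV. norm (w k z)) \<le> (\<Sum>k\<in>UNIV. M k * \<rho>)"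
        by (intro sum_mono wM z)
      also have "\<dots> < 1"
        using \<rho>(3) unfolding N_def sum_distrib_right[symmetric] by (simp only: mult.commute)
      finally show ?thesis
        unfolding split[OF z] using has_sum_cmult_right[OF has_sum_lists, of "\<lambda>k. w k z" "\<phi> z / G z"] by simp
    qed
    have "((\<lambda>l. ?I (\<lambda>z. \<phi> z / G z * prod_list (map (\<lambda>k. w k z) l))) has_sum
        ?I (\<lambda>z. \<phi> z / ?D x z)) UNIV"
    proof (rule has_sum_contour_integral_circlepath[OF r _ _ summable_on_cmult_right[OF W, of B] sums])
      show "continuous_on (sphere z0 r) (\<lambda>z. \<phi> z / G z * prod_list (map (\<lambda>k. w k z) l))" for l
        unfolding w_def prod_list_monomials mult.assoc[symmetric] by (intro continuous_intros cont'[of l, unfolded mult.assoc[symmetric]])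
      show "norm (\<phi> z / G z * prod_list (map (\<lambda>k. w k z) l)) \<le> B * W l" if "z \<in> sphere z0 r" for l z
      proof -
        have "norm (prod_list (map (\<lambda>k. w k z) l)) \<le> W l"
          unfolding W_def using \<rho> by (induction l)
            (auto simp: norm_mult intro!: mult_mono wM[OF that] mult_nonneg_nonneg less_imp_le[OF M(1)])
        then show ?thesis
          unfolding norm_mult using B that by (intro mult_mono) (auto intro: less_imp_le)
      qed
    qed
    from has_sum_cmult_left[OF this, of "inverse (2 * of_real pi * \<i>)"]
    have "((\<lambda>l. ?I (\<lambda>z. \<phi> z / G z * prod_list (map (\<lambda>k. w k z) l)) / (2 * of_real pi * \<i>)) has_sum
        ?I (\<lambda>z. \<phi> z / ?D x z) / (2 * of_real pi * \<i>)) UNIV"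
      by (simp only: divide_inverse)
    moreover have "?I (\<lambda>z. \<phi> z / G z * prod_list (map (\<lambda>k. w k z) l)) / (2 * of_real pi * \<i>) =
        c l * of_real (\<Prod>j\<in>UNIV. y j ^ word_deg l j)" for l
      unfolding w_def prod_list_monomials mult.assoc[symmetric] c_def
      by (subst contour_integral_rmul) (use cont'[of l] r in \<open>auto intro!: contour_integrable_continuous_circlepath\<close>)
    ultimately have "((\<lambda>l. c l * of_real (\<Prod>j\<in>UNIV. y j ^ word_deg l j)) has_sum
        ?I (\<lambda>z. \<phi> z / ?D x z) / (2 * of_real pi * \<i>)) UNIV"
      by simp
    from has_sum_Re[OF this] show "((\<lambda>l. Re (c l) * monomial (word_deg l) (x - a)) has_sum
        Re (?I (\<lambda>z. \<phi> z / ?D x z) / (2 * of_real pi * \<i>))) UNIV"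
      by (simp only: y_def vector_minus_component Re_complex_of_real times_complex.sel Im_complex_of_real mult_zero_right diff_zero)
  qed
qed

section \<open>Analyticity of the envelope\<close>

text \<open>The residue of \<open>H * f' / f\<close> at a simple zero. Dividing \<open>f\<close> by
  \<open>z - w\<close> leaves a holomorphic function without zeros on the closed disc, and Cauchy's
  formula applies to the quotient.\<close>

lemma simple_zero_contour_integral:
  assumes S: "open S" "cball z0 r \<subseteq> S" and f: "\<And>z. z \<in> S \<Longrightarrow> (f has_field_derivative f' z) (at z)"
    and f': "f' holomorphic_on S" and H: "H holomorphic_on S"
    and w: "w \<in> ball z0 r" "f w = 0" "f' w \<noteq> 0" and uniq: "\<And>z. z \<in> cball z0 r \<Longrightarrow> f z = 0 \<Longrightarrow> z = w"
  shows "contour_integral (circlepath z0 r) (\<lambda>z. H z * f' z / f z) = 2 * of_real pi * \<i> * H w"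
proof -
  define K where "K = (\<lambda>z. if z = w then deriv f w else (f z - f w) / (z - w))"
  have wS: "w \<in> S"
    using w S by auto
  have hf: "f holomorphic_on S"
    using holomorphic_on_open[OF S(1)] f by blast
  have K: "K holomorphic_on S"
    unfolding K_def by (rule pole_lemma[OF hf]) (use S wS in \<open>simp add: interior_open\<close>)
  have dw: "deriv f w = f' w"
    by (rule DERIV_imp_deriv[OF f[OF wS]])
  have K0: "K z \<noteq> 0" if "z \<in> cball z0 r" for z
  proof (cases "z = w")
    case True
    then show ?thesis
      using w(3) dw by (simp add: K_def)
  next
    case False
    then have "f z \<noteq> 0"
      using uniq[OF that] by blast
    then show ?thesis
      using False w(2) by (simp add: K_def)
  qed
  define g where "g = (\<lambda>z. H z * f' z / K z)"
  have "g holomorphic_on cball z0 r"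
    unfolding g_def by (intro holomorphic_on_divide holomorphic_on_mult holomorphic_on_subset[OF H S(2)]
        holomorphic_on_subset[OF f' S(2)] holomorphic_on_subset[OF K S(2)] K0)
  then have "((\<lambda>u. g u / (u - w)) has_contour_integral (2 * of_real pi * \<i> * g w)) (circlepath z0 r)"
    by (rule Cauchy_integral_circlepath_simple) (use w in \<open>simp add: dist_norm norm_minus_commute\<close>)
  moreover have "g w = H w"
    using w by (simp add: g_def K_def dw)
  moreover have "g u / (u - w) = H u * f' u / f u" if "u \<in> path_image (circlepath z0 r)" for u
  proof -
    have "r > 0"
      using w(1) by (metis ball_eq_empty empty_iff not_le)
    then have "u \<in> sphere z0 r"
      using that by simp
    then have "u \<noteq> w"
      using w by auto
    then show ?thesis
      by (simp add: g_def K_def w)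
  qed
  ultimately have "((\<lambda>u. H u * f' u / f u) has_contour_integral (2 * of_real pi * \<i> * H w)) (circlepath z0 r)"
    by (metis (no_types, lifting) has_contour_integral_eq)
  then show ?thesis
    by (rule contour_integral_unique)
qed

text \<open>Only the functions entering \<open>U\<close> and the contour integrals are extended:
  \<open>m\<close> and \<open>h\<close> for the value of \<open>\<Phi>\<close>, \<open>p\<close> and
  its derivative for the root.\<close>

locale analytic_envelope = envelope +
  fixes pc Pc mc :: "3 \<Rightarrow> complex \<Rightarrow> complex" and hc :: "complex \<Rightarrow> complex"
  assumes dpc: "\<And>j z. z \<in> ball 0 \<delta> \<Longrightarrow> (pc j has_field_derivative Pc j z) (at z)"
    and Pc: "\<And>j. Pc j holomorphic_on ball 0 \<delta>" and mc: "\<And>j. mc j holomorphic_on ball 0 \<delta>"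
    and hc: "hc holomorphic_on ball 0 \<delta>"
    and real_values: "\<And>j s. \<bar>s\<bar> < \<delta> \<Longrightarrow> pc j (of_real s) = of_real (p j s)"
      "\<And>j s. \<bar>s\<bar> < \<delta> \<Longrightarrow> Pc j (of_real s) = of_real (P j s)"
      "\<And>j s. \<bar>s\<bar> < \<delta> \<Longrightarrow> mc j (of_real s) = of_real (m j s)"
      "\<And>s. \<bar>s\<bar> < \<delta> \<Longrightarrow> hc (of_real s) = of_real (h s)"
begin

definition b :: "3 \<Rightarrow> real" where "b j = (if j = 1 then 1 else 0)"

lemma sh_b: "sh x j = x $ j + b j"
  by (simp add: sh_def b_def)

definition Gc :: "complex \<Rightarrow> real^3 \<Rightarrow> complex" where
  "Gc z x = (\<Sum>j\<in>UNIV. pc j z * of_real ((x $ j + b j)\<^sup>2)) - of_real K"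

definition GSc :: "complex \<Rightarrow> real^3 \<Rightarrow> complex" where
  "GSc z x = (\<Sum>j\<in>UNIV. Pc j z * of_real ((x $ j + b j)\<^sup>2))"

lemma Gc_of_real: "\<bar>s\<bar> < \<delta> \<Longrightarrow> Gc (of_real s) x = of_real (G s x)"
  by (simp add: Gc_def G_def real_values sh_b)

lemma GSc_of_real: "\<bar>s\<bar> < \<delta> \<Longrightarrow> GSc (of_real s) x = of_real (GS s x)"
  by (simp add: GSc_def GS_def real_values sh_b)

lemma DERIV_Gc: "z \<in> ball 0 \<delta> \<Longrightarrow> ((\<lambda>z. Gc z x) has_field_derivative GSc z x) (at z)"
  unfolding Gc_def GSc_def by (auto intro!: derivative_eq_intros dpc)

lemma GSc_holomorphic: "(\<lambda>z. GSc z x) holomorphic_on ball 0 \<delta>"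
  unfolding GSc_def by (intro holomorphic_intros Pc)

lemma pc_continuous: "continuous_on (ball 0 \<delta>) (pc j)"
  by (rule continuous_at_imp_continuous_on) (use dpc DERIV_isCont in blast)

lemma real_analytic_at_sh: "real_analytic_at (\<lambda>x. sh x k) a"
  unfolding sh_def by (intro real_analytic_at_add real_analytic_at_nth real_analytic_at_const)

text \<open>Locally \<open>\<sigma> x\<close> is the only zero of \<open>z \<mapsto> Gc z x\<close>, so a holomorphic function of it is a
  contour integral over a circle that does not depend on \<open>x\<close>.\<close>

lemma real_analytic_at_holomorphic_sigma:
  assumes x0: "norm x0 < \<rho>" "x0 \<noteq> 0" and H: "H holomorphic_on ball 0 \<delta>"
  shows "real_analytic_at (\<lambda>x. Re (H (of_real (\<sigma> x)))) x0"
proof -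
  define s0 where "s0 = complex_of_real (\<sigma> x0)"
  define l where "l = GS (\<sigma> x0) x0"
  have s0: "s0 \<in> ball 0 \<delta>" and l: "l > 0" and G0: "Gc s0 x0 = 0" "GSc s0 x0 = of_real l"
    using sigma[of x0] sigma_nonzero[of x0] x0 by (auto simp: s0_def l_def Gc_of_real GSc_of_real)
  have "isCont (\<lambda>z. GSc z x0) s0"
    using holomorphic_on_imp_continuous_on[OF GSc_holomorphic] s0 by (simp add: continuous_on_eq_continuous_at)
  then have "\<forall>\<^sub>F z in at s0. dist (GSc z x0) (of_real l) < l / 4"
    unfolding isCont_def G0(2) by (rule tendstoD) (use l in simp)
  then have e1: "\<forall>\<^sub>F z in nhds s0. dist (GSc z x0) (of_real l) < l / 4"
    using l by (simp add: eventually_nhds_conv_at G0)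
  have e2: "\<forall>\<^sub>F z in nhds s0. z \<in> ball 0 \<delta>"
    by (rule eventually_nhds_in_open[OF open_ball s0])
  obtain e where e: "e > 0" "\<And>z. dist z s0 < e \<Longrightarrow> dist (GSc z x0) (of_real l) < l / 4 \<and> z \<in> ball 0 \<delta>"
    using eventually_conj[OF e1 e2] unfolding eventually_nhds_metric by blast
  define r where "r = e / 2"
  have r: "r > 0" and sub: "cball s0 r \<subseteq> ball 0 \<delta>"
    and close: "\<And>z. z \<in> cball s0 r \<Longrightarrow> norm (GSc z x0 - of_real l) \<le> l / 4"
  proof -
    have "dist z s0 < e" if "z \<in> cball s0 r" for z
      using that e(1) by (simp add: r_def dist_commute)
    then show "cball s0 r \<subseteq> ball 0 \<delta>" "\<And>z. z \<in> cball s0 r \<Longrightarrow> norm (GSc z x0 - of_real l) \<le> l / 4"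
      using e(2) by (force simp: dist_norm)+
    show "r > 0"
      using e by (simp add: r_def)
  qed
  have "\<exists>B. \<forall>z\<in>cball s0 r. norm (Pc j z) \<le> B" for j
  proof -
    have "bounded (Pc j ` cball s0 r)"
      using holomorphic_on_imp_continuous_on[OF Pc] sub
      by (intro compact_imp_bounded compact_continuous_image) (auto intro: continuous_on_subset)
    then show ?thesis
      unfolding bounded_iff by auto
  qed
  then obtain B where B: "\<And>j z. z \<in> cball s0 r \<Longrightarrow> norm (Pc j z) \<le> B j"
    by metis
  \<comment> \<open>For such \<open>x\<close> the root stays inside the disc, and passing from
    \<open>x0\<close> to \<open>x\<close> changes the \<open>s\<close>-derivative of
    \<open>Gc\<close> by at most \<open>l / 4\<close> throughout the disc.\<close>
  define near where "near = (\<lambda>x. norm x < \<rho> \<and> x \<noteq> 0 \<and> dist (\<sigma> x) (\<sigma> x0) < r \<and>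
    (\<Sum>j\<in>UNIV. B j * \<bar>(sh x j)\<^sup>2 - (sh x0 j)\<^sup>2\<bar>) < l / 4)"
  have near: "\<forall>\<^sub>F x in nhds x0. near x"
  proof -
    have "((\<lambda>x. \<Sum>j\<in>UNIV. B j * \<bar>(sh x j)\<^sup>2 - (sh x0 j)\<^sup>2\<bar>) \<longlongrightarrow>
        (\<Sum>j\<in>UNIV. B j * \<bar>(sh x0 j)\<^sup>2 - (sh x0 j)\<^sup>2\<bar>)) (at x0)"
      by (intro tendsto_intros sh_tendsto)
    then have "\<forall>\<^sub>F x in at x0. (\<Sum>j\<in>UNIV. B j * \<bar>(sh x j)\<^sup>2 - (sh x0 j)\<^sup>2\<bar>) < l / 4"
      using l by (intro order_tendstoD(2)) auto
    moreover have "\<forall>\<^sub>F x in at x0. dist (\<sigma> x) (\<sigma> x0) < r"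
      using sigma_tendsto[OF x0(1)] r by (simp add: tendsto_iff)
    moreover have "\<forall>\<^sub>F x in at x0. x \<noteq> 0"
      using x0(2) by (intro tendsto_imp_eventually_ne[OF tendsto_ident_at])
    ultimately have "\<forall>\<^sub>F x in at x0. near x"
      using eventually_in_ball[OF x0(1)] unfolding near_def by eventually_elim simp
    moreover have "near x0"
      using x0 r l by (simp add: near_def)
    ultimately show ?thesis
      by (simp add: eventually_nhds_conv_at)
  qed
  have sigma_ball: "complex_of_real (\<sigma> x) \<in> ball s0 r" if "near x" for x
    using that unfolding s0_def near_def mem_ball dist_of_real by (simp add: dist_commute)
  \<comment> \<open>On the disc the derivative of \<open>Gc\<close> differs from the positive number
    \<open>l\<close> by at most \<open>l / 2\<close>. So \<open>Gc z x - of_real l * z\<close> has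
    Lipschitz constant \<open>l / 2\<close>, and \<open>Gc\<close> cannot vanish twice.\<close>
  have inj: "z = of_real (\<sigma> x)" if x: "near x" and z: "z \<in> cball s0 r" "Gc z x = 0" for x z
  proof -
    define w where "w = complex_of_real (\<sigma> x)"
    have w: "w \<in> cball s0 r" "Gc w x = 0"
    proof -
      show "w \<in> cball s0 r"
        using sigma_ball[OF x] by (simp add: w_def)
      show "Gc w x = 0"
        unfolding w_def using sigma[of x] x by (simp add: near_def Gc_of_real)
    qed
    have "norm ((Gc z x - of_real l * z) - (Gc w x - of_real l * w)) \<le> (l / 2) * norm (z - w)"
    proof (rule field_differentiable_bound[of "cball s0 r" "\<lambda>z. Gc z x - of_real l * z" "\<lambda>z. GSc z x - of_real l"])
      fix v assume v: "v \<in> cball s0 r"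
      have "((\<lambda>z. Gc z x) has_field_derivative GSc v x) (at v within cball s0 r)"
        by (rule has_field_derivative_at_within[OF DERIV_Gc]) (use v sub in blast)
      then show "((\<lambda>z. Gc z x - of_real l * z) has_field_derivative GSc v x - of_real l) (at v within cball s0 r)"
        by (auto intro!: derivative_eq_intros)
      have "GSc v x - GSc v x0 = (\<Sum>j\<in>UNIV. Pc j v * of_real ((sh x j)\<^sup>2 - (sh x0 j)\<^sup>2))"
        unfolding GSc_def sh_b by (simp only: sum_subtractf[symmetric] right_diff_distrib[symmetric] of_real_diff[symmetric])
      also have "norm \<dots> \<le> (\<Sum>j\<in>UNIV. norm (Pc j v * of_real ((sh x j)\<^sup>2 - (sh x0 j)\<^sup>2)))"
        by (rule norm_sum)
      also have "\<dots> \<le> (\<Sum>j\<in>UNIV. B j * \<bar>(sh x j)\<^sup>2 - (sh x0 j)\<^sup>2\<bar>)"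
        unfolding norm_mult norm_of_real by (intro sum_mono mult_right_mono B[OF v]) auto
      also have "\<dots> \<le> l / 4"
        using x by (simp add: near_def)
      finally have "norm (GSc v x - GSc v x0) \<le> l / 4" .
      then have "norm ((GSc v x - GSc v x0) + (GSc v x0 - of_real l)) \<le> l / 4 + l / 4"
        by (intro norm_triangle_mono close v)
      then show "norm (GSc v x - of_real l) \<le> l / 2"
        by simp
    qed (use z w in auto)
    then have "norm (of_real l * (w - z)) \<le> (l / 2) * norm (z - w)"
      using z w by (simp add: algebra_simps)
    then have "l * norm (z - w) \<le> (l / 2) * norm (z - w)"
      using l by (simp add: norm_mult norm_minus_commute)
    then have "norm (z - w) \<le> 0"
      using l by (simp add: field_simps)
    then show ?thesis
      by (simp add: w_def)
  qed
  \<comment> \<open>In the residue formula the numerator \<open>GSc\<close> depends on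
    \<open>x\<close>, but only through the squares of the \<open>sh x k\<close>. With these taken
    outside, the remaining integrals have numerators independent of \<open>x\<close>, as
    \<open>real_analytic_contour_integral\<close> requires.\<close>
  define An where "An = (\<lambda>k x. Re (contour_integral (circlepath s0 r) (\<lambda>z. (H z * Pc k z) / Gc z x) / (2 * of_real pi * \<i>)))"
  have contH: "continuous_on (sphere s0 r) H" and contP: "continuous_on (sphere s0 r) (Pc k)"
    and contp: "continuous_on (sphere s0 r) (pc k)" for k
    using holomorphic_on_imp_continuous_on[OF H] holomorphic_on_imp_continuous_on[OF Pc] pc_continuous sub
    by (meson continuous_on_subset order_trans sphere_cball)+
  have nz: "Gc z x \<noteq> 0" if "near x" "z \<in> sphere s0 r" for x z
  proof
    assume "Gc z x = 0"
    then have "z = of_real (\<sigma> x)"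
      using that by (intro inj) auto
    then show False
      using that(2) sigma_ball[OF that(1)] by simp
  qed
  have near0: "near x0"
    using near by (rule eventually_nhds_x_imp_x)
  have "real_analytic_at (An k) x0" for k
    unfolding An_def Gc_def
    by (rule real_analytic_contour_integral[OF r contp])
      (use nz[OF near0] in \<open>auto simp: Gc_def intro!: continuous_intros contH contP\<close>)
  then have an: "real_analytic_at (\<lambda>x. \<Sum>k\<in>UNIV. (sh x k * sh x k) * An k x) x0"
    by (intro real_analytic_at_sum real_analytic_at_mult real_analytic_at_sh) auto
  moreover have "\<forall>\<^sub>F x in nhds x0. (\<Sum>k\<in>UNIV. (sh x k * sh x k) * An k x) = Re (H (of_real (\<sigma> x)))"
    using near
  proof eventually_elim
    case (elim x)
    have nx: "norm x \<le> \<rho>"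
      using elim by (simp add: near_def)
    define w where "w = complex_of_real (\<sigma> x)"
    have w: "w \<in> ball s0 r"
      unfolding w_def by (rule sigma_ball[OF elim])
    have int: "(\<lambda>z. (H z * Pc k z) / Gc z x) contour_integrable_on circlepath s0 r" for k
    proof -
      have "continuous_on (sphere s0 r) (\<lambda>z. (H z * Pc k z) / Gc z x)"
        using nz[OF elim] unfolding Gc_def by (intro continuous_intros contH contP contp) auto
      then show ?thesis
        using r by (intro contour_integrable_continuous_circlepath) simp
    qed
    have "x \<noteq> 0"
      using elim by (simp add: near_def)
    then have pos: "GS (\<sigma> x) x > 0"
      by (rule sigma_nonzero[OF nx])
    have "contour_integral (circlepath s0 r) (\<lambda>z. H z * GSc z x / Gc z x) = 2 * of_real pi * \<i> * H w"
    proof (rule simple_zero_contour_integral[OF open_ball sub DERIV_Gc GSc_holomorphic H w])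
      show "Gc w x = 0" "GSc w x \<noteq> 0"
        unfolding w_def using sigma[OF nx] pos by (auto simp: Gc_of_real GSc_of_real)
      show "z = w" if "z \<in> cball s0 r" "Gc z x = 0" for z
        unfolding w_def using inj[OF elim that] .
    qed
    then have "H w = contour_integral (circlepath s0 r) (\<lambda>z. H z * GSc z x / Gc z x) / (2 * of_real pi * \<i>)"
      by simp
    also have "(\<lambda>z. H z * GSc z x / Gc z x) = (\<lambda>z. \<Sum>k\<in>UNIV. of_real (sh x k * sh x k) * ((H z * Pc k z) / Gc z x))"
      by (rule ext) (simp add: GSc_def sh_b power2_eq_square sum_distrib_left sum_divide_distrib ac_simps)
    also have "contour_integral (circlepath s0 r) \<dots> =
        (\<Sum>k\<in>UNIV. of_real (sh x k * sh x k) * contour_integral (circlepath s0 r) (\<lambda>z. (H z * Pc k z) / Gc z x))"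
      by (simp only: contour_integral_sum[OF finite_class.finite_UNIV contour_integrable_lmul[OF int]] contour_integral_lmul[OF int])
    finally have "H w = (\<Sum>k\<in>UNIV. of_real (sh x k * sh x k) *
        (contour_integral (circlepath s0 r) (\<lambda>z. (H z * Pc k z) / Gc z x) / (2 * of_real pi * \<i>)))"
      by (simp add: sum_divide_distrib)
    then show ?case
      unfolding w_def An_def by (simp only: Re_sum times_complex.sel Re_complex_of_real Im_complex_of_real) simp
  qed
  ultimately show ?thesis
    by (rule real_analytic_at_cong)
qed

lemma real_analytic_at_U:
  assumes x0: "norm x0 < \<rho>" "x0 \<noteq> 0"
  shows "real_analytic_at U x0"
proof (rule real_analytic_at_cong)
  show "real_analytic_at (\<lambda>x. (\<Sum>j\<in>UNIV. Re (mc j (of_real (\<sigma> x))) * (sh x j * sh x j)) * (1 / 2) + Re (hc (of_real (\<sigma> x)))) x0"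
    by (intro real_analytic_at_add real_analytic_at_mult real_analytic_at_sum real_analytic_at_sh
        real_analytic_at_const real_analytic_at_holomorphic_sigma x0 mc hc) auto
  have "\<forall>\<^sub>F x in nhds x0. x \<in> ball 0 \<rho>"
    using x0 by (intro eventually_nhds_in_open) auto
  then show "\<forall>\<^sub>F x in nhds x0. (\<Sum>j\<in>UNIV. Re (mc j (of_real (\<sigma> x))) * (sh x j * sh x j)) * (1 / 2) + Re (hc (of_real (\<sigma> x))) = U x"
  proof eventually_elim
    case (elim x)
    then have "\<bar>\<sigma> x\<bar> < \<delta>"
      using sigma(1) by simp
    then show ?case
      by (simp add: real_values U_def \<Phi>_def power2_eq_square)
  qed
qed

end

section \<open>Construction of the envelope\<close>

text \<open>One complex quadrature yields the real antiderivative and its holomorphic extension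
  together: on the real axis the imaginary part of the primitive has derivative 0 and starts at
  0.\<close>

lemma holomorphic_real_primitive:
  assumes r: "r > 0" and f: "f holomorphic_on ball 0 r" and real: "\<And>s. \<bar>s\<bar> < r \<Longrightarrow> f (of_real s) = of_real (g s)"
  obtains F u where "\<And>z. z \<in> ball 0 r \<Longrightarrow> (F has_field_derivative f z) (at z)"
    "\<And>s. \<bar>s\<bar> < r \<Longrightarrow> F (of_real s) = of_real (u s)"
    "\<And>s. \<bar>s\<bar> < r \<Longrightarrow> (u has_real_derivative g s) (at s)" "u 0 = 0"
proof -
  obtain F0 where F0: "\<And>z. z \<in> ball 0 r \<Longrightarrow> (F0 has_field_derivative f z) (at z within ball 0 r)"
    using holomorphic_convex_primitive'[OF convex_ball open_ball f] by blast
  define F where "F = (\<lambda>z. F0 z - F0 0)"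
  have F: "(F has_field_derivative f z) (at z)" if "z \<in> ball 0 r" for z
    using F0[OF that] that unfolding F_def by (auto simp: at_within_open[OF _ open_ball] intro!: derivative_eq_intros)
  define u v where "u = (\<lambda>s. Re (F (of_real s)))" and "v = (\<lambda>s. Im (F (of_real s)))"
  have vec: "((\<lambda>s. F (of_real s)) has_vector_derivative of_real (g s)) (at s)" if "\<bar>s\<bar> < r" for s
    using has_vector_derivative_real_field[OF F[of "of_real s"]] that by (simp add: real)
  have u: "(u has_real_derivative g s) (at s)" if "\<bar>s\<bar> < r" for s
    using has_field_derivative_Re[OF vec[OF that]] by (simp add: u_def)
  have v: "(v has_real_derivative 0) (at s)" if "\<bar>s\<bar> < r" for s
    using has_field_derivative_Im[OF vec[OF that]] by (simp add: v_def)
  have "\<exists>k. \<forall>s\<in>{-r<..<r}. v s = k"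
    by (rule has_field_derivative_zero_constant) (auto intro!: has_field_derivative_at_within[OF v])
  then obtain k where k: "\<And>s. \<bar>s\<bar> < r \<Longrightarrow> v s = k"
    by (auto simp: abs_less_iff)
  have "F 0 = 0"
    by (simp add: F_def)
  then have "v s = 0" if "\<bar>s\<bar> < r" for s
    using k[OF that] k[of 0] r by (simp add: v_def)
  then have "F (of_real s) = of_real (u s)" if "\<bar>s\<bar> < r" for s
    using that by (simp add: complex_eq_iff u_def v_def)
  moreover have "u 0 = 0"
    using \<open>F 0 = 0\<close> by (simp add: u_def)
  ultimately show thesis
    using that F u by blast
qed

text \<open>With m = tan of the angle and p = (1 + m^2) / (a + z), these formulas yield
  \<open>dm\<close> and \<open>P_eq\<close> of \<open>envelope\<close>. The general field serves the
  real functions and their complex extensions at once.\<close>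

lemma tan_family_derivatives:
  fixes F q :: "'a::{real_normed_field,banach} \<Rightarrow> 'a"
  assumes F: "(F has_field_derivative q z / (a + z)) (at z)" and nz: "cos (b + F z) \<noteq> 0" "a + z \<noteq> 0"
  shows "((\<lambda>z. tan (b + F z)) has_field_derivative q z * ((1 + (tan (b + F z))\<^sup>2) / (a + z))) (at z)"
    and "((\<lambda>z. (1 + (tan (b + F z))\<^sup>2) / (a + z)) has_field_derivative
      ((1 + (tan (b + F z))\<^sup>2) / (a + z)) * (2 * tan (b + F z) * q z - 1) / (a + z)) (at z)"
proof -
  have "((\<lambda>z. tan (b + F z)) has_field_derivative inverse ((cos (b + F z))\<^sup>2) * (q z / (a + z))) (at z)"
    by (rule DERIV_chain2[where f=tan and g="\<lambda>z. b + F z", OF DERIV_tan[OF nz(1)]]) (auto intro!: derivative_eq_intros F)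
  moreover have "inverse ((cos (b + F z))\<^sup>2) = 1 + (tan (b + F z))\<^sup>2"
    using nz(1) by (simp add: tan_sec power_inverse)
  ultimately show D: "((\<lambda>z. tan (b + F z)) has_field_derivative q z * ((1 + (tan (b + F z))\<^sup>2) / (a + z))) (at z)"
    by (simp add: ac_simps)
  have *: "((\<lambda>z. (1 + (M z)\<^sup>2) / (a + z)) has_field_derivative
      ((1 + (M z)\<^sup>2) / (a + z)) * (2 * M z * q z - 1) / (a + z)) (at z)"
    if "(M has_field_derivative q z * ((1 + (M z)\<^sup>2) / (a + z))) (at z)" for M
    by (rule derivative_eq_intros that refl nz(2) | simp)+
      (use nz(2) in \<open>simp add: field_simps power2_eq_square\<close>)
  show "((\<lambda>z. (1 + (tan (b + F z))\<^sup>2) / (a + z)) has_field_derivative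
      ((1 + (tan (b + F z))\<^sup>2) / (a + z)) * (2 * tan (b + F z) * q z - 1) / (a + z)) (at z)"
    by (rule *[OF D])
qed

text \<open>The derivative of \<open>x s - lo / 2 * s\<^sup>2\<close> is
  \<open>s * (r s - lo)\<close>, which has the sign of \<open>s\<close>, so the minimum is the value
  0 at 0. The upper bound is symmetric.\<close>

lemma quadratic_bounds:
  fixes x r :: "real \<Rightarrow> real"
  assumes x0: "x 0 = 0" and D: "\<And>s. \<bar>s\<bar> \<le> \<delta> \<Longrightarrow> (x has_real_derivative s * r s) (at s)"
    and r: "\<And>s. \<bar>s\<bar> \<le> \<delta> \<Longrightarrow> lo \<le> r s \<and> r s \<le> hi" and s: "\<bar>s\<bar> \<le> \<delta>"
  shows "lo / 2 * s\<^sup>2 \<le> x s" "x s \<le> hi / 2 * s\<^sup>2"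
proof -
  have nonneg: "0 \<le> y s" if y0: "y 0 = 0" and Dy: "\<And>s. \<bar>s\<bar> \<le> \<delta> \<Longrightarrow> (y has_real_derivative s * k s) (at s)"
    and k: "\<And>s. \<bar>s\<bar> \<le> \<delta> \<Longrightarrow> 0 \<le> k s" for y k :: "real \<Rightarrow> real"
  proof (cases "0 \<le> s")
    case True
    have "y 0 \<le> y s"
    proof (rule DERIV_nonneg_imp_nondecreasing[OF True])
      fix t assume t: "0 \<le> t" "t \<le> s"
      then have "\<bar>t\<bar> \<le> \<delta>"
        using s by auto
      then show "\<exists>y'. (y has_real_derivative y') (at t) \<and> 0 \<le> y'"
        using Dy k t(1) mult_nonneg_nonneg by blast
    qed
    then show ?thesis
      using y0 by simp
  next
    case False
    have "y 0 \<le> y s"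
    proof (rule DERIV_nonpos_imp_nonincreasing[of s 0])
      fix t assume t: "s \<le> t" "t \<le> 0"
      then have "\<bar>t\<bar> \<le> \<delta>"
        using s by auto
      then show "\<exists>y'. (y has_real_derivative y') (at t) \<and> y' \<le> 0"
        using Dy k t(2) mult_nonpos_nonneg by blast
    qed (use False in simp)
    then show ?thesis
      using y0 by simp
  qed
  have "0 \<le> x s - lo / 2 * s\<^sup>2"
  proof (rule nonneg[of "\<lambda>s. x s - lo / 2 * s\<^sup>2" "\<lambda>s. r s - lo"])
    show "((\<lambda>s. x s - lo / 2 * s\<^sup>2) has_real_derivative t * (r t - lo)) (at t)" if "\<bar>t\<bar> \<le> \<delta>" for t
      using D[OF that] by (auto intro!: derivative_eq_intros simp: algebra_simps)
  qed (use x0 r in auto)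
  then show "lo / 2 * s\<^sup>2 \<le> x s"
    by simp
  have "0 \<le> hi / 2 * s\<^sup>2 - x s"
  proof (rule nonneg[of "\<lambda>s. hi / 2 * s\<^sup>2 - x s" "\<lambda>s. hi - r s"])
    show "((\<lambda>s. hi / 2 * s\<^sup>2 - x s) has_real_derivative t * (hi - r t)) (at t)" if "\<bar>t\<bar> \<le> \<delta>" for t
      using D[OF that] by (auto intro!: derivative_eq_intros simp: algebra_simps)
  qed (use x0 r in auto)
  then show "x s \<le> hi / 2 * s\<^sup>2"
    by simp
qed

lemma sin_ge_half:
  fixes x :: real
  assumes "0 \<le> x" "x \<le> pi / 3"
  shows "x / 2 \<le> sin x"
proof -
  have "sin 0 - 0 / 2 \<le> sin x - x / 2"
  proof (rule DERIV_nonneg_imp_nondecreasing[OF assms(1)])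
    fix t assume t: "0 \<le> t" "t \<le> x"
    have "((\<lambda>x. sin x - x / 2) has_real_derivative cos t - 1 / 2) (at t)"
      by (auto intro!: derivative_eq_intros)
    moreover have "cos (pi / 3) \<le> cos t"
      using t assms pi_gt_zero by (intro cos_monotone_0_pi_le) auto
    ultimately show "\<exists>y. ((\<lambda>x. sin x - x / 2) has_real_derivative y) (at t) \<and> 0 \<le> y"
      by (intro exI[of _ "cos t - 1 / 2"]) (simp add: cos_60)
  qed
  then show ?thesis
    by simp
qed

text \<open>The real part that goes with \<open>sum_arctan_phase\<close>; the quotient of the two
  brackets is the tangent of the shifted angle.\<close>

lemma cos_arctan_sum:
  "cos (arctan a + arctan b + arctan c - \<theta>) =
    (cos \<theta> * (1 - (a * b + a * c + b * c)) + sin \<theta> * (a + b + c - a * b * c)) *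
    (cos (arctan a) * cos (arctan b) * cos (arctan c))"
proof -
  have s: "sin (arctan x) = x * cos (arctan x)" for x
    using tan_arctan[of x] by (simp add: tan_def nonzero_divide_eq_eq)
  show ?thesis
    by (simp add: cos_diff sin_add cos_add s algebra_simps)
qed

lemma phase_eqI:
  fixes a b c q \<theta> :: real
  assumes "sin (arctan a + arctan b + arctan c - \<theta>) = - 2 * q * cos (arctan a + arctan b + arctan c - \<theta>)"
  shows "cos \<theta> * (a + b + c - a * b * c) - sin \<theta> * (1 - (a * b + a * c + b * c)) =
    - 2 * q * (cos \<theta> * (1 - (a * b + a * c + b * c)) + sin \<theta> * (a + b + c - a * b * c))"
proof -
  define w where "w = cos (arctan a) * cos (arctan b) * cos (arctan c)"
  have "w \<noteq> 0"
    by (simp add: w_def)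
  moreover have "(cos \<theta> * (a + b + c - a * b * c) - sin \<theta> * (1 - (a * b + a * c + b * c))) * w =
    (- 2 * q * (cos \<theta> * (1 - (a * b + a * c + b * c)) + sin \<theta> * (a + b + c - a * b * c))) * w"
    using assms unfolding sum_arctan_phase cos_arctan_sum w_def by (simp only: mult.assoc)
  ultimately show ?thesis
    by (metis mult_right_cancel)
qed

text \<open>With \<open>h'\<close> proportional to \<open>q\<close>, the equation says that the angles \<open>\<beta> j = arctan (m j s)\<close> satisfy
  \<open>\<beta>' j = q / (a j + s)\<close> for constants \<open>a j\<close>, and that \<open>2 * q = cot y\<close> for
  \<open>y = \<beta> 1 + \<beta> 2 + \<beta> 3 - \<theta> + pi / 2\<close>. Then \<open>(\<Prod>j. a j + s) * (cos y)\<^sup>2\<close> is constant, which makes \<open>q\<close> explicit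
  and leaves two quadratures. The derivative of \<open>p 1\<close> vanishes at \<open>0\<close> if \<open>y = \<beta> 1\<close> there; it vanishes to
  second order because \<open>a 2 + a 3 = 0\<close>, and it has the right sign because \<open>\<beta> 2 = \<beta> 3 < \<beta> 1 < 0\<close> at \<open>0\<close>.\<close>

lemma analytic_envelope_exists:
  assumes \<theta>: "- pi / 2 < \<theta>" "\<theta> < pi / 2"
  shows "\<exists>p P m q h K \<delta> c C pc Pc mc hc. analytic_envelope p P m q h K \<delta> c C \<theta> pc Pc mc hc"
proof -
  \<comment> \<open>The common initial value of the second and third angles. That \<open>y\<close>
    equals the first angle at 0 means \<open>2 * b = \<theta> - pi / 2\<close>; the range of
    \<open>\<theta>\<close> corresponds to \<open>b\<close> between \<open>- pi / 2\<close> and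
    0.\<close>
  define b where "b = \<theta> / 2 - pi / 4"
  have b: "- (pi / 2) < b" "b < 0" and \<theta>_b: "\<theta> = 2 * b + pi / 2"
    using \<theta> by (auto simp: b_def)
  \<comment> \<open>The first angle starts at \<open>b / 2\<close>, a choice strictly between
    \<open>b\<close> and 0.\<close>
  define T T' where "T = tan (b / 2)" and "T' = tan b"
  have T: "T < 0" "T' < T"
    unfolding T_def T'_def using b by (auto intro!: tan_less_zero tan_monotone)
  \<comment> \<open>This is the value of \<open>p 1\<close> at 0. Since \<open>y\<close> starts at
    \<open>b / 2\<close>, it is also the constant of integration:
    \<open>(1 + s)\<^sup>2 * (1 - s) * (cos (y s))\<^sup>2 = 1 / K\<close>.\<close>
  define K where "K = 1 + T\<^sup>2"
  have K: "K > 0"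
    by (simp add: K_def add_pos_nonneg)
  \<comment> \<open>\<open>R\<close> is the square of \<open>tan y\<close> given by this first
    integral. With \<open>y\<close> between \<open>- pi / 2\<close> and 0, the relation
    \<open>2 * q = cot y\<close> becomes the formula for \<open>q\<close>.\<close>
  define R where "R = (\<lambda>s::real. K * ((1 + s)\<^sup>2 * (1 - s)) - 1)"
  define Rc where "Rc = (\<lambda>z::complex. of_real K * ((1 + z)\<^sup>2 * (1 - z)) - 1)"
  define q where "q = (\<lambda>s. - 1 / (2 * sqrt (R s)))"
  define qc where "qc = (\<lambda>z. - 1 / (2 * csqrt (Rc z)))"
  define a where "a = (\<lambda>j::3. if j = 3 then - 1 else 1 :: real)"
  define b0 where "b0 = (\<lambda>j::3. if j = 1 then b / 2 else b)"
  have a_simps: "a 1 = 1" "a 2 = 1" "a 3 = - 1" and b0_simps: "b0 1 = b / 2" "b0 2 = b" "b0 3 = b"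
    by (simp_all add: a_def b0_def)
  have Rc_R: "Rc (of_real s) = of_real (R s)" for s
    by (simp add: Rc_def R_def)

  have "isCont (\<lambda>z. Re (Rc z)) 0"
    unfolding Rc_def by (intro isCont_Re continuous_intros)
  moreover have "Re (Rc 0) > 0"
    using T by (simp add: Rc_def K_def)
  ultimately have "\<forall>\<^sub>F z in nhds 0. Re (Rc z) > 0"
    by (simp add: isCont_def eventually_nhds_conv_at order_tendstoD(1))
  then obtain e where e: "e > 0" "\<And>z. norm z < e \<Longrightarrow> Re (Rc z) > 0"
    unfolding eventually_nhds_metric by auto
  \<comment> \<open>The bound 1 / 2 keeps \<open>a j + z\<close> away from 0, because every
    \<open>a j\<close> has modulus 1.\<close>
  define \<delta>1 where "\<delta>1 = min e (1 / 2)"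
  have \<delta>1: "\<delta>1 > 0" "\<delta>1 \<le> 1 / 2" and Rc_pos: "\<And>z. z \<in> ball 0 \<delta>1 \<Longrightarrow> Re (Rc z) > 0"
    using e by (auto simp: \<delta>1_def)
  have R_pos: "R s > 0" if "\<bar>s\<bar> < \<delta>1" for s
    using Rc_pos[of "of_real s"] that by (simp add: Rc_R)
  have qc_q: "qc (of_real s) = of_real (q s)" if "\<bar>s\<bar> < \<delta>1" for s
  proof -
    have "csqrt (of_real (R s)) = of_real (sqrt (R s))"
      using R_pos[OF that] by (intro of_real_sqrt[symmetric]) simp
    then show ?thesis
      by (simp add: qc_def q_def Rc_R)
  qed
  have qc_hol: "qc holomorphic_on ball 0 \<delta>1"
  proof -
    have 1: "Rc z \<notin> \<real>\<^sub>\<le>\<^sub>0" if "z \<in> ball 0 \<delta>1" for z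
      using Rc_pos[OF that] unfolding complex_nonpos_Reals_iff by linarith
    have 2: "2 * csqrt (Rc z) \<noteq> 0" if "z \<in> ball 0 \<delta>1" for z
    proof -
      have "Rc z \<noteq> 0"
        using Rc_pos[OF that] by (metis less_irrefl zero_complex.sel(1))
      then show ?thesis
        by simp
    qed
    have "Rc holomorphic_on ball 0 \<delta>1"
      unfolding Rc_def by (intro holomorphic_intros)
    then show ?thesis
      unfolding qc_def by (intro holomorphic_on_divide holomorphic_on_mult holomorphic_on_const holomorphic_on_csqrt' 1 2)
  qed
  have ac: "of_real (a j) + z \<noteq> 0" if "z \<in> ball 0 \<delta>1" for j and z :: complex
  proof
    assume "of_real (a j) + z = 0"
    then have "norm z = 1"
      by (metis a_def add_eq_0_iff norm_minus_cancel norm_of_real norm_one of_real_1 of_real_minus)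
    then show False
      using that \<delta>1 by simp
  qed
  have ar: "a j + s \<noteq> 0" if "\<bar>s\<bar> < \<delta>1" for j s
    using that \<delta>1 by (auto simp: a_def)

  have "\<exists>F u. (\<forall>z\<in>ball 0 \<delta>1. (F has_field_derivative qc z / (of_real (a j) + z)) (at z)) \<and>
      (\<forall>s. \<bar>s\<bar> < \<delta>1 \<longrightarrow> F (of_real s) = of_real (u s)) \<and>
      (\<forall>s. \<bar>s\<bar> < \<delta>1 \<longrightarrow> (u has_real_derivative q s / (a j + s)) (at s)) \<and> u 0 = 0" for j
  proof -
    have hol: "(\<lambda>z. qc z / (of_real (a j) + z)) holomorphic_on ball 0 \<delta>1"
      by (intro holomorphic_on_divide qc_hol holomorphic_intros ac)
    have real: "qc (of_real s) / (of_real (a j) + of_real s) = of_real (q s / (a j + s))" if "\<bar>s\<bar> < \<delta>1" for s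
      using qc_q[OF that] by simp
    obtain F u where "\<And>z. z \<in> ball 0 \<delta>1 \<Longrightarrow> (F has_field_derivative qc z / (of_real (a j) + z)) (at z)"
      "\<And>s. \<bar>s\<bar> < \<delta>1 \<Longrightarrow> F (of_real s) = of_real (u s)"
      "\<And>s. \<bar>s\<bar> < \<delta>1 \<Longrightarrow> (u has_real_derivative q s / (a j + s)) (at s)" "u 0 = 0"
      by (rule holomorphic_real_primitive[OF \<delta>1(1) hol real]) (assumption, rule that)
    then show ?thesis
      by (intro exI[of _ F] exI[of _ u]) blast
  qed
  then obtain Fc f where "\<forall>j. (\<forall>z\<in>ball 0 \<delta>1. (Fc j has_field_derivative qc z / (of_real (a j) + z)) (at z)) \<and>
      (\<forall>s. \<bar>s\<bar> < \<delta>1 \<longrightarrow> Fc j (of_real s) = of_real (f j s)) \<and>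
      (\<forall>s. \<bar>s\<bar> < \<delta>1 \<longrightarrow> (f j has_real_derivative q s / (a j + s)) (at s)) \<and> f j 0 = 0"
    by metis
  then have Fc: "\<And>j z. z \<in> ball 0 \<delta>1 \<Longrightarrow> (Fc j has_field_derivative qc z / (of_real (a j) + z)) (at z)"
    and Fc_f: "\<And>j s. \<bar>s\<bar> < \<delta>1 \<Longrightarrow> Fc j (of_real s) = of_real (f j s)"
    and f: "\<And>j s. \<bar>s\<bar> < \<delta>1 \<Longrightarrow> (f j has_real_derivative q s / (a j + s)) (at s)" and f0: "\<And>j. f j 0 = 0"
    by blast+
  have hc_hol: "(\<lambda>z. of_real (- (K / 2)) * qc z) holomorphic_on ball 0 \<delta>1"
    by (intro holomorphic_intros qc_hol)
  have hc_real: "of_real (- (K / 2)) * qc (of_real s) = of_real (- (K / 2) * q s)" if "\<bar>s\<bar> < \<delta>1" for s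
    using qc_q[OF that] by simp
  obtain hc h where hc: "\<And>z. z \<in> ball 0 \<delta>1 \<Longrightarrow> (hc has_field_derivative of_real (- (K / 2)) * qc z) (at z)"
    and hc_h: "\<And>s. \<bar>s\<bar> < \<delta>1 \<Longrightarrow> hc (of_real s) = of_real (h s)"
    and h: "\<And>s. \<bar>s\<bar> < \<delta>1 \<Longrightarrow> (h has_real_derivative - (K / 2) * q s) (at s)"
    by (rule holomorphic_real_primitive[OF \<delta>1(1) hc_hol hc_real]) (assumption, rule that)

  define m where "m = (\<lambda>j s. tan (b0 j + f j s))"
  define p where "p = (\<lambda>j s. (1 + (m j s)\<^sup>2) / (a j + s))"
  define P where "P = (\<lambda>j s. p j s * (2 * m j s * q s - 1) / (a j + s))"
  define mc where "mc = (\<lambda>j z. tan (of_real (b0 j) + Fc j z))"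
  define pc where "pc = (\<lambda>j z. (1 + (mc j z)\<^sup>2) / (of_real (a j) + z))"
  define Pc where "Pc = (\<lambda>j z. pc j z * (2 * mc j z * qc z - 1) / (of_real (a j) + z))"
  have cos_b0: "cos (b0 j) > 0" for j
    using b by (intro cos_gt_zero_pi) (auto simp: b0_def)
  have Fc0: "Fc j 0 = 0" for j
    using Fc_f[of 0 j] \<delta>1 f0 by simp
  have "\<forall>\<^sub>F z in nhds 0. cos (of_real (b0 j) + Fc j z) \<noteq> 0" for j
  proof -
    have "isCont (\<lambda>z. cos (of_real (b0 j) + Fc j z)) 0"
      using DERIV_isCont[OF Fc[of 0 j]] \<delta>1 by (intro continuous_intros) auto
    moreover have "cos (of_real (b0 j) + Fc j 0) \<noteq> 0"
      using cos_b0[of j] by (simp add: Fc0 cos_of_real)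
    ultimately show ?thesis
      unfolding isCont_def by (simp add: eventually_nhds_conv_at tendsto_imp_eventually_ne)
  qed
  then have "\<forall>\<^sub>F z in nhds 0. \<forall>j. cos (of_real (b0 j) + Fc j z) \<noteq> 0"
    by (rule eventually_all_finite)
  then obtain \<delta>2 where \<delta>2: "\<delta>2 > 0" "\<And>z j. norm z < \<delta>2 \<Longrightarrow> cos (of_real (b0 j) + Fc j z) \<noteq> 0"
    unfolding eventually_nhds_metric by auto
  have cos_nz: "cos (b0 j + f j s) \<noteq> 0" if "\<bar>s\<bar> < \<delta>1" "\<bar>s\<bar> < \<delta>2" for j s
    using \<delta>2(2)[of "of_real s" j] that by (simp add: Fc_f cos_of_real flip: of_real_add)
  have real_derivs: "(m j has_real_derivative q s * p j s) (at s)" "(p j has_real_derivative P j s) (at s)"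
    if s: "\<bar>s\<bar> < \<delta>1" "\<bar>s\<bar> < \<delta>2" for j s
    using tan_family_derivatives[where F="f j" and q=q and z=s and a="a j" and b="b0 j", OF f[OF s(1), of j] cos_nz[OF s] ar[OF s(1)]]
    unfolding m_def p_def P_def by auto
  have complex_derivs: "(mc j has_field_derivative qc z * pc j z) (at z)" "(pc j has_field_derivative Pc j z) (at z)"
    if z: "z \<in> ball 0 \<delta>1" "norm z < \<delta>2" for j z
    using tan_family_derivatives[where F="Fc j" and q=qc and z=z and a="of_real (a j)" and b="of_real (b0 j)", OF Fc[OF z(1), of j] \<delta>2(2)[OF z(2)] ac[OF z(1)]]
    unfolding mc_def pc_def Pc_def by auto

  have q_neg: "q s < 0" if "\<bar>s\<bar> < \<delta>1" for s
    using R_pos[OF that] by (simp add: q_def)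
  have contq: "isCont q s" if "\<bar>s\<bar> < \<delta>1" for s
    unfolding q_def R_def using R_pos[OF that] by (intro continuous_intros) (auto simp: R_def)
  have q0: "2 * T * q 0 = 1"
    using T by (simp add: q_def R_def K_def)
  have contf: "isCont (f j) 0" and contm: "isCont (m j) 0" and contp: "isCont (p j) 0" for j
    using DERIV_isCont[OF f[of 0 j]] DERIV_isCont[OF real_derivs(1)[of 0 j]] DERIV_isCont[OF real_derivs(2)[of 0 j]] \<delta>1 \<delta>2(1)
    by auto
  have contP: "isCont (P j) s" if s: "\<bar>s\<bar> < \<delta>1" "\<bar>s\<bar> < \<delta>2" for j s
    unfolding P_def using DERIV_isCont[OF real_derivs(1)[OF s, of j]] DERIV_isCont[OF real_derivs(2)[OF s, of j]]
      contq[OF s(1)] ar[OF s(1), of j] by (intro continuous_intros)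

  \<comment> \<open>The difference of \<open>y\<close> and the first angle. Up to a factor that is
    positive near 0, its sine is \<open>P 1\<close>.\<close>
  define x where "x = (\<lambda>s. f 2 s + f 3 s)"
  define y where "y = (\<lambda>s. b / 2 + f 1 s + x s)"
  define r where "r = (\<lambda>s. - 2 * q s / (1 - s\<^sup>2))"
  have sq: "1 - s\<^sup>2 > 0" "1 + s > 0" "1 - s > 0" if "\<bar>s\<bar> < \<delta>1" for s
  proof -
    have "\<bar>s\<bar> < 1"
      using that \<delta>1 by simp
    then show "1 - s\<^sup>2 > 0" "1 + s > 0" "1 - s > 0"
      by (auto simp: abs_square_less_1)
  qed
  have Dx: "(x has_real_derivative s * r s) (at s)" if s: "\<bar>s\<bar> < \<delta>1" for s
  proof -
    have "(x has_real_derivative q s / (1 + s) + q s / (- 1 + s)) (at s)"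
      unfolding x_def using f[OF s, of 2] f[OF s, of 3] by (auto intro!: derivative_eq_intros simp: a_simps)
    moreover have "q s / (1 + s) + q s / (- 1 + s) = s * r s"
    proof -
      have "- 1 + s \<noteq> 0" "1 + s \<noteq> 0" "1 - s\<^sup>2 \<noteq> 0"
        using sq[OF s] by auto
      then show ?thesis
        unfolding r_def by (simp add: divide_simps power2_eq_square) algebra
    qed
    ultimately show ?thesis
      by simp
  qed
  \<comment> \<open>The first integral in differential form: the sum of both sides' difference has
    derivative 0 and vanishes at 0. This justifies in retrospect that \<open>q\<close>, introduced
    by a formula, is half the cotangent of \<open>y\<close>.\<close>
  have y_eq: "y s = - arctan (sqrt (R s))" if s: "\<bar>s\<bar> < \<delta>1" for s
  proof -
    have D: "((\<lambda>s. y s + arctan (sqrt (R s))) has_real_derivative 0) (at s)" if s: "\<bar>s\<bar> < \<delta>1" for s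
    proof -
      define w where "w = sqrt (R s)"
      have w: "w > 0" "w\<^sup>2 = R s"
        using R_pos[OF s] by (auto simp: w_def)
      have DR: "(R has_real_derivative K * (2 * (1 + s) * (1 - s) - (1 + s)\<^sup>2)) (at s)"
        unfolding R_def by (auto intro!: derivative_eq_intros simp: algebra_simps power2_eq_square)
      have Da: "((\<lambda>s. arctan (sqrt (R s))) has_real_derivative
          inverse (1 + w\<^sup>2) * (inverse w / 2 * (K * (2 * (1 + s) * (1 - s) - (1 + s)\<^sup>2)))) (at s)"
        unfolding w_def using R_pos[OF s]
        by (intro DERIV_chain2[OF DERIV_arctan] DERIV_chain2[OF DERIV_real_sqrt] DR)
      have Dy: "(y has_real_derivative q s / (1 + s) + s * r s) (at s)"
        unfolding y_def using f[OF s, of 1] Dx[OF s] by (auto intro!: derivative_eq_intros simp: a_simps)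
      have "q s / (1 + s) + s * r s + inverse (1 + w\<^sup>2) * (inverse w / 2 * (K * (2 * (1 + s) * (1 - s) - (1 + s)\<^sup>2))) = 0"
      proof -
        have nz: "1 + s \<noteq> 0" "1 - s \<noteq> 0" "w \<noteq> 0" "K \<noteq> 0"
          using sq[OF s] w K by auto
        have e1: "1 + w\<^sup>2 = K * ((1 + s) * ((1 + s) * (1 - s)))"
          unfolding w(2) R_def by (simp add: power2_eq_square algebra_simps)
        have e2: "1 - s\<^sup>2 = (1 + s) * (1 - s)"
          by (simp add: power2_eq_square algebra_simps)
        have e3: "q s = - (inverse w / 2)"
          by (simp add: q_def w_def inverse_eq_divide)
        have e4: "K * (2 * (1 + s) * (1 - s) - (1 + s)\<^sup>2) = K * ((1 + s) * (1 - 3 * s))"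
          by (simp add: power2_eq_square algebra_simps)
        show ?thesis
          unfolding r_def e1 e2 e3 e4 using nz by (simp add: divide_simps) (simp add: algebra_simps)
      qed
      then show ?thesis
        using DERIV_add[OF Dy Da] by simp
    qed
    have "\<exists>k. \<forall>s\<in>{-\<delta>1<..<\<delta>1}. y s + arctan (sqrt (R s)) = k"
      by (rule has_field_derivative_zero_constant) (auto intro!: has_field_derivative_at_within[OF D])
    then have "y s + arctan (sqrt (R s)) = y 0 + arctan (sqrt (R 0))"
      using s \<delta>1(1) by (auto simp: abs_less_iff)
    also have "sqrt (R 0) = - T"
      using T by (simp add: R_def K_def)
    also have "y 0 + arctan (- T) = 0"
      using b by (simp add: y_def x_def f0 T_def arctan_minus arctan_tan)
    finally show ?thesis
      by simp
  qed
  have y_bounds: "- (pi / 2) < y s" "y s < 0" "tan (y s) = - sqrt (R s)" if "\<bar>s\<bar> < \<delta>1" for s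
    using R_pos[OF that] arctan_bounded[of "sqrt (R s)"] by (auto simp: y_eq[OF that] tan_minus tan_arctan)
  have y_trig: "sin (y s) < 0" "2 * q s * sin (y s) = cos (y s)" if "\<bar>s\<bar> < \<delta>1" for s
  proof -
    show "sin (y s) < 0"
      using y_bounds[OF that] sin_gt_zero[of "- y s"] pi_gt_zero by simp
    have "cos (y s) > 0"
      using y_bounds[OF that] by (intro cos_gt_zero_pi) auto
    then have "sin (y s) = tan (y s) * cos (y s)"
      by (simp add: tan_def)
    then show "2 * q s * sin (y s) = cos (y s)"
      using R_pos[OF that] by (simp add: y_bounds[OF that] q_def)
  qed

  define g where "g = (\<lambda>s. (1 + (m 1 s)\<^sup>2) / ((1 + s)\<^sup>2 * cos (b / 2 + f 1 s) * (- sin (y s))))"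
  have P1_eq: "P 1 s = sin (x s) * g s" if s: "\<bar>s\<bar> < \<delta>1" "\<bar>s\<bar> < \<delta>2" for s
  proof -
    define \<beta> where "\<beta> = b / 2 + f 1 s"
    have nz: "cos \<beta> \<noteq> 0" "sin (y s) \<noteq> 0" "1 + s \<noteq> 0"
      using cos_nz[OF s, of 1] y_trig(1)[OF s(1)] sq(2)[OF s(1)] by (auto simp: \<beta>_def b0_simps)
    have "2 * tan \<beta> * q s - 1 = sin (x s) / (cos \<beta> * (- sin (y s)))"
    proof -
      have "sin (x s) = sin (y s - \<beta>)"
        by (simp add: y_def \<beta>_def)
      then have e: "sin (x s) = sin (y s) * cos \<beta> - cos (y s) * sin \<beta>"
        by (simp add: sin_diff)
      have "(2 * tan \<beta> * q s - 1) * (cos \<beta> * (- sin (y s))) = sin (y s) * cos \<beta> - (2 * q s * sin (y s)) * sin \<beta>"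
        using nz by (simp add: tan_def algebra_simps)
      also have "\<dots> = sin (x s)"
        unfolding y_trig(2)[OF s(1)] e ..
      finally show ?thesis
        using nz by (intro eq_divide_imp) simp_all
    qed
    then show ?thesis
      unfolding P_def p_def g_def using nz by (simp add: m_def a_simps b0_simps \<beta>_def power2_eq_square ac_simps)
  qed
  have contg: "isCont g 0"
    unfolding g_def y_def x_def using cos_nz[of 0 1] y_trig(1)[of 0] \<delta>1 \<delta>2(1)
    by (intro continuous_intros contf contm) (auto simp: b0_simps f0 y_def x_def)
  \<comment> \<open>\<open>\<kappa>\<close> is the common value of \<open>P 2\<close> and
    \<open>P 3\<close> at 0, positive because \<open>T'\<close> lies below the negative
    \<open>T\<close>. In it the sign of \<open>a 3\<close> disappears, as \<open>a j\<close> enters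
    \<open>P j\<close> squared.\<close>
  define g0 r0 \<kappa> where "g0 = g 0" and "r0 = r 0" and "\<kappa> = (1 + T'\<^sup>2) * (T' / T - 1)"
  have g0: "g0 > 0"
    unfolding g0_def g_def using cos_b0[of 1] y_trig(1)[of 0] \<delta>1
    by (intro divide_pos_pos mult_pos_pos) (auto simp: b0_simps f0 add_pos_nonneg)
  have r0: "r0 > 0"
    using q_neg[of 0] \<delta>1 by (simp add: r0_def r_def)
  have \<kappa>: "\<kappa> > 0"
    unfolding \<kappa>_def using T by (intro mult_pos_pos) (auto simp: add_pos_nonneg less_divide_eq)
  have P0: "P j 0 = \<kappa>" if "j \<noteq> 1" for j
  proof -
    have "q 0 = 1 / (2 * T)"
      using q0 T by (simp add: field_simps)
    then show ?thesis
      using that by (simp add: P_def p_def m_def \<kappa>_def b0_def a_def f0 T'_def)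
  qed
  \<comment> \<open>The bound on the angles lets \<open>arctan\<close> undo \<open>tan\<close>,
    \<open>x s < pi / 3\<close> is meant for \<open>sin_ge_half\<close>, and the two-sided bounds on
    \<open>r\<close> and \<open>g\<close> give the quadratic bounds on \<open>P 1\<close>.\<close>
  define good where "good = (\<lambda>s. (\<forall>j. \<bar>b0 j + f j s\<bar> < pi / 2) \<and> x s < pi / 3 \<and>
    (r0 / 2 < r s \<and> r s < 2 * r0) \<and> (g0 / 2 < g s \<and> g s < 2 * g0) \<and> (\<forall>j. j \<noteq> 1 \<longrightarrow> \<kappa> / 2 < P j s))"
  have nhds_less: "\<forall>\<^sub>F s in nhds 0. k s < B" if "isCont k 0" "k 0 < B" for k :: "real \<Rightarrow> real" and B
    using that by (simp add: isCont_def eventually_nhds_conv_at order_tendstoD(2))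
  have nhds_gr: "\<forall>\<^sub>F s in nhds 0. B < k s" if "isCont k 0" "B < k 0" for k :: "real \<Rightarrow> real" and B
    using that by (simp add: isCont_def eventually_nhds_conv_at order_tendstoD(1))
  have "\<forall>\<^sub>F s in nhds 0. good s"
    unfolding good_def
  proof (intro eventually_conj eventually_all_finite)
    show "\<forall>\<^sub>F s in nhds 0. \<bar>b0 j + f j s\<bar> < pi / 2" for j
      by (rule nhds_less) (use b in \<open>auto intro!: continuous_intros contf simp: f0 b0_def\<close>)
    show "\<forall>\<^sub>F s in nhds 0. x s < pi / 3"
      by (rule nhds_less) (auto intro!: continuous_intros contf simp: x_def f0)
    have "isCont r 0"
      unfolding r_def using contq[of 0] \<delta>1 by (intro continuous_intros) auto
    then show "\<forall>\<^sub>F s in nhds 0. r0 / 2 < r s" "\<forall>\<^sub>F s in nhds 0. r s < 2 * r0"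
      using r0 by (auto intro!: nhds_less nhds_gr simp: r0_def)
    show "\<forall>\<^sub>F s in nhds 0. g0 / 2 < g s" "\<forall>\<^sub>F s in nhds 0. g s < 2 * g0"
      using g0 contg by (auto intro!: nhds_less nhds_gr simp: g0_def)
    show "\<forall>\<^sub>F s in nhds 0. j \<noteq> 1 \<longrightarrow> \<kappa> / 2 < P j s" for j
    proof (cases "j = 1")
      case False
      then have "\<forall>\<^sub>F s in nhds 0. \<kappa> / 2 < P j s"
        using P0[OF False] \<kappa> \<delta>1(1) \<delta>2(1) by (intro nhds_gr contP) auto
      then show ?thesis
        by eventually_elim simp
    qed simp
  qed
  then obtain \<delta>3 where \<delta>3: "\<delta>3 > 0" "\<And>s. \<bar>s\<bar> < \<delta>3 \<Longrightarrow> good s"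
    unfolding eventually_nhds_metric by auto
  define \<delta> where "\<delta> = min \<delta>1 (min \<delta>2 \<delta>3) / 2"
  have \<delta>: "\<delta> > 0" "\<delta> < \<delta>1" "\<delta> < \<delta>2" "\<delta> < \<delta>3"
    using \<delta>1 \<delta>2 \<delta>3 by (auto simp: \<delta>_def)
  \<comment> \<open>In the lower bound, \<open>x s\<close> is at least
    \<open>r0 / 4 * s\<^sup>2\<close>, and one factor 1 / 2 each is lost to the sine and to
    \<open>g\<close>, hence 16. The upper bound multiplies \<open>r0 * s\<^sup>2\<close> by
    \<open>2 * g0\<close>.\<close>
  define c C where "c = min (\<kappa> / 2) (g0 * r0 / 16)" and "C = 2 * g0 * r0"
  have ball: "z \<in> ball 0 \<delta>1" "norm z < \<delta>2" if "z \<in> ball 0 \<delta>" for z :: complex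
    using that \<delta> by auto
  have P1_bounds: "c * s\<^sup>2 \<le> P 1 s" "P 1 s \<le> C * s\<^sup>2" if s: "\<bar>s\<bar> \<le> \<delta>" for s
  proof -
    have s': "\<bar>s\<bar> < \<delta>1" "\<bar>s\<bar> < \<delta>2" and gs: "good s"
      using s \<delta> \<delta>3(2)[of s] by auto
    have D: "(x has_real_derivative t * r t) (at t)" if "\<bar>t\<bar> \<le> \<delta>" for t
      using that \<delta> by (intro Dx) auto
    have rt: "r0 / 2 \<le> r t \<and> r t \<le> 2 * r0" if "\<bar>t\<bar> \<le> \<delta>" for t
      using \<delta>3(2)[of t] that \<delta> by (auto simp: good_def)
    have "x 0 = 0"
      by (simp add: x_def f0)
    then have x: "r0 / 4 * s\<^sup>2 \<le> x s" "x s \<le> r0 * s\<^sup>2"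
      using quadratic_bounds[OF _ D rt s] by simp_all
    have x0: "0 \<le> x s"
      using order_trans[OF _ x(1)] r0 by simp
    have sinx: "x s / 2 \<le> sin (x s)" "sin (x s) \<le> x s"
      using sin_ge_half[OF x0] sin_x_le_x[OF x0] gs by (auto simp only: good_def less_imp_le)
    have g: "g0 / 2 \<le> g s" "g s \<le> 2 * g0"
      using gs by (auto simp: good_def)
    have "c * s\<^sup>2 \<le> (g0 * r0 / 16) * s\<^sup>2"
      by (intro mult_right_mono) (auto simp: c_def)
    also have "\<dots> = (r0 / 4 * s\<^sup>2 / 2) * (g0 / 2)"
      by simp
    also have "\<dots> \<le> sin (x s) * g s"
      using x sinx g g0 x0 r0 by (intro mult_mono) auto
    finally show "c * s\<^sup>2 \<le> P 1 s"
      by (simp add: P1_eq[OF s'])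
    have "sin (x s) * g s \<le> (r0 * s\<^sup>2) * (2 * g0)"
      using x sinx g g0 x0 r0 by (intro mult_mono) auto
    then show "P 1 s \<le> C * s\<^sup>2"
      by (simp add: P1_eq[OF s'] C_def ac_simps)
  qed
  have arctan_m: "arctan (m j s) = b0 j + f j s" if "\<bar>s\<bar> \<le> \<delta>" for j s
  proof -
    have "\<bar>b0 j + f j s\<bar> < pi / 2"
      using \<delta>3(2)[of s] that \<delta> by (auto simp: good_def)
    then show ?thesis
      unfolding m_def abs_less_iff by (intro arctan_tan) linarith+
  qed
  have sum_angle: "arctan (m 1 s) + arctan (m 2 s) + arctan (m 3 s) - \<theta> = y s - pi / 2" if "\<bar>s\<bar> \<le> \<delta>" for s
    using that by (simp add: arctan_m b0_simps y_def x_def \<theta>_b)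
  have "analytic_envelope p P m q h K \<delta> c C \<theta> pc Pc mc hc"
  proof
    show "0 < \<delta>" "0 < c" "0 < K"
      using \<delta> \<kappa> g0 r0 K by (auto simp: c_def)
    show "p 1 0 = K"
      by (simp add: p_def m_def b0_simps a_simps f0 K_def T_def)
    fix j s assume s: "\<bar>s\<bar> \<le> \<delta>"
    then have s': "\<bar>s\<bar> < \<delta>1" "\<bar>s\<bar> < \<delta>2"
      using \<delta> by auto
    show "(p j has_real_derivative P j s) (at s)" "(m j has_real_derivative q s * p j s) (at s)"
      by (rule real_derivs[OF s'])+
    show "(h has_real_derivative - (K / 2) * q s) (at s)"
      by (rule h[OF s'(1)])
    show "isCont (P j) s" "isCont q s"
      by (rule contP[OF s'] contq[OF s'(1)])+
    show "c * s\<^sup>2 \<le> P 1 s" "P 1 s \<le> C * s\<^sup>2"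
      by (rule P1_bounds[OF s])+
    show "c \<le> P j s" if "j \<noteq> 1"
      using \<delta>3(2)[of s] s \<delta> that by (auto simp: good_def c_def)
    show "q s < 0"
      by (rule q_neg[OF s'(1)])
    show "P j s * (1 + (m j s)\<^sup>2) = (p j s)\<^sup>2 * (2 * m j s * q s - 1)"
      unfolding P_def p_def by (simp add: power2_eq_square)
    \<comment> \<open>The sum of the angles minus \<open>\<theta>\<close> is
      \<open>y s - pi / 2\<close>, which lies between \<open>- pi\<close> and
      \<open>- pi / 2\<close>.\<close>
    have "\<theta> - pi < \<theta> + (y s - pi / 2)" "\<theta> + (y s - pi / 2) < \<theta>"
      using y_bounds[OF s'(1)] pi_gt_zero by linarith+
    then show "\<theta> - pi < arctan (m 1 s) + arctan (m 2 s) + arctan (m 3 s)"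
      "arctan (m 1 s) + arctan (m 2 s) + arctan (m 3 s) < \<theta>"
      using sum_angle[OF s] by linarith+
    show "cos \<theta> * (m 1 s + m 2 s + m 3 s - m 1 s * m 2 s * m 3 s)
        - sin \<theta> * (1 - (m 1 s * m 2 s + m 1 s * m 3 s + m 2 s * m 3 s)) =
      - 2 * q s * (cos \<theta> * (1 - (m 1 s * m 2 s + m 1 s * m 3 s + m 2 s * m 3 s))
        + sin \<theta> * (m 1 s + m 2 s + m 3 s - m 1 s * m 2 s * m 3 s))"
      by (rule phase_eqI) (simp add: sum_angle[OF s] sin_diff cos_diff y_trig(2)[OF s'(1), symmetric])
  next
    fix j and z :: complex assume z: "z \<in> ball 0 \<delta>"
    show "(pc j has_field_derivative Pc j z) (at z)"
      by (rule complex_derivs(2)[OF ball[OF z]])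
  next
    fix j
    have hol: "mc j holomorphic_on ball 0 \<delta>" "pc j holomorphic_on ball 0 \<delta>" for j
      using complex_derivs[OF ball] unfolding holomorphic_on_open[OF open_ball] by blast+
    show "mc j holomorphic_on ball 0 \<delta>"
      by (rule hol)
    have "ball 0 \<delta> \<subseteq> ball (0::complex) \<delta>1"
      using \<delta> by auto
    then show "Pc j holomorphic_on ball 0 \<delta>"
      unfolding Pc_def using ac[OF ball(1)]
      by (intro holomorphic_on_divide holomorphic_on_mult holomorphic_on_diff hol holomorphic_on_subset[OF qc_hol] holomorphic_intros) auto
  next
    show "hc holomorphic_on ball 0 \<delta>"
      using hc[OF ball(1)] unfolding holomorphic_on_open[OF open_ball] by blast
  next
    fix j s assume "\<bar>s\<bar> < \<delta>"
    then have s: "\<bar>s\<bar> < \<delta>1"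
      using \<delta> by simp
    show mm: "mc j (of_real s) = of_real (m j s)"
      by (simp add: mc_def m_def Fc_f[OF s] tan_of_real flip: of_real_add)
    show pp: "pc j (of_real s) = of_real (p j s)"
      by (simp add: pc_def p_def mm)
    show "Pc j (of_real s) = of_real (P j s)"
      by (simp add: Pc_def P_def mm pp qc_q[OF s])
    show "hc (of_real s) = of_real (h s)"
      by (rule hc_h[OF s])
  qed
  then show ?thesis
    by blast
qed

theorem theorem4p1:
  fixes \<theta> :: real
  assumes "- pi / 2 < \<theta>" and "\<theta> < pi / 2"
  shows "\<exists>\<epsilon>>0. \<exists>f :: real^3 \<Rightarrow> real. real_analytic_on f (sphere 0 \<epsilon>) \<and>
    (\<exists>u. HL_solution (F_set \<theta>) 0 \<epsilon> f u \<and>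
      (\<forall>w. HL_solution (F_set \<theta>) 0 \<epsilon> f w \<longrightarrow> (\<forall>x\<in>cball 0 \<epsilon>. w x = u x)) \<and>
      C1_Hoelder_on (1/3) (ball 0 \<epsilon>) u \<and>
      (\<forall>\<delta>>1/3. \<not> C1_Hoelder_on \<delta> (ball 0 \<epsilon>) u))"
proof -
  obtain p P m q h K \<delta> c C pc Pc mc hc where "analytic_envelope p P m q h K \<delta> c C \<theta> pc Pc mc hc"
    using analytic_envelope_exists[OF assms] by blast
  then interpret analytic_envelope p P m q h K \<delta> c C \<theta> pc Pc mc hc .
  \<comment> \<open>\<open>U\<close> itself provides the boundary data. The sphere of radius
    \<open>\<rho> / 2\<close> avoids the origin, and halving keeps the closed ball inside the region
    where \<open>U\<close> is known to be differentiable.\<close>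
  have \<epsilon>: "0 < \<rho> / 2" "\<rho> / 2 < \<rho>"
    using rho(1) by auto
  have "real_analytic_on U (sphere 0 (\<rho> / 2))"
    unfolding real_analytic_on_def
  proof
    fix x assume "x \<in> sphere (0::real^3) (\<rho> / 2)"
    then have "real_analytic_at U x"
      using \<epsilon> by (intro real_analytic_at_U) auto
    then show "\<exists>g. real_analytic_at g x \<and> (\<exists>r>0. \<forall>y\<in>sphere 0 (\<rho> / 2) \<inter> ball x r. U y = g y)"
      using zero_less_one by blast
  qed
  then show ?thesis
    using U_solution[OF \<epsilon> assms] \<epsilon>(1)
    by (intro exI[of _ "\<rho> / 2"] conjI exI[of _ U]) auto
qed

end
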